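(* Let $k\in\{0,1\}$, $s\in\mathbb{C}$ and $v\in(0,1]$ satisfy one of the following three conditions: (i) $k=0$, $v\in(0,1)$, $\mathrm{Re}\,s\in(1,\infty)$, $\mathrm{Re}\,s\neq 3,5,7,\ldots$, and $s\notin\mathbb{N}$; (ii) $k=0$, $v=1$, and $\mathrm{Re}\,s\in\bigcup_{d\in\mathbb{Z}_+}(1+2d,2+2d)$; (iii) $k=1$, $v\in(0,1]$, $\mathrm{Re}\,s\in(0,\infty)$, $\mathrm{Re}\,s\neq 2,4,6,\ldots$, and $s\notin\mathbb{N}$. Let $f_{k,s,v}$ and $g_{k,s,v}$ be the functions on $\mathbb{R}$ defined in the context. Then: (a) If $\Phi((-1)^k,s,v)=0$, then $f_{k,s,v}-g_{k,s,v}\in L_p(\mathbb{R})$ for every $p\in(1/2,\infty)$. (b) If there exists $p\in(1/2,\infty)$ such that $f_{k,s,v}-g_{k,s,v}\in L_p(\mathbb{R})$, then $\Phi((-1)^k,s,v)=0$.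
   Context: $\mathbb{N}=\{1,2,\ldots\}$, $\mathbb{Z}_+=\{0,1,2,\ldots\}$. For $v>0$ and $z=\pm1$, $$\Phi(z,s,v)=\frac{1}{\Gamma(s)}\int_0^\infty\frac{t^{s-1}e^{(1-v)t}}{e^t-z}\,dt,$$ where $\mathrm{Re}\,s>1$ if $z=1$ and $\mathrm{Re}\,s>0$ if $z=-1$. Let $m_0:=\lfloor(\mathrm{Re}\,s-1)/2\rfloor$ and $m_1:=\lfloor(\mathrm{Re}\,s)/2\rfloor$. For $y\in\mathbb{R}$, $$f_{k,s,v}(y):=-\pi 2^{s-2}\left(\frac{|y|^s\sin[(2v-1)y-\pi k/2]}{\sin(\pi s/2)}+\frac{|y|^s\,\mathrm{sgn}(y)\cos[(2v-1)y-\pi k/2]}{\cos(\pi s/2)}\right),$$ $$g_{k,s,v}(y):=-\sin(y+\pi k/2)\Bigg(\sum_{j=1}^{m_k}(-1)^{j-1}\Gamma(s-2j)\,\Phi\big((-1)^k,s-2j,v\big)(2y)^{2j}+\frac{\pi 2^{s}y^{2(m_k+1)}}{\sin(\pi s)}\sum_{n=1-k}^\infty\frac{[\pi(n+k/2)]^{s-2m_k-1}\sin[\pi(2n+k)v+\pi s/2]}{y^2-[\pi(n+k/2)]^2}\Bigg).$$ Conventions: complex powers of positive reals are principal, $0^s=0$ when $\mathrm{Re}\,s>0$; the factor $\sin(y+\pi k/2)$ multiplies each term of the series, and at $y=\pm\pi(n+k/2)$ the product $\sin(y+\pi k/2)/(y^2-[\pi(n+k/2)]^2)$ is understood by continuity;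 the series is the limit of its partial sums (it need not converge absolutely); an empty sum is zero. For $0<p<\infty$, $L_p(\mathbb{R})$ is the space of measurable $F:\mathbb{R}\to\mathbb{C}$ with $\int_{\mathbb{R}}|F(y)|^p\,dy<\infty$ (also for $p<1$). *)

theory Defs
  imports "HOL-Analysis.Analysis"
begin

text \<open>The integral converges absolutely for \<open>v > 0\<close> and \<open>z = 1\<close>, \<open>Re s > 1\<close> or
  \<open>z = -1\<close>, \<open>Re s > 0\<close>; no meaning is attached to the value outside this range.\<close>

definition Phi :: "real \<Rightarrow> complex \<Rightarrow> real \<Rightarrow> complex" where
  "Phi z s v = 1 / Gamma s *
     (LINT t:{0<..}|lborel.
        complex_of_real t powr (s - 1) * complex_of_real (exp ((1 - v) * t))
          / (complex_of_real (exp t) - complex_of_real z))"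

text \<open>For \<open>k = 0\<close>, \<open>Re s \<ge> 1\<close> and for \<open>k = 1\<close>, \<open>Re s \<ge> 0\<close> the floor is nonnegative,
  so \<^const>\<open>nat\<close> does not truncate.\<close>

definition m_idx :: "nat \<Rightarrow> complex \<Rightarrow> nat" where
  "m_idx k s = (if k = 0 then nat \<lfloor>(Re s - 1) / 2\<rfloor> else nat \<lfloor>Re s / 2\<rfloor>)"

text \<open>In HOL \<open>0 powr s = 0\<close>, which is the convention wanted for \<open>\<bar>y\<bar> powr s\<close> at \<open>y = 0\<close>.\<close>

definition f_fun :: "nat \<Rightarrow> complex \<Rightarrow> real \<Rightarrow> real \<Rightarrow> complex" where
  "f_fun k s v y =
     - (complex_of_real pi * 2 powr (s - 2) *
        (complex_of_real \<bar>y\<bar> powr s * complex_of_real (sin ((2 * v - 1) * y - pi * real k / 2))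
            / sin (complex_of_real pi * s / 2)
         + complex_of_real \<bar>y\<bar> powr s * complex_of_real (sgn y)
             * complex_of_real (cos ((2 * v - 1) * y - pi * real k / 2))
            / cos (complex_of_real pi * s / 2)))"

definition node :: "nat \<Rightarrow> nat \<Rightarrow> real" where
  "node k n = pi * (real n + real k / 2)"

text \<open>The quotient \<open>sin (y + pi * k / 2) / (y\<^sup>2 - (node k n)\<^sup>2)\<close>, extended by continuity to
  \<open>y = node k n\<close> and \<open>y = - node k n\<close>, where numerator and denominator both vanish.\<close>

definition sin_quot :: "nat \<Rightarrow> nat \<Rightarrow> real \<Rightarrow> real" where
  "sin_quot k n y =
     (let q = (\<lambda>x. sin (x + pi * real k / 2) / (x\<^sup>2 - (node k n)\<^sup>2))
      in if y\<^sup>2 = (node k n)\<^sup>2 then Lim (at y) q else q y)"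

text \<open>The factor \<open>sin (y + pi * k / 2)\<close> is distributed over the terms of the series.
  The series starts at \<open>n = 1 - k\<close>, so the summation index is \<open>i\<close> with \<open>n = i + (1 - k)\<close>;
  \<^const>\<open>suminf\<close> is the limit of the partial sums and does not require absolute convergence.\<close>

definition g_fun :: "nat \<Rightarrow> complex \<Rightarrow> real \<Rightarrow> real \<Rightarrow> complex" where
  "g_fun k s v y = (let m = m_idx k s in
     - (complex_of_real (sin (y + pi * real k / 2)) *
          (\<Sum>j = 1..m. (-1) ^ (j - 1) * Gamma (s - 2 * of_nat j)
              * Phi ((-1) ^ k) (s - 2 * of_nat j) v * complex_of_real ((2 * y) ^ (2 * j)))
        + complex_of_real pi * 2 powr s * complex_of_real (y ^ (2 * (m + 1)))
            / sin (complex_of_real pi * s) *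
          (\<Sum>i. let n = i + (1 - k) in
              complex_of_real (node k n) powr (s - 2 * of_nat m - 1)
              * sin (complex_of_real (pi * (2 * real n + real k) * v) + complex_of_real pi * s / 2)
              * complex_of_real (sin_quot k n y))))"

text \<open>Functions rather than almost-everywhere classes; for \<open>p > 0\<close>, also \<open>p < 1\<close>.\<close>

definition Lp :: "real \<Rightarrow> (real \<Rightarrow> complex) set" where
  "Lp p = {F. F \<in> borel_measurable lebesgue \<and>
              (\<integral>\<^sup>+ y. ennreal (norm (F y) powr p) \<partial>lebesgue) < \<infinity>}"

end

theory Submission
  imports Defs
begin

text \<open>
  For \<open>y\<close> outside a countable set,
  \<open>f(y) - g(y) = sin (y + \<pi>k/2) G(y)\<close> with
  \<open>G(y) = 4y\<^sup>2 \<integral>\<^sub>0\<^sup>\<infinity> t\<^bsup>s-1\<^esup> w(t) / (t\<^sup>2 + 4y\<^sup>2) dt\<close> and \<open>w(t) = e\<^bsup>(1-v)t\<^esup> / (e\<^sup>t - (-1)\<^sup>k)\<close>.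
  Expanding \<open>4y\<^sup>2 / (t\<^sup>2 + 4y\<^sup>2)\<close> in powers of \<open>(2y/t)\<^sup>2\<close> produces the finite sum in \<open>g\<close> and reduces
  \<open>s\<close> to \<open>s - 2 m\<^sub>k\<close>. In the remaining integral \<open>w\<close> is replaced by its partial fractions. The partial sums
  are dominated by an integrable function, so the series may be integrated term by term; each term
  is a Mellin transform whose value consists of a summand of the series in \<open>g\<close> and of a multiple of the
  partial fractions of \<open>w\<close> at \<open>\<plusminus>2iy\<close>, which sum up to \<open>f\<close>.

  Since \<open>G(y) = \<Gamma>(s) \<Phi>((-1)\<^sup>k, s, v) + O(y\<^sup>-\<^sup>2)\<close> and \<open>G\<close> is bounded, \<open>f - g\<close> is \<open>O(1 / (1 + y\<^sup>2))\<close> if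
  \<open>\<Phi>\<close> vanishes, and otherwise \<open>\<bar>f - g\<bar>\<close> is bounded below by a multiple of \<open>\<bar>sin (y + \<pi>k/2)\<bar>\<close> for large \<open>y\<close>.
\<close>

section \<open>Partial fractions of the kernel\<close>

text \<open>What replaces it is a bound A/t + B for all partial sums, uniform in their length. With
  a = s - 2 m_k and x = 2y, the weight t^(a-1)/(t^2+x^2) makes A/t integrable for 1 < Re a < 3 and B
  integrable for 0 < Re a < 2. For k = 0, v < 1 only A/t occurs, for k = 1 only B, for k = 0, v = 1
  both; this is where the three ranges for Re s come from. Excluding positive integers s in (i) and
  (iii) keeps a away from 1 and 2, the zeros of sin(pi a) in these ranges. Convergence of the series
  in g is a by-product: its partial sums are differences of two convergent sequences, the integrals
  of the partial sums and multiples of the partial fractions at \<plusminus>2iy. The identity is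
  proved where sin(2y) \<noteq> 0. Neither measurability nor the p-th power integral sees the
  countable remainder, so the limits in \<open>sin_quot\<close> never have to be computed. The bound
  p > 1/2 is the integrability condition for (1+y^2)^(-p).\<close>

lemma cot_partial_fractions:
  fixes z :: complex
  assumes z: "z \<notin> \<int>"
  shows "(\<lambda>N. 1 / z + (\<Sum>n<N. 2 * z / (z\<^sup>2 - (of_nat n + 1)\<^sup>2))) \<longlonglongrightarrow> of_real pi * cot (of_real pi * z)"
proof -
  have z1: "1 - z \<notin> \<int>"
    using z by (metis Ints_diff Ints_1 diff_diff_eq2 add_diff_cancel_left')
  have np: "z \<notin> \<int>\<^sub>\<le>\<^sub>0" "1 - z \<notin> \<int>\<^sub>\<le>\<^sub>0"
    using z z1 nonpos_Ints_subset_Ints by blast+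
  have sinz: "sin (of_real pi * z) \<noteq> 0"
    using z by (auto simp: sin_eq_0 field_simps)
  have open_ints: "open (- \<int> :: complex set)"
    using closed_Ints by blast
  \<comment> \<open>The expansion is the logarithmic derivative of the reflection formula: it gives
    \<open>Digamma (1 - z) - Digamma z\<close> = pi cot(pi z), and both Digamma values are limits of
    ln N minus a harmonic-type sum, so that the logarithms cancel.\<close>
  have eq: "Gamma w * Gamma (1 - w) = of_real pi / sin (of_real pi * w)" for w :: complex
    using Gamma_reflection_complex by blast
  have d1: "((\<lambda>w. Gamma w * Gamma (1 - w)) has_field_derivative
        Gamma z * Digamma z * Gamma (1 - z) - Gamma z * (Gamma (1 - z) * Digamma (1 - z))) (at z)"
    using np by (auto intro!: derivative_eq_intros)
  have d2: "((\<lambda>w. of_real pi / sin (of_real pi * w)) has_field_derivative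
        - (of_real pi * (of_real pi * cos (of_real pi * z))) / (sin (of_real pi * z))\<^sup>2) (at z)"
    using sinz by (auto intro!: derivative_eq_intros simp: power2_eq_square)
  have "Gamma z * Digamma z * Gamma (1 - z) - Gamma z * (Gamma (1 - z) * Digamma (1 - z))
        = - (of_real pi * (of_real pi * cos (of_real pi * z))) / (sin (of_real pi * z))\<^sup>2"
    using DERIV_unique[OF d1] d2 unfolding eq by blast
  then have "(Gamma z * Gamma (1 - z)) * (Digamma (1 - z) - Digamma z)
        = (of_real pi / sin (of_real pi * z)) * (of_real pi * cot (of_real pi * z))"
    by (simp add: cot_def algebra_simps power2_eq_square)
  then have dig: "Digamma (1 - z) - Digamma z = of_real pi * cot (of_real pi * z)"
    unfolding eq using sinz by simp
  have nz: "z - (of_nat n + 1) \<noteq> 0" "z + of_nat n \<noteq> 0" "1 - z + of_nat n \<noteq> 0" for n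
  proof -
    show "z - (of_nat n + 1) \<noteq> 0"
      using z by (metis Ints_1 Ints_add Ints_of_nat eq_iff_diff_eq_0)
    then show "1 - z + of_nat n \<noteq> 0" by (simp add: algebra_simps)
    show "z + of_nat n \<noteq> 0"
      using z by (metis Ints_minus Ints_of_nat add_eq_0_iff2)
  qed
  have pair: "2 * z / (z\<^sup>2 - (of_nat n + 1)\<^sup>2) = 1 / (z + of_nat (Suc n)) - 1 / (1 - z + of_nat n)" for n
  proof -
    have "z\<^sup>2 - (of_nat n + 1)\<^sup>2 = (z + of_nat (Suc n)) * (z - (of_nat n + 1))"
      by (simp add: power2_eq_square algebra_simps)
    moreover have "1 / (1 - z + of_nat n) = - (1 / (z - (of_nat n + 1)))"
      by (simp add: divide_simps) (use nz(1,3)[of n] in \<open>simp add: algebra_simps\<close>)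
    ultimately show ?thesis
      using nz(2)[of "Suc n"] nz(1)[of n] by (simp add: divide_simps) (simp add: algebra_simps)
  qed
  \<comment> \<open>Together with 1/z, the N pairs supply N+1 summands 1/(z+n) but only N summands
    1/(1-z+n); the surplus one is the last term, which tends to 0.\<close>
  have part: "1 / z + (\<Sum>n<N. 2 * z / (z\<^sup>2 - (of_nat n + 1)\<^sup>2)) =
      ((of_real (ln (real N)) - (\<Sum>n<N. inverse (1 - z + of_nat n)))
       - (of_real (ln (real N)) - (\<Sum>n<N. inverse (z + of_nat n)))) + inverse (z + of_nat N)" for N
  proof -
    have "1 / z + (\<Sum>n<N. 1 / (z + of_nat (Suc n))) = (\<Sum>n<Suc N. inverse (z + of_nat n))"
      by (subst sum.lessThan_Suc_shift) (simp add: divide_simps)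
    then show ?thesis
      unfolding pair by (simp add: sum_subtractf inverse_eq_divide algebra_simps)
  qed
  have "(\<lambda>N. inverse (z + of_nat N)) \<longlonglongrightarrow> 0"
    by (intro tendsto_inverse_0 [THEN filterlim_compose] tendsto_add_filterlim_at_infinity'[OF _ tendsto_const] tendsto_add_filterlim_at_infinity[OF tendsto_const] tendsto_of_nat)
  then have "(\<lambda>N. ((of_real (ln (real N)) - (\<Sum>n<N. inverse (1 - z + of_nat n)))
       - (of_real (ln (real N)) - (\<Sum>n<N. inverse (z + of_nat n)))) + inverse (z + of_nat N))
       \<longlonglongrightarrow> (Digamma (1 - z) - Digamma z) + 0"
    using nz(2)[of 0] nz(3)[of 0]
    by (intro tendsto_add tendsto_diff Digamma_LIMSEQ) auto
  then show ?thesis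
    unfolding part dig by simp
qed

text \<open>With z = t/(2 pi i), pi cot(pi z)/(2 pi i) equals coth(t/2)/2, which is 1/(e^t-1) + 1/2.
  The constant 1/2 reappears as \<open>pf_jump 0 1\<close>.\<close>

lemma coth_partial_fractions:
  fixes t :: complex
  assumes t: "exp t \<noteq> 1"
  shows "(\<lambda>N. 1 / t + (\<Sum>n<N. 2 * t / (t\<^sup>2 + (2 * of_real pi * (of_nat n + 1))\<^sup>2)))
           \<longlonglongrightarrow> 1 / (exp t - 1) + 1 / 2"
proof -
  define z where "z = t / (2 * of_real pi * \<i>)"
  have tz: "t = 2 * of_real pi * \<i> * z"
    by (simp add: z_def)
  have "z \<notin> \<int>"
  proof
    assume "z \<in> \<int>"
    then obtain m where "z = of_int m" by (auto elim: Ints_cases)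
    then have "t = 2 * of_int m * of_real pi * \<i>" using tz by simp
    with t show False by (auto simp: exp_eq_1)
  qed
  from tendsto_mult_left[OF cot_partial_fractions[OF this], of "1 / (2 * of_real pi * \<i>)"]
  have "(\<lambda>N. 1 / (2 * of_real pi * \<i>) * (1 / z + (\<Sum>n<N. 2 * z / (z\<^sup>2 - (of_nat n + 1)\<^sup>2))))
     \<longlonglongrightarrow> 1 / (2 * of_real pi * \<i>) * (of_real pi * cot (of_real pi * z))" .
  also have "(\<lambda>N. 1 / (2 * of_real pi * \<i>) * (1 / z + (\<Sum>n<N. 2 * z / (z\<^sup>2 - (of_nat n + 1)\<^sup>2))))
     = (\<lambda>N. 1 / t + (\<Sum>n<N. 2 * t / (t\<^sup>2 + (2 * of_real pi * (of_nat n + 1))\<^sup>2)))"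
  proof
    fix N
    have "1 / (2 * of_real pi * \<i>) * (2 * z / (z\<^sup>2 - (of_nat n + 1)\<^sup>2))
        = 2 * t / (t\<^sup>2 + (2 * of_real pi * (of_nat n + 1))\<^sup>2)" for n :: nat
    proof -
      have "t\<^sup>2 + (2 * of_real pi * (of_nat n + 1))\<^sup>2 = (2 * of_real pi * \<i>)\<^sup>2 * (z\<^sup>2 - (of_nat n + 1)\<^sup>2)"
        unfolding tz power_mult_distrib by (simp add: algebra_simps)
      moreover have "2 * t = (2 * of_real pi * \<i>) * (2 * z)"
        by (simp add: tz)
      ultimately show ?thesis
        by (simp add: power2_eq_square)
    qed
    then show "1 / (2 * of_real pi * \<i>) * (1 / z + (\<Sum>n<N. 2 * z / (z\<^sup>2 - (of_nat n + 1)\<^sup>2)))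
      = 1 / t + (\<Sum>n<N. 2 * t / (t\<^sup>2 + (2 * of_real pi * (of_nat n + 1))\<^sup>2))"
      by (simp add: distrib_left sum_distrib_left tz)
  qed
  also have "1 / (2 * of_real pi * \<i>) * (of_real pi * cot (of_real pi * z)) = 1 / (exp t - 1) + 1 / 2"
  proof -
    define q where "q = exp (\<i> * (of_real pi * z))"
    have q0: "q \<noteq> 0" by (simp add: q_def)
    have "exp t = q * q"
      by (simp add: q_def tz flip: exp_add) (simp add: algebra_simps)
    moreover have "exp (- (\<i> * (of_real pi * z))) = inverse q"
      by (simp add: q_def exp_minus)
    ultimately have "exp t = q * q" "sin (of_real pi * z) = (q - inverse q) / (2 * \<i>)"
        "cos (of_real pi * z) = (q + inverse q) / 2"
      unfolding sin_exp_eq cos_exp_eq q_def[symmetric] by simp_all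
    moreover have quot: "complex_of_real pi * (A / 2 / (B / (2 * \<i>))) / (2 * of_real pi * \<i>) = A / B / 2" for A B
      by (simp add: divide_simps)
    ultimately have "of_real pi * cot (of_real pi * z) / (2 * of_real pi * \<i>) = (q + inverse q) / (q - inverse q) / 2"
      unfolding cot_def by (simp only: quot)
    also have "\<dots> = 1 / (q * q - 1) + 1 / 2"
      using t q0 \<open>exp t = q * q\<close> by (simp add: divide_simps)
    finally show ?thesis
      using \<open>exp t = q * q\<close> by simp
  qed
  finally show ?thesis .
qed


text \<open>The difference of the previous expansion at t/2 and at t, by 1/(e^(t/2)-1) - 1/(e^t-1) =
  e^(t/2)/(e^t-1). The summands at t/2 are twice the odd-indexed summands at t, which turns the
  signs into alternating ones and pairs N terms with 2N terms; hence only partial sums of even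
  length appear.\<close>

lemma csch_partial_fractions:
  fixes t :: complex
  assumes t: "exp t \<noteq> 1"
  shows "(\<lambda>N. 1 / t + (\<Sum>n<2*N. (- 1) ^ Suc n * (2 * t / (t\<^sup>2 + (2 * of_real pi * (of_nat n + 1))\<^sup>2))))
           \<longlonglongrightarrow> exp (t / 2) / (exp t - 1)"
proof -
  define b :: "complex \<Rightarrow> nat \<Rightarrow> complex"
    where "b u n = 2 * u / (u\<^sup>2 + (2 * of_real pi * (of_nat n + 1))\<^sup>2)" for u n
  have t2: "exp (t / 2) \<noteq> 1"
    using t exp_double[of "t / 2"] by auto
  have half: "2 * b t (2 * n + 1) = b (t / 2) n" for n
  proof -
    have "t\<^sup>2 + (2 * of_real pi * (of_nat (2 * n + 1) + 1))\<^sup>2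
          = 4 * ((t / 2)\<^sup>2 + (2 * of_real pi * (of_nat n + 1))\<^sup>2)"
      by (simp add: power2_eq_square algebra_simps)
    moreover have "2 * (2 * t / (4 * X)) = 2 * (t / 2) / X" for X
      by (simp add: divide_simps)
    ultimately show ?thesis unfolding b_def by (simp only:)
  qed
  have alt: "(\<Sum>n<2*N. (- 1) ^ Suc n * b t n) = (\<Sum>n<N. b (t / 2) n) - (\<Sum>n<2*N. b t n)" for N
    by (induction N) (simp_all add: half[symmetric] algebra_simps)
  have "(\<lambda>N. 1 / (t / 2) + (\<Sum>n<N. b (t / 2) n)) \<longlonglongrightarrow> 1 / (exp (t / 2) - 1) + 1 / 2"
    unfolding b_def by (rule coth_partial_fractions[OF t2])
  moreover have "(\<lambda>N. 1 / t + (\<Sum>n<2*N. b t n)) \<longlonglongrightarrow> 1 / (exp t - 1) + 1 / 2"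
    unfolding b_def
    using LIMSEQ_subseq_LIMSEQ[OF coth_partial_fractions[OF t], of "\<lambda>N. 2 * N"]
    by (simp add: o_def strict_mono_def)
  ultimately have "(\<lambda>N. (1 / (t / 2) + (\<Sum>n<N. b (t / 2) n)) - (1 / t + (\<Sum>n<2*N. b t n)))
      \<longlonglongrightarrow> (1 / (exp (t / 2) - 1) + 1 / 2) - (1 / (exp t - 1) + 1 / 2)"
    by (rule tendsto_diff)
  also have "(\<lambda>N. (1 / (t / 2) + (\<Sum>n<N. b (t / 2) n)) - (1 / t + (\<Sum>n<2*N. b t n)))
      = (\<lambda>N. 1 / t + (\<Sum>n<2*N. (- 1) ^ Suc n * b t n))"
    unfolding alt by (simp add: algebra_simps)
  also have "(1 / (exp (t / 2) - 1) + 1 / 2) - (1 / (exp t - 1) + 1 / 2) = exp (t / 2) / (exp t - 1)"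
  proof -
    have e: "exp t = exp (t / 2) * exp (t / 2)"
      by (simp flip: exp_add)
    have "exp (t / 2) * exp (t / 2) - 1 \<noteq> 0" using t e by auto
    then show ?thesis unfolding e using t2 by (simp add: divide_simps) (simp add: algebra_simps)
  qed
  finally show ?thesis unfolding b_def .
qed

lemma Dirichlet_kernel:
  "sin (pi * v) * (1 + (\<Sum>n<N. 2 * cos (2 * pi * (real n + 1) * v))) = sin ((2 * real N + 1) * pi * v)"
proof (induction N)
  case (Suc N)
  have "2 * sin (pi * v) * cos (2 * pi * (real N + 1) * v)
      = sin ((2 * real (Suc N) + 1) * pi * v) - sin ((2 * real N + 1) * pi * v)"
    unfolding sin_diff_sin by (simp add: algebra_simps add_divide_distrib)
  with Suc show ?case by (simp add: algebra_simps)
qed simp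

text \<open>The nonzero poles of \<open>e\<^bsup>(1 - v) t\<^esup> / (e\<^sup>t - (-1)\<^sup>k)\<close> are \<open>\<plusminus>i freq k j\<close>, and \<open>freq\<close> is
  twice the corresponding \<^const>\<open>node\<close>. Each \<open>pf_term\<close> collects a pair of conjugate poles. For
  \<open>v = 1\<close> the partial fractions differ from the function by the constant \<open>pf_jump\<close>.\<close>

definition freq :: "nat \<Rightarrow> nat \<Rightarrow> real"
  where "freq k i = pi * (2 * real i + 2 - real k)"

definition pf_term :: "nat \<Rightarrow> real \<Rightarrow> complex \<Rightarrow> nat \<Rightarrow> complex"
  where "pf_term k v t i = (2 * t * of_real (cos (freq k i * v)) + 2 * of_real (freq k i * sin (freq k i * v)))
            / (t\<^sup>2 + (of_real (freq k i))\<^sup>2)"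

definition pf_sum :: "nat \<Rightarrow> real \<Rightarrow> nat \<Rightarrow> complex \<Rightarrow> complex"
  where "pf_sum k v N t = (if k = 0 then 1 / t else 0) + (\<Sum>i<N. pf_term k v t i)"

text \<open>As a function of v the partial fractions form a Fourier-type series, multiplied by
  (-1)^k under v \<mapsto> v+1. At v = 1 its limit is the mean of the left limit 1/(e^t-(-1)^k) and
  the right limit (-1)^k e^t/(e^t-(-1)^k); their difference is (-1)^k, and the constant is half of
  it.\<close>

definition pf_jump :: "nat \<Rightarrow> real \<Rightarrow> real"
  where "pf_jump k v = (if v = 1 then (-1) ^ k / 2 else 0)"

lemma freq_pos: "k \<le> 1 \<Longrightarrow> freq k i > 0"
  by (simp add: freq_def)


lemma cis_freq:
  assumes "k \<le> 1"
  shows "cis (freq k i) = (-1) ^ k"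
proof -
  have "freq k i = 2 * pi * real_of_int (int i + 1) - real k * pi"
    by (simp add: freq_def algebra_simps)
  then have "cis (freq k i) = cis (2 * pi * real_of_int (int i + 1)) / cis (real k * pi)"
    by (simp only: cis_divide)
  also have "\<dots> = (-1) ^ k"
    using assms by (cases "k = 0") (auto simp: le_Suc_eq)
  finally show ?thesis .
qed

lemma exp_ne_imp_denom_ne_0:
  fixes t :: complex
  assumes "exp t \<noteq> (-1) ^ k" "k \<le> 1"
  shows "t\<^sup>2 + (of_real (freq k i))\<^sup>2 \<noteq> 0"
proof
  assume "t\<^sup>2 + (of_real (freq k i))\<^sup>2 = 0"
  then have "(t - \<i> * of_real (freq k i)) * (t + \<i> * of_real (freq k i)) = 0"
    by (simp add: algebra_simps power2_eq_square)
  then have "t = \<i> * of_real (freq k i) \<or> t = \<i> * of_real (- freq k i)"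
    by (auto simp: eq_neg_iff_add_eq_0)
  then have "exp t = cis (freq k i) \<or> exp t = cis (- freq k i)"
    by (auto simp: cis_conv_exp)
  moreover have "cis (- freq k i) = inverse (cis (freq k i))"
    by simp
  ultimately have "exp t = (-1) ^ k"
    using assms(2) unfolding cis_freq[OF assms(2)] by (auto simp: power_inverse[symmetric])
  with assms show False by simp
qed

lemma LIMSEQ_inv_odd: "(\<lambda>N. 1 / (2 * real N + 1)) \<longlonglongrightarrow> 0"
  by (rule tendsto_sandwich[OF _ _ tendsto_const lim_inverse_n']) (auto intro!: always_eventually eventually_sequentiallyI[of 1] divide_left_mono)

text \<open>As functions of \<open>v\<close>, the partial sums multiplied by \<open>e\<^bsup>v t\<^esup>\<close> have the derivative
  \<open>e\<^bsup>v t\<^esup>\<close> times the Dirichlet kernel. An integration by parts, carried out by adding the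
  correction term of \<open>Q\<close>, shows that in the limit they do not depend on \<open>v\<close>, and \<open>v = 1/2\<close> is the
  partial fraction expansion of the hyperbolic cosecant.\<close>

lemma partial_fractions_0_interior:
  assumes t: "exp t \<noteq> 1" and v: "v \<in> {0<..<1}"
  shows "(\<lambda>N. pf_sum 0 v (2 * N) t) \<longlonglongrightarrow> exp (of_real (1 - v) * t) / (exp t - 1)"
proof -
  have dn: "t\<^sup>2 + (of_real (freq 0 i))\<^sup>2 \<noteq> 0" for i
    using exp_ne_imp_denom_ne_0[of t 0 i] t by simp
  have t0: "t \<noteq> 0" using t by auto
  have sinpos: "sin (pi * x) > 0" if "x \<in> {0<..<1}" for x
    using that by (intro sin_gt_zero) auto
  have sin_ne: "sin (complex_of_real pi * of_real x) \<noteq> 0" if "x \<in> {0<..<1}" for x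
  proof -
    have "sin (complex_of_real pi * of_real x) = of_real (sin (pi * x))"
      by (simp flip: sin_of_real)
    with sinpos[OF that] show ?thesis by simp
  qed
  define L :: "nat \<Rightarrow> complex" where "L N = of_real ((2 * real N + 1) * pi)" for N
  \<comment> \<open>\<open>P\<close> is \<open>pf_sum 0\<close> with v replaced by a complex
    variable, so that complex derivatives and the mean value bound on a segment can be used; only
    points u on the real interval (0,1) enter. \<open>L N\<close> is the frequency of the Dirichlet
    kernel of order N.\<close>
  define P :: "nat \<Rightarrow> complex \<Rightarrow> complex" where
    "P = (\<lambda>N u. 1 / t + (\<Sum>i<N. (2 * t * cos (of_real (freq 0 i) * u) + 2 * of_real (freq 0 i) * sin (of_real (freq 0 i) * u))
            / (t\<^sup>2 + (of_real (freq 0 i))\<^sup>2)))"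
  define D where "D = (\<lambda>u. exp (u * t) / sin (of_real pi * u))"
  define D' where "D' = (\<lambda>u. (t * exp (u * t) * sin (of_real pi * u) - exp (u * t) * (of_real pi * cos (of_real pi * u)))
      / (sin (of_real pi * u))\<^sup>2)"
  define Q where "Q = (\<lambda>N u. exp (u * t) * P N u + D u * (cos (L N * u) / L N))"
  have L0: "L N \<noteq> 0" for N
  proof -
    have "(2 * real N + 1) * pi \<noteq> 0" by (simp add: add_eq_0_iff)
    then show ?thesis unfolding L_def by (metis of_real_eq_0_iff)
  qed
  have P_real: "P N (of_real x) = pf_sum 0 x N t" for N x
    by (simp add: P_def pf_sum_def pf_term_def cos_of_real[symmetric] sin_of_real[symmetric] mult.assoc)
  have kernel: "sin (of_real pi * u) * (1 + (\<Sum>i<N. 2 * cos (of_real (freq 0 i) * u))) = sin (L N * u)"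
    if "u = of_real x" for u :: complex and x N
  proof -
    have fr: "freq 0 i * x = 2 * pi * (real i + 1) * x" for i
      by (simp add: freq_def algebra_simps)
    then have "sin (pi * x) * (1 + (\<Sum>i<N. 2 * cos (freq 0 i * x))) = sin ((2 * real N + 1) * pi * x)"
      using Dirichlet_kernel[of x N] by (simp only: fr)
    then have "complex_of_real (sin (pi * x) * (1 + (\<Sum>i<N. 2 * cos (freq 0 i * x)))) = of_real (sin ((2 * real N + 1) * pi * x))"
      by simp
    then show ?thesis
      unfolding that L_def by (simp add: cos_of_real[symmetric] sin_of_real[symmetric])
  qed
  have dQ: "(Q N has_field_derivative D' u * (cos (L N * u) / L N)) (at u)"
    if u: "u = of_real x" "x \<in> {0<..<1}" for u x N
  proof -
    have sn: "sin (of_real pi * u) \<noteq> 0"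
      using sin_ne[OF u(2)] u(1) by simp
    have dterm: "((\<lambda>u. (2 * t * cos (of_real (freq 0 i) * u) + 2 * of_real (freq 0 i) * sin (of_real (freq 0 i) * u))
            / (t\<^sup>2 + (of_real (freq 0 i))\<^sup>2)) has_field_derivative
        2 * cos (of_real (freq 0 i) * u) - t * ((2 * t * cos (of_real (freq 0 i) * u) + 2 * of_real (freq 0 i) * sin (of_real (freq 0 i) * u))
            / (t\<^sup>2 + (of_real (freq 0 i))\<^sup>2))) (at u)" for i
    proof -
      have "((\<lambda>u. (2 * t * cos (of_real (freq 0 i) * u) + 2 * of_real (freq 0 i) * sin (of_real (freq 0 i) * u))
            / (t\<^sup>2 + (of_real (freq 0 i))\<^sup>2)) has_field_derivative
          (2 * t * (- sin (of_real (freq 0 i) * u) * of_real (freq 0 i))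
            + 2 * of_real (freq 0 i) * (cos (of_real (freq 0 i) * u) * of_real (freq 0 i))) / (t\<^sup>2 + (of_real (freq 0 i))\<^sup>2)) (at u)"
        by (intro DERIV_cdivide) (auto intro!: derivative_eq_intros)
      also have "(2 * t * (- sin (of_real (freq 0 i) * u) * of_real (freq 0 i))
            + 2 * of_real (freq 0 i) * (cos (of_real (freq 0 i) * u) * of_real (freq 0 i))) / (t\<^sup>2 + (of_real (freq 0 i))\<^sup>2)
         = 2 * cos (of_real (freq 0 i) * u) - t * ((2 * t * cos (of_real (freq 0 i) * u) + 2 * of_real (freq 0 i) * sin (of_real (freq 0 i) * u))
            / (t\<^sup>2 + (of_real (freq 0 i))\<^sup>2))"
      proof -
        have "(2 * t * (- S * c) + 2 * c * (C * c)) / (t\<^sup>2 + c\<^sup>2) = 2 * C - t * ((2 * t * C + 2 * c * S) / (t\<^sup>2 + c\<^sup>2))"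
          if "t\<^sup>2 + c\<^sup>2 \<noteq> 0" for S C c
        proof -
          have "2 * C - t * ((2 * t * C + 2 * c * S) / (t\<^sup>2 + c\<^sup>2))
              = (2 * C * (t\<^sup>2 + c\<^sup>2) - t * (2 * t * C + 2 * c * S)) / (t\<^sup>2 + c\<^sup>2)"
            unfolding diff_divide_distrib using that by simp
          also have "2 * C * (t\<^sup>2 + c\<^sup>2) - t * (2 * t * C + 2 * c * S) = 2 * t * (- S * c) + 2 * c * (C * c)"
            by (simp add: algebra_simps power2_eq_square)
          finally show ?thesis by (rule sym)
        qed
        from this[OF dn[of i]] show ?thesis .
      qed
      finally show ?thesis .
    qed
    \<comment> \<open>Each differentiated summand is 2 cos(c u) minus t times the summand itself.
      Hence P' = kernel - t P, and the factor e^(u t) removes the term t P.\<close>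
    have d1: "(P N has_field_derivative 0 + (\<Sum>i<N. 2 * cos (of_real (freq 0 i) * u) - t * ((2 * t * cos (of_real (freq 0 i) * u) + 2 * of_real (freq 0 i) * sin (of_real (freq 0 i) * u))
            / (t\<^sup>2 + (of_real (freq 0 i))\<^sup>2)))) (at u)"
      unfolding P_def by (rule DERIV_add[OF DERIV_const DERIV_sum[OF dterm]])
    have d2: "0 + (\<Sum>i<N. 2 * cos (of_real (freq 0 i) * u) - t * ((2 * t * cos (of_real (freq 0 i) * u) + 2 * of_real (freq 0 i) * sin (of_real (freq 0 i) * u))
            / (t\<^sup>2 + (of_real (freq 0 i))\<^sup>2))) = (1 + (\<Sum>i<N. 2 * cos (of_real (freq 0 i) * u))) - t * P N u"
      using t0 by (simp add: P_def sum_subtractf sum_distrib_left distrib_left)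
    have d3: "1 + (\<Sum>i<N. 2 * cos (of_real (freq 0 i) * u)) = sin (L N * u) / sin (of_real pi * u)"
      unfolding kernel[OF u(1), of N, symmetric] using sn by (rule nonzero_mult_div_cancel_left[symmetric])
    have dP: "(P N has_field_derivative sin (L N * u) / sin (of_real pi * u) - t * P N u) (at u)"
      by (rule DERIV_cong[OF d1 trans[OF d2]]) (simp only: d3)
    have dD: "(D has_field_derivative D' u) (at u)"
    proof -
      have "((\<lambda>u. exp (u * t)) has_field_derivative t * exp (u * t)) (at u)"
        by (auto intro!: derivative_eq_intros)
      moreover have "((\<lambda>u. sin (of_real pi * u)) has_field_derivative of_real pi * cos (of_real pi * u)) (at u)"
        by (auto intro!: derivative_eq_intros)
      ultimately show ?thesis
        unfolding D_def D'_def power2_eq_square using sn by (rule DERIV_divide)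
    qed
    have dexp: "((\<lambda>u. exp (u * t)) has_field_derivative t * exp (u * t)) (at u)"
      by (auto intro!: derivative_eq_intros)
    have dcos: "((\<lambda>u. cos (L N * u) / L N) has_field_derivative - sin (L N * u)) (at u)"
      using L0[of N] by (auto intro!: derivative_eq_intros)
    have cancel: "(e * (r / n - t * p) + t * e * p) + (e / n * (- r) + d) = d" for e r n p d :: complex
      by (simp add: right_diff_distrib)
    have "(Q N has_field_derivative (exp (u * t) * (sin (L N * u) / sin (of_real pi * u) - t * P N u) + t * exp (u * t) * P N u)
          + (D u * (- sin (L N * u)) + D' u * (cos (L N * u) / L N))) (at u)"
      unfolding Q_def by (rule DERIV_add[OF DERIV_mult'[OF dexp dP] DERIV_mult'[OF dD dcos]])
    then show ?thesis unfolding D_def by (rule DERIV_cong) (rule cancel)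
  qed
  \<comment> \<open>The segment from 1/2 to v stays inside (0,1), where sin(pi u) has no zero; by
    compactness D' is bounded on it, and the derivative of Q is O(1/N) uniformly.\<close>
  define S :: "complex set" where "S = closed_segment (of_real (1/2)) (of_real v)"
  have S_mem: "\<exists>x. u = of_real x \<and> x \<in> {0<..<1}" if "u \<in> S" for u
  proof -
    have "\<exists>r. 0 \<le> r \<and> r \<le> 1 \<and> u = (1 - r) *\<^sub>R of_real (1/2) + r *\<^sub>R of_real v"
      using that unfolding S_def by (simp only: in_segment(1))
    then obtain r where r: "0 \<le> r" "r \<le> 1" "u = (1 - r) *\<^sub>R of_real (1/2) + r *\<^sub>R of_real v"
      by (elim exE conjE)
    then have "u = of_real ((1 - r) * (1/2) + r * v)"
      by (simp add: scaleR_conv_of_real)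
    moreover have "(1 - r) * (1/2) + r * v \<in> closed_segment (1/2) v"
      unfolding in_segment using r by auto
    moreover have "closed_segment (1/2) v \<subseteq> {0<..<1::real}"
      using v by (intro closed_segment_subset) auto
    ultimately show ?thesis by blast
  qed
  have contD': "continuous_on S D'"
  proof -
    have "sin (of_real pi * u) \<noteq> 0" if "u \<in> S" for u
      using S_mem[OF that] sin_ne by auto
    then show ?thesis
      unfolding D'_def by (intro continuous_intros) auto
  qed
  have "compact S" unfolding S_def by (rule compact_segment)
  then obtain M where M: "\<And>u. u \<in> S \<Longrightarrow> norm (D' u) \<le> M"
    using compact_imp_bounded[OF compact_continuous_image[OF contD']] unfolding bounded_iff by blast
  have cos_le: "norm (cos (L N * u) / L N) \<le> 1 / (2 * real N + 1)" if "u = of_real x" for u x N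
  proof -
    have "cos (L N * u) = of_real (cos (((2 * real N + 1) * pi) * x))"
      unfolding that L_def by (simp add: cos_of_real[symmetric])
    then have "norm (cos (L N * u)) \<le> 1" by simp
    moreover have "norm (L N) \<ge> 2 * real N + 1"
      using mult_left_mono[of 1 pi "2 * real N + 1"] pi_ge_two unfolding L_def norm_of_real by (simp add: abs_mult)
    ultimately show ?thesis
      by (simp add: norm_divide frac_le)
  qed
  have bound: "norm (Q N (of_real v) - Q N (of_real (1/2))) \<le> M * (1 / (2 * real N + 1)) * norm (complex_of_real v - of_real (1/2))" for N
  proof (rule field_differentiable_bound[of S])
    show "convex S" unfolding S_def by simp
    show "(Q N has_field_derivative D' u * (cos (L N * u) / L N)) (at u within S)" if "u \<in> S" for u
      using S_mem[OF that] dQ has_field_derivative_at_within by blast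
    show "norm (D' u * (cos (L N * u) / L N)) \<le> M * (1 / (2 * real N + 1))" if uS: "u \<in> S" for u
    proof -
      obtain x where x: "u = of_real x" using S_mem[OF uS] by blast
      show ?thesis
        unfolding norm_mult
        by (rule mult_mono[OF M[OF uS] cos_le[OF x] order_trans[OF norm_ge_zero M[OF uS]] norm_ge_zero])
    qed
  qed (auto simp: S_def)
  have inv0: "(\<lambda>N. 1 / (2 * real N + 1)) \<longlonglongrightarrow> 0"
    by (rule LIMSEQ_inv_odd)
  have "(\<lambda>N. M * (1 / (2 * real N + 1)) * norm (complex_of_real v - of_real (1/2))) \<longlonglongrightarrow> 0"
    using tendsto_mult[OF tendsto_mult[OF tendsto_const inv0] tendsto_const] by simp
  then have Qdiff: "(\<lambda>N. Q N (of_real v) - Q N (of_real (1/2))) \<longlonglongrightarrow> 0"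
    by (rule Lim_null_comparison[OF always_eventually[OF allI[OF bound]]])
  have small: "(\<lambda>N. D (of_real x) * (cos (L N * of_real x) / L N)) \<longlonglongrightarrow> 0" for x
    by (intro tendsto_mult_right_zero Lim_null_comparison[OF always_eventually inv0]) (simp add: cos_le)
  have "(\<lambda>N. (Q N (of_real v) - Q N (of_real (1/2))) - D (of_real v) * (cos (L N * of_real v) / L N)
      + D (of_real (1/2)) * (cos (L N * of_real (1/2)) / L N)) \<longlonglongrightarrow> 0 - 0 + 0"
    by (intro tendsto_add tendsto_diff Qdiff small)
  then have "(\<lambda>N. exp (of_real v * t) * pf_sum 0 v N t - exp (t / 2) * pf_sum 0 (1/2) N t) \<longlonglongrightarrow> 0"
    unfolding Q_def P_real by (simp add: algebra_simps)
  \<comment> \<open>At v = 1/2 the limit is known only along even lengths.\<close>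
  from LIMSEQ_subseq_LIMSEQ[OF this, of "\<lambda>N. 2 * N"]
  have diff: "(\<lambda>N. exp (of_real v * t) * pf_sum 0 v (2 * N) t - exp (t / 2) * pf_sum 0 (1/2) (2 * N) t) \<longlonglongrightarrow> 0"
    by (simp add: o_def strict_mono_def)
  have half: "pf_sum 0 (1/2) N t = 1 / t + (\<Sum>n<N. (- 1) ^ Suc n * (2 * t / (t\<^sup>2 + (2 * of_real pi * (of_nat n + 1))\<^sup>2)))" for N
  proof -
    have "freq 0 i * (1/2) = real (Suc i) * pi" for i
      by (simp add: freq_def algebra_simps)
    moreover have "complex_of_real (freq 0 i) = 2 * of_real pi * (of_nat i + 1)" for i
      by (simp add: freq_def algebra_simps)
    ultimately show ?thesis
      unfolding pf_sum_def pf_term_def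
      by (simp only: sin_npi cos_npi) (simp add: mult.commute)
  qed
  have "(\<lambda>N. exp (- of_real v * t) * ((exp (of_real v * t) * pf_sum 0 v (2 * N) t - exp (t / 2) * pf_sum 0 (1/2) (2 * N) t)
       + exp (t / 2) * pf_sum 0 (1/2) (2 * N) t)) \<longlonglongrightarrow> exp (- of_real v * t) * (0 + exp (t / 2) * (exp (t / 2) / (exp t - 1)))"
    by (intro tendsto_intros diff) (use csch_partial_fractions[OF t] in \<open>simp only: half\<close>)
  also have "(\<lambda>N. exp (- of_real v * t) * ((exp (of_real v * t) * pf_sum 0 v (2 * N) t - exp (t / 2) * pf_sum 0 (1/2) (2 * N) t)
       + exp (t / 2) * pf_sum 0 (1/2) (2 * N) t)) = (\<lambda>N. pf_sum 0 v (2 * N) t)"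
    by (simp add: exp_minus mult.assoc[symmetric])
  also have "exp (- of_real v * t) * (0 + exp (t / 2) * (exp (t / 2) / (exp t - 1))) = exp (of_real (1 - v) * t) / (exp t - 1)"
    by (simp add: algebra_simps flip: exp_add mult.assoc)
  finally show ?thesis .
qed

text \<open>The argument for 0 < v < 1 divides by sin(pi v) and stops short of v = 1. There all
  cosines are 1 and all sines 0, and the sum is literally the coth expansion.\<close>

lemma partial_fractions_0:
  assumes t: "exp t \<noteq> 1" and v: "v \<in> {0<..1}"
  shows "(\<lambda>N. pf_sum 0 v (2 * N) t) \<longlonglongrightarrow> exp (of_real (1 - v) * t) / (exp t - 1) + of_real (pf_jump 0 v)"
proof (cases "v = 1")
  case True
  have "cos (freq 0 i) = 1 \<and> sin (freq 0 i) = 0" for i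
    using cis_freq[of 0 i] by (simp add: complex_eq_iff)
  moreover have "complex_of_real (freq 0 i) = 2 * of_real pi * (of_nat i + 1)" for i
    by (simp add: freq_def algebra_simps)
  ultimately have "pf_sum 0 v N t = 1 / t + (\<Sum>n<N. 2 * t / (t\<^sup>2 + (2 * of_real pi * (of_nat n + 1))\<^sup>2))" for N
    unfolding pf_sum_def pf_term_def True by simp
  then show ?thesis
    using LIMSEQ_subseq_LIMSEQ[OF coth_partial_fractions[OF t], of "\<lambda>N. 2 * N"] True
    by (simp add: o_def strict_mono_def pf_jump_def)
next
  case False
  then show ?thesis
    using partial_fractions_0_interior[OF t, of v] v by (simp add: pf_jump_def)
qed

lemma LIMSEQ_even_imp_LIMSEQ:
  fixes f :: "nat \<Rightarrow> 'a::real_normed_vector"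
  assumes even: "(\<lambda>n. f (2 * n)) \<longlonglongrightarrow> L" and step: "(\<lambda>n. f (Suc n) - f n) \<longlonglongrightarrow> 0"
  shows "f \<longlonglongrightarrow> L"
proof -
  have half: "filterlim (\<lambda>n::nat. n div 2) at_top at_top"
    unfolding filterlim_at_top
  proof
    fix Z :: nat
    show "\<forall>\<^sub>F n in sequentially. Z \<le> n div 2"
      by (rule eventually_sequentiallyI[of "2 * Z"]) auto
  qed
  have pred: "filterlim (\<lambda>n::nat. n - 1) at_top at_top"
    by (rule filterlim_minus_const_nat_at_top)
  have "(\<lambda>n. f (2 * (n div 2))) \<longlonglongrightarrow> L"
    using filterlim_compose[OF even half] .
  moreover have "(\<lambda>n. f n - f (2 * (n div 2))) \<longlonglongrightarrow> 0"
  proof (rule Lim_null_comparison[OF always_eventually])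
    show "(\<lambda>n. norm (f (Suc (n - 1)) - f (n - 1))) \<longlonglongrightarrow> 0"
      using filterlim_compose[OF step pred] by (simp add: tendsto_norm_zero)
    show "\<forall>n. norm (f n - f (2 * (n div 2))) \<le> norm (f (Suc (n - 1)) - f (n - 1))"
    proof
      fix n show "norm (f n - f (2 * (n div 2))) \<le> norm (f (Suc (n - 1)) - f (n - 1))"
        by (cases "even n") (auto elim!: oddE)
    qed
  qed
  ultimately show ?thesis
    using tendsto_add by fastforce
qed

text \<open>After division by the frequency the numerator is bounded and the denominator tends to
  infinity. The vanishing of single terms upgrades convergence along even lengths to convergence of
  the whole sequence.\<close>

lemma pf_term_0_tendsto_0: "pf_term 0 v t \<longlonglongrightarrow> 0"
proof -
  have c: "filterlim (\<lambda>i. complex_of_real (freq 0 i)) at_infinity sequentially"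
  proof -
    have "filterlim (\<lambda>i. freq 0 i) at_top sequentially"
      unfolding freq_def
      by (intro filterlim_tendsto_pos_mult_at_top[OF tendsto_const pi_gt_zero])
         (auto intro!: filterlim_at_top_mono[OF filterlim_real_sequentially])
    then show ?thesis
      unfolding filterlim_at_infinity_conv_norm_at_top norm_of_real
      by (rule filterlim_compose[OF filterlim_abs_real])
  qed
  have ic: "(\<lambda>i. inverse (complex_of_real (freq 0 i))) \<longlonglongrightarrow> 0"
    by (rule filterlim_compose[OF tendsto_inverse_0 c])
  have q: "(\<lambda>i. inverse (t\<^sup>2 * inverse (of_real (freq 0 i)) + of_real (freq 0 i))) \<longlonglongrightarrow> 0"
    by (rule filterlim_compose[OF tendsto_inverse_0 tendsto_add_filterlim_at_infinity[OF _ c]])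
       (rule tendsto_mult[OF tendsto_const ic])
  have num: "norm (2 * t * of_real (cos (freq 0 i * v)) * inverse (of_real (freq 0 i)) + 2 * of_real (sin (freq 0 i * v))) \<le> 2 * norm t + 2" for i
  proof -
    have f1: "freq 0 i \<ge> 1"
    proof -
      have "freq 0 i \<ge> pi * 1" unfolding freq_def by (intro mult_left_mono) auto
      then show ?thesis using pi_ge_two by linarith
    qed
    have "norm (2 * t * of_real (cos (freq 0 i * v)) * inverse (of_real (freq 0 i))) \<le> (2 * norm t * 1) * 1"
      unfolding norm_mult norm_inverse norm_of_real using f1
      by (intro mult_mono) (auto simp: inverse_le_1_iff)
    moreover have "norm (2 * complex_of_real (sin (freq 0 i * v))) \<le> 2"
      by (simp add: norm_mult)
    ultimately show ?thesis
      by (intro order_trans[OF norm_triangle_ineq]) linarith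
  qed
  have "pf_term 0 v t i = (2 * t * of_real (cos (freq 0 i * v)) * inverse (of_real (freq 0 i)) + 2 * of_real (sin (freq 0 i * v)))
      * inverse (t\<^sup>2 * inverse (of_real (freq 0 i)) + of_real (freq 0 i))" for i
  proof -
    define c where "c = complex_of_real (freq 0 i)"
    have "c \<noteq> 0" using freq_pos[of 0 i] by (simp add: c_def)
    then have "t\<^sup>2 * inverse c + c = (t\<^sup>2 + c\<^sup>2) * inverse c"
      by (simp add: field_simps power2_eq_square)
    then show ?thesis
      unfolding pf_term_def c_def[symmetric] of_real_mult using \<open>c \<noteq> 0\<close> by (simp add: divide_simps)
  qed
  then have "pf_term 0 v t = (\<lambda>i. (2 * t * of_real (cos (freq 0 i * v)) * inverse (of_real (freq 0 i)) + 2 * of_real (sin (freq 0 i * v)))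
      * inverse (t\<^sup>2 * inverse (of_real (freq 0 i)) + of_real (freq 0 i)))"
    by (rule ext)
  then show ?thesis
    using lim_null_mult_left_bounded[OF always_eventually[OF allI[OF num]] q] by simp
qed

text \<open>The case \<open>k = 1\<close> follows from \<open>k = 0\<close> by
  \<open>1 / (e\<^sup>t + 1) = (e\<^sup>t - 1) / (e\<^sup>2\<^sup>t - 1)\<close>.\<close>

lemma pf_sum_1:
  assumes "t \<noteq> 0" and dn: "\<And>i. (2 * t)\<^sup>2 + (of_real (freq 0 i))\<^sup>2 \<noteq> 0"
  shows "pf_sum 1 v N t = pf_sum 0 (v / 2) (2 * N) (2 * t) - pf_sum 0 ((v + 1) / 2) (2 * N) (2 * t)"
proof -
  \<comment> \<open>Raising v/2 by 1/2 multiplies the i-th cosine and sine by (-1)^(i+1). So the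
    terms of odd index, which belong to the poles of 1/(e^t-1), cancel in the difference, and those
    of even index double and carry the frequencies of k = 1.\<close>
  have s: "freq 0 i * ((v + 1) / 2) = freq 0 i * (v / 2) + pi * real (Suc i)" for i
    by (simp add: freq_def algebra_simps add_divide_distrib)
  have tr: "cos (freq 0 i * ((v + 1) / 2)) = (- 1) ^ Suc i * cos (freq 0 i * (v / 2))"
    "sin (freq 0 i * ((v + 1) / 2)) = (- 1) ^ Suc i * sin (freq 0 i * (v / 2))" for i
    unfolding s cos_add sin_add cos_npi2 sin_npi2 by simp_all
  have even: "pf_term 0 (v / 2) (2 * t) (2 * i + 1) - pf_term 0 ((v + 1) / 2) (2 * t) (2 * i + 1) = 0" for i
    unfolding pf_term_def tr by simp
  have odd: "pf_term 0 (v / 2) (2 * t) (2 * i) - pf_term 0 ((v + 1) / 2) (2 * t) (2 * i) = pf_term 1 v t i" for i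
  proof -
    have f: "freq 0 (2 * i) = 2 * freq 1 i"
      by (simp add: freq_def)
    have f': "freq 0 (2 * i) * (v / 2) = freq 1 i * v"
      by (simp add: f)
    have den: "(2 * t)\<^sup>2 + (2 * complex_of_real (freq 1 i))\<^sup>2 = 4 * (t\<^sup>2 + (of_real (freq 1 i))\<^sup>2)"
      by (simp add: power2_eq_square algebra_simps)
    moreover have combine: "(2 * (2 * t) * C + 2 * (2 * F * S)) / (4 * X) - (2 * (2 * t) * (- C) + 2 * (2 * F * (- S))) / (4 * X)
        = (2 * t * C + 2 * (F * S)) / X" for C S F X :: complex
      by (simp add: divide_simps)
    moreover have "cos (freq 0 (2 * i) * ((v + 1) / 2)) = - cos (freq 1 i * v)"
      "sin (freq 0 (2 * i) * ((v + 1) / 2)) = - sin (freq 1 i * v)"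
      unfolding tr f' by simp_all
    ultimately show ?thesis
      unfolding pf_term_def f' by (simp only: f den of_real_mult of_real_minus of_real_numeral)
  qed
  have "(\<Sum>i<2*N. pf_term 0 (v / 2) (2 * t) i - pf_term 0 ((v + 1) / 2) (2 * t) i) = (\<Sum>i<N. pf_term 1 v t i)"
    using even odd by (induction N) simp_all
  then show ?thesis
    unfolding pf_sum_def by (simp add: sum_subtractf)
qed


lemma partial_fractions:
  assumes k: "k \<in> {0, 1}" and t: "exp t \<noteq> 1" "exp t \<noteq> -1" and v: "v \<in> {0<..1}"
  shows "(\<lambda>N. pf_sum k v N t) \<longlonglongrightarrow>
           exp (of_real (1 - v) * t) / (exp t - (-1) ^ k) + of_real (pf_jump k v)"
proof (cases "k = 0")
  case True
  have "pf_sum 0 v (Suc N) t - pf_sum 0 v N t = pf_term 0 v t N" for N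
    by (simp add: pf_sum_def)
  then have "(\<lambda>N. pf_sum 0 v (Suc N) t - pf_sum 0 v N t) \<longlonglongrightarrow> 0"
    using pf_term_0_tendsto_0 by presburger
  then show ?thesis
    using LIMSEQ_even_imp_LIMSEQ[OF partial_fractions_0[OF t(1) v]] True by simp
next
  case False
  then have k1: "k = 1" using k by simp
  have e: "exp (2 * t) = exp t * exp t"
    by (simp flip: exp_add)
  have t2: "exp (2 * t) \<noteq> 1"
    using t unfolding e by (metis square_eq_1_iff)
  have dn: "(2 * t)\<^sup>2 + (of_real (freq 0 i))\<^sup>2 \<noteq> 0" for i
    using exp_ne_imp_denom_ne_0[of "2 * t" 0 i] t2 by simp
  have t0: "t \<noteq> 0" using t by auto
  \<comment> \<open>The argument (v+1)/2 reaches 1 exactly when v does, and it enters with a minus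
    sign; this produces the sign of \<open>pf_jump 1 v\<close>.\<close>
  have j: "pf_jump 0 (v / 2) = 0" "pf_jump 0 ((v + 1) / 2) = - pf_jump 1 v"
    using v by (auto simp: pf_jump_def)
  have "(\<lambda>N. pf_sum 0 (v / 2) (2 * N) (2 * t) - pf_sum 0 ((v + 1) / 2) (2 * N) (2 * t))
     \<longlonglongrightarrow> (exp (of_real (1 - v / 2) * (2 * t)) / (exp (2 * t) - 1) + of_real (pf_jump 0 (v / 2)))
       - (exp (of_real (1 - (v + 1) / 2) * (2 * t)) / (exp (2 * t) - 1) + of_real (pf_jump 0 ((v + 1) / 2)))"
    using v by (intro tendsto_diff partial_fractions_0 t2) auto
  moreover have "exp (of_real (1 - v / 2) * (2 * t)) / (exp (2 * t) - 1) - exp (of_real (1 - (v + 1) / 2) * (2 * t)) / (exp (2 * t) - 1)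
      = exp (of_real (1 - v) * t) / (exp t + 1)"
  proof -
    have e1: "exp (of_real (1 - v / 2) * (2 * t)) = exp (of_real (1 - v) * t) * exp t"
      by (simp add: algebra_simps flip: exp_add)
    have e2: "exp (of_real (1 - (v + 1) / 2) * (2 * t)) = exp (of_real (1 - v) * t)"
      by (simp add: algebra_simps diff_divide_distrib add_divide_distrib)
    have d: "exp t * exp t - 1 = (exp t - 1) * (exp t + 1)"
      by (simp add: algebra_simps)
    have nz: "exp t - 1 \<noteq> 0" "exp t + 1 \<noteq> 0"
      using t by (auto simp: eq_neg_iff_add_eq_0)
    have "(A * x) / ((x - 1) * (x + 1)) - A / ((x - 1) * (x + 1)) = A / (x + 1)"
      if "x - 1 \<noteq> 0" "x + 1 \<noteq> 0" for A x :: complex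
      using that by (simp add: divide_simps) (simp add: algebra_simps)
    then show ?thesis
      unfolding e1 e2 e d using nz by blast
  qed
  ultimately show ?thesis
    unfolding k1 pf_sum_1[OF t0 dn] j by (simp add: algebra_simps)
qed

section \<open>Mellin transforms of rational functions\<close>

text \<open>The power is extended by zero to t \<le> 0, so Mellin integrals become integrals over
  the whole line and need no indicator functions.\<close>

definition pos_powr :: "complex \<Rightarrow> real \<Rightarrow> complex"
  where "pos_powr z t = (if t > 0 then of_real t powr z else 0)"

lemma measurable_pos_powr [measurable]: "pos_powr z \<in> borel_measurable borel"
proof -
  have "pos_powr z = (\<lambda>t. if t > 0 then exp (z * of_real (ln t)) else 0)"
    by (auto simp: pos_powr_def powr_def Ln_of_real)
  then show ?thesis by simp
qed

lemma norm_pos_powr: "norm (pos_powr z t) = (if t > 0 then t powr Re z else 0)"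
  by (simp add: pos_powr_def norm_powr_real_powr)

lemma of_real_norm_pos_powr: "complex_of_real (norm (pos_powr z t)) = pos_powr (of_real (Re z)) t"
  unfolding norm_pos_powr by (simp add: pos_powr_def powr_of_real)

lemma pos_powr_add_nat: "t > 0 \<Longrightarrow> pos_powr (z + of_nat n) t = pos_powr z t * of_real t ^ n"
  by (simp add: pos_powr_def powr_add powr_nat')

lemma pos_powr_scale: "c > 0 \<Longrightarrow> pos_powr z (c * t) = of_real c powr z * pos_powr z t"
  by (auto simp: pos_powr_def zero_less_mult_iff powr_times_real)

lemma LINT_pos_powr:
  "(LINT t:{0<..}|lborel. of_real t powr z * h t) = (LINT t|lborel. pos_powr z t * h t)"
  unfolding set_lebesgue_integral_def
  by (intro Bochner_Integration.integral_cong) (auto simp: pos_powr_def indicator_def)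

lemma has_bochner_integral_Gamma:
  assumes z: "Re z > 0" and c: "c > 0"
  shows "has_bochner_integral lborel (\<lambda>r. pos_powr (z - 1) r * of_real (exp (- (c * r)))) (Gamma z * of_real c powr (- z))"
proof -
  define f where "f r = pos_powr (z - 1) r * of_real (exp (- r))" for r
  have f_eq: "f r = indicator {0<..} r *\<^sub>R (of_real r powr (z - 1) / of_real (exp r))" for r
    by (simp add: f_def pos_powr_def indicator_def exp_minus divide_inverse)
  have [measurable]: "f \<in> borel_measurable borel"
    unfolding f_def by measurable
  have "integrable lebesgue f"
    using absolutely_integrable_Gamma_integral'[OF z] unfolding set_integrable_def f_eq .
  then have int: "integrable lborel f"
    by (subst (asm) integrable_completion) auto
  have set_int: "set_integrable lborel {0<..} (\<lambda>r. of_real r powr (z - 1) / of_real (exp r))"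
    using int unfolding set_integrable_def f_eq .
  have "integral\<^sup>L lborel f = Gamma z"
    using set_borel_integral_eq_integral(2)[OF set_int] integral_unique[OF Gamma_integral_complex'[OF z]]
    unfolding set_lebesgue_integral_def f_eq by simp
  then have "has_bochner_integral lborel f (Gamma z)"
    using int has_bochner_integral_iff by blast
  from lborel_has_bochner_integral_real_affine_iff[where c = c and t = 0, THEN iffD1, OF _ this]
  have "has_bochner_integral lborel (\<lambda>r. f (c * r)) (Gamma z /\<^sub>R c)"
    using c by simp
  moreover have "f (c * r) = of_real c powr (z - 1) * (pos_powr (z - 1) r * of_real (exp (- (c * r))))" for r
    using c by (simp add: f_def pos_powr_scale)
  ultimately have "has_bochner_integral lborel
      (\<lambda>r. of_real c powr (1 - z) * (of_real c powr (z - 1) * (pos_powr (z - 1) r * of_real (exp (- (c * r))))))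
      (of_real c powr (1 - z) * (Gamma z /\<^sub>R c))"
    by (intro has_bochner_integral_mult_right) simp_all
  moreover have "of_real c powr (1 - z) * (of_real c powr (z - 1) * w) = w" for w :: complex
    using c by (simp add: powr_add[symmetric] mult.assoc[symmetric])
  moreover have "of_real c powr (1 - z) * (Gamma z /\<^sub>R c) = Gamma z * of_real c powr (- z)"
    using c powr_add[of "complex_of_real c" 1 "- z"] by (simp add: scaleR_conv_of_real field_simps)
  ultimately show ?thesis by simp
qed

text \<open>Write 1/(u+B) as the integral of e^(-(u+B)r) over r > 0 and exchange the integrations:
  the u-integral is Gamma(z) r^(-z), and the remaining r-integral is a Gamma integral with parameter
  1-z. The factor \<open>pos_powr 0 r\<close> is the indicator of r > 0.\<close>

lemma has_bochner_integral_Mellin_linear: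
  assumes z: "0 < Re z" "Re z < 1" and B: "B > 0"
  shows "has_bochner_integral lborel (\<lambda>u. pos_powr (z - 1) u / of_real (u + B))
           (Gamma z * Gamma (1 - z) * of_real B powr (z - 1))"
proof -
  define F where "F r u = pos_powr (z - 1) u * of_real (exp (- (r * u))) * (pos_powr 0 r * of_real (exp (- (B * r))))" for r u
  have meas: "case_prod F \<in> borel_measurable (lborel \<Otimes>\<^sub>M lborel)"
    unfolding F_def case_prod_beta by measurable
  have inner: "has_bochner_integral lborel (\<lambda>u. pos_powr (w - 1) u * of_real (exp (- (r * u))) * (pos_powr 0 r * of_real (exp (- (B * r)))))
      (Gamma w * (pos_powr (- w) r * of_real (exp (- (B * r)))))" if w: "Re w > 0" for r w
  proof (cases "r > 0")
    case True
    have "has_bochner_integral lborel (\<lambda>u. pos_powr (w - 1) u * of_real (exp (- (r * u))) * (pos_powr 0 r * of_real (exp (- (B * r)))))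
        (Gamma w * of_real r powr (- w) * (pos_powr 0 r * of_real (exp (- (B * r)))))"
      by (rule has_bochner_integral_mult_left[OF has_bochner_integral_Gamma[OF w True]])
    then show ?thesis using True by (simp add: pos_powr_def mult.assoc)
  qed (simp add: pos_powr_def has_bochner_integral_zero)
  note inner_u = inner[OF z(1), folded F_def]
  have inner_r: "has_bochner_integral lborel (\<lambda>r. F r u) (pos_powr (z - 1) u / of_real (u + B))" for u
  proof (cases "u > 0")
    case True
    then have "u + B > 0" using B by simp
    from has_bochner_integral_mult_right[OF has_bochner_integral_Gamma[of 1, OF _ this], of "pos_powr (z - 1) u"]
    have "has_bochner_integral lborel (\<lambda>r. pos_powr (z - 1) u * (pos_powr 0 r * of_real (exp (- ((u + B) * r)))))
         (pos_powr (z - 1) u * of_real (u + B) powr (- 1))" by simp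
    also have "(\<lambda>r. pos_powr (z - 1) u * (pos_powr 0 r * of_real (exp (- ((u + B) * r))))) = (\<lambda>r. F r u)"
      by (auto simp: F_def fun_eq_iff algebra_simps exp_add[symmetric] exp_diff[symmetric] simp flip: of_real_mult)
    also have "of_real (u + B) powr (- 1) = 1 / complex_of_real (u + B)"
      by (simp add: powr_minus_divide)
    finally show ?thesis by simp
  qed (simp add: F_def pos_powr_def has_bochner_integral_zero)
  \<comment> \<open>The norm of \<open>F\<close> is \<open>F\<close> with z replaced by Re z, so the
    hypothesis of Fubini follows from the same inner formula; the r-integral converges because Re z
    < 1.\<close>
  have "complex_of_real (LINT u|lborel. norm (F r u)) = Gamma (of_real (Re z)) * (pos_powr (- of_real (Re z)) r * of_real (exp (- (B * r))))" for r
  proof -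
    have "complex_of_real (norm (F r u)) = pos_powr (of_real (Re z) - 1) u * of_real (exp (- (r * u))) * (pos_powr 0 r * of_real (exp (- (B * r))))" for u
      by (simp add: F_def norm_mult of_real_norm_pos_powr)
    then have "has_bochner_integral lborel (\<lambda>u. complex_of_real (norm (F r u)))
       (Gamma (of_real (Re z)) * (pos_powr (- of_real (Re z)) r * of_real (exp (- (B * r)))))"
      using inner[of "of_real (Re z)" r] z by simp
    from has_bochner_integral_integral_eq[OF this] show ?thesis by simp
  qed
  moreover have "integrable lborel (\<lambda>r. Gamma (of_real (Re z)) * (pos_powr (- of_real (Re z)) r * complex_of_real (exp (- (B * r)))))"
    using has_bochner_integral_Gamma[of "1 - of_real (Re z)" B] z B by (auto simp: has_bochner_integral_iff)
  ultimately have "integrable lborel (\<lambda>r. complex_of_real (LINT u|lborel. norm (F r u)))"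
    by simp
  from integrable_Re[OF this] have norm_int: "integrable lborel (\<lambda>r. LINT u|lborel. norm (F r u))"
    by simp
  have int: "integrable (lborel \<Otimes>\<^sub>M lborel) (case_prod F)"
    by (rule lborel_pair.Fubini_integrable[OF meas])
       (use norm_int inner_u in \<open>simp_all add: has_bochner_integral_iff\<close>)
  have "integrable lborel (\<lambda>u. LINT r|lborel. F r u)"
    using lborel_pair.integrable_snd[OF int] by simp
  moreover have "(LINT u|lborel. LINT r|lborel. F r u) = (LINT r|lborel. LINT u|lborel. F r u)"
    by (rule lborel_pair.Fubini_integral[OF int])
  moreover have "(LINT r|lborel. F r u) = pos_powr (z - 1) u / of_real (u + B)" for u
    using inner_r has_bochner_integral_iff by blast
  moreover have "(LINT u|lborel. F r u) = Gamma z * (pos_powr (- z) r * of_real (exp (- (B * r))))" for r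
    using inner_u has_bochner_integral_iff by blast
  moreover have "has_bochner_integral lborel (\<lambda>r. Gamma z * (pos_powr (- z) r * of_real (exp (- (B * r)))))
     (Gamma z * (Gamma (1 - z) * of_real B powr (- (1 - z))))"
    using has_bochner_integral_mult_right[OF has_bochner_integral_Gamma[of "1 - z" B], of "Gamma z"] z B by simp
  ultimately show ?thesis
    by (simp add: has_bochner_integral_iff mult.assoc)
qed


lemma has_bochner_integral_square_substitution:
  fixes f :: "real \<Rightarrow> complex"
  assumes f: "has_bochner_integral lborel f I" and zero: "\<And>u. u \<le> 0 \<Longrightarrow> f u = 0"
  shows "has_bochner_integral lborel (\<lambda>t. indicator {0<..} t *\<^sub>R ((2 * t) *\<^sub>R f (t\<^sup>2))) I"
proof -
  have [measurable]: "f \<in> borel_measurable borel"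
    using borel_measurable_has_bochner_integral[OF f] by simp
  have img: "power2 ` {0<..} = ({0<..} :: real set)"
  proof -
    have "\<exists>y>0. x = y\<^sup>2" if "x > 0" for x :: real
      using that by (intro exI[of _ "sqrt x"]) auto
    then show ?thesis by auto
  qed
  have f_ind: "indicator {0<..} u *\<^sub>R f u = f u" for u
    using zero[of u] by (auto simp: indicator_def)
  have si: "set_integrable lborel {0<..} f"
    using f unfolding set_integrable_def f_ind has_bochner_integral_iff by blast
  have "f absolutely_integrable_on {0<..}"
    using si unfolding set_integrable_def by (subst integrable_completion) auto
  moreover have "integral {0<..} f = I"
    using set_borel_integral_eq_integral(2)[OF si] f
    unfolding set_lebesgue_integral_def f_ind by (simp add: has_bochner_integral_iff)
  moreover have "inj_on power2 ({0<..} :: real set)"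
    by (auto simp: inj_on_def)
  moreover have "(power2 has_field_derivative 2 * x) (at x within {0<..})" for x :: real
    by (auto intro!: derivative_eq_intros)
  ultimately have *: "(\<lambda>t. \<bar>2 * t\<bar> *\<^sub>R f (t\<^sup>2)) absolutely_integrable_on {0<..} \<and> integral {0<..} (\<lambda>t. \<bar>2 * t\<bar> *\<^sub>R f (t\<^sup>2)) = I"
    by (subst has_absolute_integral_change_of_variables_real) (auto simp: img)
  have eq: "indicator {0<..} t *\<^sub>R (\<bar>2 * t\<bar> *\<^sub>R f (t\<^sup>2)) = indicator {0<..} t *\<^sub>R ((2 * t) *\<^sub>R f (t\<^sup>2))" for t :: real
    by (auto simp: indicator_def)
  have int: "integrable lborel (\<lambda>t. indicator {0<..} t *\<^sub>R ((2 * t) *\<^sub>R f (t\<^sup>2)))"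
    using *[THEN conjunct1] unfolding set_integrable_def eq by (subst (asm) integrable_completion) auto
  have si': "set_integrable lborel {0<..} (\<lambda>t. \<bar>2 * t\<bar> *\<^sub>R f (t\<^sup>2))"
    using int unfolding set_integrable_def eq .
  show ?thesis
    using int set_borel_integral_eq_integral(2)[OF si'] *
    unfolding set_lebesgue_integral_def eq by (simp add: has_bochner_integral_iff)
qed

lemma sin_pi_half_eq_0D:
  assumes "sin (of_real pi * z / 2) = (0 :: complex)"
  obtains n :: int where "z = of_int (2 * n)"
proof -
  obtain n :: int where n: "of_real pi * z / 2 = of_real (of_int n * pi)"
    using assms unfolding sin_eq_0 by auto
  show ?thesis
    by (rule that[of n]) (use n in \<open>simp add: field_simps\<close>)
qed

text \<open>The linear case for z/2 and B = b^2 under u = t^2; the reflection formula turns the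
  Gamma product into pi/sin.\<close>

lemma has_bochner_integral_Mellin_square:
  assumes z: "0 < Re z" "Re z < 2" and b: "b > 0"
  shows "has_bochner_integral lborel (\<lambda>t. pos_powr (z - 1) t / of_real (t\<^sup>2 + b\<^sup>2))
           (of_real pi / 2 * of_real b powr (z - 2) / sin (of_real pi * z / 2))"
proof -
  have "has_bochner_integral lborel (\<lambda>u. pos_powr (z / 2 - 1) u / of_real (u + b\<^sup>2))
           (Gamma (z / 2) * Gamma (1 - z / 2) * of_real (b\<^sup>2) powr (z / 2 - 1))"
    by (rule has_bochner_integral_Mellin_linear) (use z b in auto)
  from has_bochner_integral_square_substitution[OF this]
  have "has_bochner_integral lborel (\<lambda>t. (1/2) *\<^sub>R (indicator {0<..} t *\<^sub>R ((2 * t) *\<^sub>R (pos_powr (z / 2 - 1) (t\<^sup>2) / of_real (t\<^sup>2 + b\<^sup>2)))))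
           ((1/2) *\<^sub>R (Gamma (z / 2) * Gamma (1 - z / 2) * of_real (b\<^sup>2) powr (z / 2 - 1)))"
    by (intro has_bochner_integral_scaleR_right) (auto simp: pos_powr_def)
  moreover have "(1/2) *\<^sub>R (indicator {0<..} t *\<^sub>R ((2 * t) *\<^sub>R (pos_powr (z / 2 - 1) (t\<^sup>2) / of_real (t\<^sup>2 + b\<^sup>2))))
      = pos_powr (z - 1) t / of_real (t\<^sup>2 + b\<^sup>2)" for t
  proof (cases "t > 0")
    case True
    have "pos_powr (z - 1) t = pos_powr (z - 2) t * of_real t"
      using pos_powr_add_nat[OF True, of "z - 2" 1] by simp
    moreover have "pos_powr (z / 2 - 1) (t\<^sup>2) = pos_powr (z - 2) t"
      using True by (simp add: pos_powr_def powr_def Ln_of_real ln_realpow algebra_simps del: of_real_power)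
    ultimately show ?thesis using True by (simp add: scaleR_conv_of_real)
  qed (simp add: pos_powr_def)
  moreover have "(1/2) *\<^sub>R (Gamma (z / 2) * Gamma (1 - z / 2) * of_real (b\<^sup>2) powr (z / 2 - 1))
     = of_real pi / 2 * of_real b powr (z - 2) / sin (of_real pi * z / 2)"
  proof -
    have "of_real (b\<^sup>2) powr (z / 2 - 1) = of_real b powr (z - 2)"
      using b by (simp add: powr_def Ln_of_real ln_realpow algebra_simps del: of_real_power)
    then show ?thesis
      using Gamma_reflection_complex[of "z / 2"] by (simp add: scaleR_conv_of_real)
  qed
  ultimately show ?thesis by simp
qed

text \<open>The power is split as t^(Re z/2) t^(Re z/2 - 1). The first factor is at most 1+t^2,
  hence at most C(t^2+x^2), and the second is a Mellin integrand with parameter Re z/2 in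
  (0,2).\<close>

lemma integrable_pos_powr_div_square_square:
  assumes z: "0 < Re z" "Re z < 4" and b: "b > 0" and x: "x > 0"
  shows "integrable lborel (\<lambda>t. pos_powr (z - 1) t / of_real ((t\<^sup>2 + x\<^sup>2) * (t\<^sup>2 + b\<^sup>2)))"
proof (rule Bochner_Integration.integrable_bound)
  define C where "C = 1 / x\<^sup>2 + 1"
  have "integrable lborel (\<lambda>t. pos_powr (of_real (Re z / 2) - 1) t / of_real (t\<^sup>2 + b\<^sup>2))"
    using has_bochner_integral_Mellin_square[of "of_real (Re z / 2)" b] z b
    by (simp add: has_bochner_integral_iff)
  then show "integrable lborel (\<lambda>t. C * norm (pos_powr (of_real (Re z / 2) - 1) t / of_real (t\<^sup>2 + b\<^sup>2)))"
    by (intro integrable_mult_right integrable_norm)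
  show "AE t in lborel. norm (pos_powr (z - 1) t / of_real ((t\<^sup>2 + x\<^sup>2) * (t\<^sup>2 + b\<^sup>2)))
      \<le> norm (C * norm (pos_powr (of_real (Re z / 2) - 1) t / of_real (t\<^sup>2 + b\<^sup>2)))"
  proof (rule always_eventually, rule allI)
    fix t :: real
    show "norm (pos_powr (z - 1) t / of_real ((t\<^sup>2 + x\<^sup>2) * (t\<^sup>2 + b\<^sup>2)))
      \<le> norm (C * norm (pos_powr (of_real (Re z / 2) - 1) t / of_real (t\<^sup>2 + b\<^sup>2)))"
    proof (cases "t > 0")
      case True
      have pos: "t\<^sup>2 + x\<^sup>2 > 0" "t\<^sup>2 + b\<^sup>2 > 0"
        using True by (simp_all add: add_pos_nonneg)
      have "t powr (Re z / 2) \<le> 1 + t\<^sup>2"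
      proof (cases "t \<le> 1")
        case le: True
        then have "t powr (Re z / 2) \<le> 1"
          using z True by (intro powr_le1) auto
        then show ?thesis by (smt (verit) zero_le_power2)
      next
        case False
        then have "t powr (Re z / 2) \<le> t powr 2"
          using z by (intro powr_mono) auto
        then show ?thesis using True by simp
      qed
      also have "1 + t\<^sup>2 \<le> C * (t\<^sup>2 + x\<^sup>2)"
        using x by (simp add: C_def field_simps)
      finally have "t powr (Re z / 2) / (t\<^sup>2 + x\<^sup>2) \<le> C"
        using pos by (simp add: divide_le_eq)
      then have "t powr (Re z / 2) / (t\<^sup>2 + x\<^sup>2) * (t powr (Re z / 2 - 1) / (t\<^sup>2 + b\<^sup>2)) \<le> C * (t powr (Re z / 2 - 1) / (t\<^sup>2 + b\<^sup>2))"
        using pos by (intro mult_right_mono) auto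
      moreover have "t powr (Re z - 1) = t powr (Re z / 2) * t powr (Re z / 2 - 1)"
        by (simp add: powr_add[symmetric])
      moreover have "C \<ge> 0" by (simp add: C_def)
      ultimately show ?thesis
        using True pos by (simp add: norm_divide norm_mult norm_pos_powr abs_mult del: of_real_add of_real_mult of_real_power)
    qed (simp add: pos_powr_def)
  qed
qed measurable

text \<open>For \<open>Re z = 2\<close> neither of the two partial fraction decompositions leads to convergent
  integrals; this case is a limit of \<open>Re z < 2\<close>.\<close>

lemma has_bochner_integral_Mellin_square_square:
  assumes z: "0 < Re z" "Re z < 4" "z \<noteq> 2" and b: "b > 0" and x: "x > 0" "x \<noteq> b"
  shows "has_bochner_integral lborel (\<lambda>t. pos_powr (z - 1) t / of_real ((t\<^sup>2 + x\<^sup>2) * (t\<^sup>2 + b\<^sup>2)))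
           (of_real pi / 2 / sin (of_real pi * z / 2) * (of_real b powr (z - 2) - of_real x powr (z - 2)) / of_real (x\<^sup>2 - b\<^sup>2))"
proof -
  define V :: "complex \<Rightarrow> complex" where "V w = of_real pi / 2 / sin (of_real pi * w / 2) * (of_real b powr (w - 2) - of_real x powr (w - 2)) / of_real (x\<^sup>2 - b\<^sup>2)" for w
  have xb: "x\<^sup>2 - b\<^sup>2 \<noteq> 0"
    using x b by (simp add: power2_eq_iff_nonneg)
  have denom: "t\<^sup>2 + c\<^sup>2 > 0" if "c > 0" for t c :: real
    using that by (simp add: add_nonneg_pos)
  \<comment> \<open>The first decomposition serves Re z < 2. For Re z > 2 a factor t^2 is taken out
    of the power, so that the second applies with parameter z-2 in (0,2).\<close>
  have pf: "1 / ((t\<^sup>2 + x\<^sup>2) * (t\<^sup>2 + b\<^sup>2)) = (1 / (t\<^sup>2 + b\<^sup>2) - 1 / (t\<^sup>2 + x\<^sup>2)) / (x\<^sup>2 - b\<^sup>2)"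
    "t\<^sup>2 / ((t\<^sup>2 + x\<^sup>2) * (t\<^sup>2 + b\<^sup>2)) = (x\<^sup>2 / (t\<^sup>2 + x\<^sup>2) - b\<^sup>2 / (t\<^sup>2 + b\<^sup>2)) / (x\<^sup>2 - b\<^sup>2)" for t :: real
  proof -
    have gen: "1 / (X * B) = (1 / B - 1 / X) / (p - q)" "r / (X * B) = (p / X - q / B) / (p - q)"
      if "X = r + p" "B = r + q" "X \<noteq> 0" "B \<noteq> 0" "p - q \<noteq> 0" for X B r p q :: real
    proof -
      have "1 / B - 1 / X = (p - q) / (X * B)" "p / X - q / B = r * (p - q) / (X * B)"
        using that(3,4) by (simp_all add: divide_simps) (simp_all add: that(1,2) algebra_simps)
      then show "1 / (X * B) = (1 / B - 1 / X) / (p - q)" "r / (X * B) = (p / X - q / B) / (p - q)"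
        using that(5) by simp_all
    qed
    have d: "t\<^sup>2 + x\<^sup>2 \<noteq> 0" "t\<^sup>2 + b\<^sup>2 \<noteq> 0"
      using denom[OF x(1), of t] denom[OF b, of t] by linarith+
    show "1 / ((t\<^sup>2 + x\<^sup>2) * (t\<^sup>2 + b\<^sup>2)) = (1 / (t\<^sup>2 + b\<^sup>2) - 1 / (t\<^sup>2 + x\<^sup>2)) / (x\<^sup>2 - b\<^sup>2)"
      by (rule gen(1)[OF refl refl d xb])
    show "t\<^sup>2 / ((t\<^sup>2 + x\<^sup>2) * (t\<^sup>2 + b\<^sup>2)) = (x\<^sup>2 / (t\<^sup>2 + x\<^sup>2) - b\<^sup>2 / (t\<^sup>2 + b\<^sup>2)) / (x\<^sup>2 - b\<^sup>2)"
      by (rule gen(2)[OF refl refl d xb])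
  qed
  have less: "has_bochner_integral lborel (\<lambda>t. pos_powr (w - 1) t / of_real ((t\<^sup>2 + x\<^sup>2) * (t\<^sup>2 + b\<^sup>2))) (V w)"
    if w: "0 < Re w" "Re w < 2" for w
  proof -
    have "pos_powr (w - 1) t / of_real ((t\<^sup>2 + x\<^sup>2) * (t\<^sup>2 + b\<^sup>2))
        = (pos_powr (w - 1) t / of_real (t\<^sup>2 + b\<^sup>2) - pos_powr (w - 1) t / of_real (t\<^sup>2 + x\<^sup>2)) / of_real (x\<^sup>2 - b\<^sup>2)" for t
    proof -
      have "pos_powr (w - 1) t / of_real ((t\<^sup>2 + x\<^sup>2) * (t\<^sup>2 + b\<^sup>2)) = pos_powr (w - 1) t * of_real (1 / ((t\<^sup>2 + x\<^sup>2) * (t\<^sup>2 + b\<^sup>2)))"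
        by simp
      then show ?thesis unfolding pf(1) by (simp add: right_diff_distrib)
    qed
    moreover have "V w = (of_real pi / 2 * of_real b powr (w - 2) / sin (of_real pi * w / 2)
        - of_real pi / 2 * of_real x powr (w - 2) / sin (of_real pi * w / 2)) / of_real (x\<^sup>2 - b\<^sup>2)"
      by (simp add: V_def right_diff_distrib diff_divide_distrib)
    ultimately show ?thesis
      using w b x by (simp only:) (intro has_bochner_integral_divide_zero has_bochner_integral_diff has_bochner_integral_Mellin_square)
  qed
  consider "Re z < 2" | "Re z = 2" | "Re z > 2" by linarith
  then show ?thesis
  proof cases
    case 1
    with less z show ?thesis by (simp add: V_def)
  next
    case 3
    have "pos_powr (z - 1) t / of_real ((t\<^sup>2 + x\<^sup>2) * (t\<^sup>2 + b\<^sup>2))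
        = (of_real (x\<^sup>2) * (pos_powr (z - 2 - 1) t / of_real (t\<^sup>2 + x\<^sup>2)) - of_real (b\<^sup>2) * (pos_powr (z - 2 - 1) t / of_real (t\<^sup>2 + b\<^sup>2))) / of_real (x\<^sup>2 - b\<^sup>2)" for t
    proof (cases "t > 0")
      case True
      have "pos_powr (z - 1) t / of_real ((t\<^sup>2 + x\<^sup>2) * (t\<^sup>2 + b\<^sup>2)) = pos_powr (z - 2 - 1) t * of_real (t\<^sup>2 / ((t\<^sup>2 + x\<^sup>2) * (t\<^sup>2 + b\<^sup>2)))"
        using pos_powr_add_nat[OF True, of "z - 2 - 1" 2] by (simp add: algebra_simps)
      then show ?thesis unfolding pf(2) by (simp add: right_diff_distrib mult.commute)
    qed (simp add: pos_powr_def)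
    moreover have "V z = (of_real (x\<^sup>2) * (of_real pi / 2 * of_real x powr (z - 2 - 2) / sin (of_real pi * (z - 2) / 2))
        - of_real (b\<^sup>2) * (of_real pi / 2 * of_real b powr (z - 2 - 2) / sin (of_real pi * (z - 2) / 2))) / of_real (x\<^sup>2 - b\<^sup>2)"
    proof -
      have "of_real pi * (z - 2) / 2 = of_real pi * z / 2 - of_real pi"
        by (simp add: algebra_simps diff_divide_distrib)
      then have s: "sin (of_real pi * (z - 2) / 2) = - sin (of_real pi * z / 2)"
        by (simp only:) (simp add: sin_diff)
      have "of_real (c\<^sup>2) * of_real c powr (z - 2 - 2) = complex_of_real c powr (z - 2)" if "c > 0" for c
        using that powr_add[of "complex_of_real c" 2 "z - 2 - 2"] by (simp add: powr_numeral)
      from this[OF b] this[OF x(1)] show ?thesis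
        unfolding V_def s by (simp add: right_diff_distrib diff_divide_distrib mult.left_commute mult.assoc)
    qed
    ultimately show ?thesis
      unfolding V_def[symmetric] using z b x 3
      by (simp only:) (intro has_bochner_integral_divide_zero has_bochner_integral_diff has_bochner_integral_mult_right has_bochner_integral_Mellin_square, auto)
  next
    case 2
    \<comment> \<open>The approach is from the left with 1 \<le> Re w < 2. On the line Re z = 2 the
      condition z \<noteq> 2 is what keeps sin(pi z/2) away from 0, so the closed form is continuous
      at z.\<close>
    define w where "w n = z - of_real (1 / (real n + 1))" for n
    have w_lim: "w \<longlonglongrightarrow> z"
    proof -
      have "(\<lambda>n. complex_of_real (1 / (real n + 1))) \<longlonglongrightarrow> of_real 0"
        by (intro tendsto_of_real) (use LIMSEQ_inverse_real_of_nat in \<open>simp add: inverse_eq_divide add.commute\<close>)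
      then show ?thesis
        unfolding w_def using tendsto_diff[OF tendsto_const] by fastforce
    qed
    have Re_w: "1 \<le> Re (w n)" "Re (w n) < 2" for n
      using 2 by (simp_all add: w_def)
    have sin_ne: "sin (of_real pi * z / 2) \<noteq> 0"
      using 2 z(3) by (auto elim!: sin_pi_half_eq_0D)
    have xb': "complex_of_real (x\<^sup>2 - b\<^sup>2) \<noteq> 0"
      using xb unfolding of_real_eq_0_iff .
    have pw: "(\<lambda>n. complex_of_real c powr (w n - 2)) \<longlonglongrightarrow> of_real c powr (z - 2)" if "c > 0" for c
      using that by (simp add: powr_def) (intro tendsto_intros w_lim)
    have "(\<lambda>n. V (w n)) \<longlonglongrightarrow> V z"
      unfolding V_def
      by (intro tendsto_divide tendsto_mult tendsto_diff tendsto_const tendsto_sin w_lim pw b x(1) xb' sin_ne) simp_all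
    moreover have "(\<lambda>n. LINT t|lborel. pos_powr (w n - 1) t / of_real ((t\<^sup>2 + x\<^sup>2) * (t\<^sup>2 + b\<^sup>2)))
        \<longlonglongrightarrow> (LINT t|lborel. pos_powr (z - 1) t / of_real ((t\<^sup>2 + x\<^sup>2) * (t\<^sup>2 + b\<^sup>2)))"
    proof (rule integral_dominated_convergence)
      \<comment> \<open>On t > 0 the two powers are t and 1, and t^(Re w - 1) \<le> t + 1 for all w
        of the sequence.\<close>
      show "integrable lborel (\<lambda>t. norm (pos_powr (2 - 1) t / of_real ((t\<^sup>2 + x\<^sup>2) * (t\<^sup>2 + b\<^sup>2)))
           + norm (pos_powr (1 - 1) t / of_real ((t\<^sup>2 + x\<^sup>2) * (t\<^sup>2 + b\<^sup>2))))"
        using b x by (intro Bochner_Integration.integrable_add integrable_norm integrable_pos_powr_div_square_square) auto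
      show "AE t in lborel. (\<lambda>n. pos_powr (w n - 1) t / of_real ((t\<^sup>2 + x\<^sup>2) * (t\<^sup>2 + b\<^sup>2)))
         \<longlonglongrightarrow> pos_powr (z - 1) t / of_real ((t\<^sup>2 + x\<^sup>2) * (t\<^sup>2 + b\<^sup>2))"
      proof (rule always_eventually, rule allI)
        fix t :: real
        show "(\<lambda>n. pos_powr (w n - 1) t / of_real ((t\<^sup>2 + x\<^sup>2) * (t\<^sup>2 + b\<^sup>2)))
         \<longlonglongrightarrow> pos_powr (z - 1) t / of_real ((t\<^sup>2 + x\<^sup>2) * (t\<^sup>2 + b\<^sup>2))"
        proof (intro tendsto_divide tendsto_const)
          show "(\<lambda>n. pos_powr (w n - 1) t) \<longlonglongrightarrow> pos_powr (z - 1) t"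
            unfolding pos_powr_def by (cases "t > 0") (auto simp: powr_def intro!: tendsto_intros w_lim)
          show "complex_of_real ((t\<^sup>2 + x\<^sup>2) * (t\<^sup>2 + b\<^sup>2)) \<noteq> 0"
            unfolding of_real_eq_0_iff using b x by simp
        qed
      qed
      show "AE t in lborel. norm (pos_powr (w n - 1) t / of_real ((t\<^sup>2 + x\<^sup>2) * (t\<^sup>2 + b\<^sup>2)))
         \<le> norm (pos_powr (2 - 1) t / of_real ((t\<^sup>2 + x\<^sup>2) * (t\<^sup>2 + b\<^sup>2)))
           + norm (pos_powr (1 - 1) t / of_real ((t\<^sup>2 + x\<^sup>2) * (t\<^sup>2 + b\<^sup>2)))" for n
      proof (rule always_eventually, rule allI)
        fix t :: real
        have "norm (pos_powr (w n - 1) t) \<le> norm (pos_powr (2 - 1) t) + norm (pos_powr (1 - 1) t)"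
        proof (cases "t > 0")
          case True
          have "t powr (Re (w n) - 1) \<le> t + 1"
          proof (cases "t \<le> 1")
            case le: True
            then have "t powr (Re (w n) - 1) \<le> 1"
              using Re_w[of n] True by (intro powr_le1) auto
            with True show ?thesis by simp
          next
            case False
            then have "t powr (Re (w n) - 1) \<le> t powr 1"
              using Re_w[of n] by (intro powr_mono) auto
            then show ?thesis using True by simp
          qed
          then show ?thesis using True by (simp add: norm_pos_powr)
        qed (simp add: pos_powr_def)
        then show "norm (pos_powr (w n - 1) t / of_real ((t\<^sup>2 + x\<^sup>2) * (t\<^sup>2 + b\<^sup>2)))
         \<le> norm (pos_powr (2 - 1) t / of_real ((t\<^sup>2 + x\<^sup>2) * (t\<^sup>2 + b\<^sup>2)))
           + norm (pos_powr (1 - 1) t / of_real ((t\<^sup>2 + x\<^sup>2) * (t\<^sup>2 + b\<^sup>2)))"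
          unfolding norm_divide add_divide_distrib[symmetric] by (intro divide_right_mono) auto
      qed
    qed measurable
    moreover have "(LINT t|lborel. pos_powr (w n - 1) t / of_real ((t\<^sup>2 + x\<^sup>2) * (t\<^sup>2 + b\<^sup>2))) = V (w n)" for n
      using less[of "w n"] Re_w[of n] by (intro has_bochner_integral_integral_eq) linarith+
    ultimately have "(LINT t|lborel. pos_powr (z - 1) t / of_real ((t\<^sup>2 + x\<^sup>2) * (t\<^sup>2 + b\<^sup>2))) = V z"
      using LIMSEQ_unique by force
    then show ?thesis
      unfolding has_bochner_integral_iff V_def[symmetric]
      using integrable_pos_powr_div_square_square[of z b x] z b x by simp
  qed
qed

section \<open>Uniform bounds for the partial sums\<close>

lemma freq_ge: "k \<le> 1 \<Longrightarrow> freq k i \<ge> 2 * (real i + 1)"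
proof -
  assume k: "k \<le> 1"
  have "2 * (real i + 1) \<le> pi * (real i + 1)"
    using pi_ge_two by (intro mult_right_mono) auto
  also have "\<dots> \<le> freq k i"
    unfolding freq_def using k by (intro mult_left_mono) auto
  finally show ?thesis .
qed

text \<open>With X = t + 2(i+1), t^2 + c^2 is at least X^2/2 for the i-th frequency c, and 2/X^2
  \<le> 1/(X-1) - 1/(X+1). Since X grows by 2 with i, the differences telescope.\<close>

lemma sum_inverse_square_freq_le:
  assumes k: "k \<le> 1" and t: "t > 0"
  shows "(\<Sum>i<N. 1 / (t\<^sup>2 + (freq k i)\<^sup>2)) \<le> 1 / (1 + t)"
proof -
  have "1 / (t\<^sup>2 + (freq k i)\<^sup>2) \<le> 1 / (t + 2 * real i + 1) - 1 / (t + 2 * real (Suc i) + 1)" for i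
  proof -
    define X where "X = t + 2 * (real i + 1)"
    have X: "X > 2" using t by (simp add: X_def)
    have "X\<^sup>2 \<le> 2 * (t\<^sup>2 + (2 * (real i + 1))\<^sup>2)"
      unfolding X_def using sum_squares_ge_zero[of "t - 2 * (real i + 1)" 0]
      by (simp add: power2_eq_square algebra_simps)
    also have "\<dots> \<le> 2 * (t\<^sup>2 + (freq k i)\<^sup>2)"
      using freq_ge[OF k, of i] by (intro mult_left_mono add_left_mono power_mono) auto
    finally have "1 / (t\<^sup>2 + (freq k i)\<^sup>2) \<le> 2 / X\<^sup>2"
      using X t by (simp add: divide_simps add_pos_nonneg)
    also have "\<dots> \<le> 2 / ((X - 1) * (X + 1))"
      using X mult_strict_mono[of 1 X 1 X] by (intro divide_left_mono) (auto simp: power2_eq_square algebra_simps)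
    also have "\<dots> = 1 / (X - 1) - 1 / (X + 1)"
      using X by (simp add: divide_simps)
    finally show ?thesis by (simp add: X_def algebra_simps)
  qed
  then have "(\<Sum>i<N. 1 / (t\<^sup>2 + (freq k i)\<^sup>2)) \<le> (\<Sum>i<N. 1 / (t + 2 * real i + 1) - 1 / (t + 2 * real (Suc i) + 1))"
    by (rule sum_mono)
  also have "\<dots> = 1 / (t + 1) - 1 / (t + 2 * real N + 1)"
    by (subst sum_lessThan_telescope') simp
  also have "\<dots> \<le> 1 / (1 + t)" using t by (simp add: add.commute)
  finally show ?thesis .
qed

text \<open>At v = 1 the sines vanish and the cosines are \<plusminus>1, so absolute summation
  works, but the bound obtained does not decay in t. This is what restricts Re a to values below 2
  for v = 1.\<close>

lemma norm_sum_pf_term_le_1: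
  assumes k: "k \<le> 1" and t: "t > 0"
  shows "norm (\<Sum>i<N. pf_term k 1 (of_real t) i) \<le> 2"
proof -
  have "norm (pf_term k 1 (of_real t) i) = 2 * t * (1 / (t\<^sup>2 + (freq k i)\<^sup>2))" for i
  proof -
    have "cis (freq k i) \<in> {1, -1}"
      unfolding cis_freq[OF k] using k by (auto simp: le_Suc_eq)
    then have "sin (freq k i) = 0" "cos (freq k i) = 1 \<or> cos (freq k i) = -1"
      by (auto simp: complex_eq_iff)
    moreover have "norm ((complex_of_real t)\<^sup>2 + (of_real (freq k i))\<^sup>2) = t\<^sup>2 + (freq k i)\<^sup>2"
      by (metis abs_of_nonneg norm_of_real of_real_add of_real_power sum_power2_ge_zero)
    ultimately show ?thesis
      unfolding pf_term_def using t by (auto simp: norm_divide norm_mult)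
  qed
  then have "(\<Sum>i<N. norm (pf_term k 1 (of_real t) i)) = 2 * t * (\<Sum>i<N. 1 / (t\<^sup>2 + (freq k i)\<^sup>2))"
    by (simp add: sum_distrib_left)
  also have "\<dots> \<le> 2 * t * (1 / (1 + t))"
    using sum_inverse_square_freq_le[OF k t] t by (intro mult_left_mono) auto
  also have "\<dots> \<le> 2" using t by (simp add: field_simps)
  finally show ?thesis
    using norm_sum[of "pf_term k 1 (of_real t)" "{..<N}"] by linarith
qed

text \<open>Abel summation: the numerators form a geometric progression with ratio \<open>\<omega> \<noteq> 1\<close>, so
  multiplication by \<open>1 - \<omega>\<close> replaces the summands by their differences.\<close>

lemma norm_sum_pf_term_le:
  assumes k: "k \<le> 1" and t: "t > 0" and v: "v \<in> {0<..<1}"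
  shows "norm (\<Sum>i<N. pf_term k v (of_real t) i) \<le> 2 * (4 + 2 * pi) / norm (1 - cis (- (2 * pi * v))) / (1 + t)"
proof -
  \<comment> \<open>\<open>q i\<close> is the residue of w at the pole i c, with c the i-th
    frequency, and \<open>u i\<close> the corresponding simple fraction; the conjugate pole
    contributes the conjugate, so a term is twice the real part of \<open>q i * u i\<close>.\<close>
  define q where "q i = cis (- (freq k i * v))" for i
  define \<omega> where "\<omega> = cis (- (2 * pi * v))"
  define u where "u i = 1 / (complex_of_real t - \<i> * of_real (freq k i))" for i
  have q_Suc: "q (Suc i) = \<omega> * q i" for i
    unfolding q_def \<omega>_def cis_mult by (simp add: freq_def algebra_simps)
  have norm_q: "norm (q i) = 1" for i
    by (simp add: q_def)
  have \<omega>1: "1 - \<omega> \<noteq> 0"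
  proof
    assume "1 - \<omega> = 0"
    then have "cos (2 * pi * v) = 1"
      by (simp add: \<omega>_def complex_eq_iff)
    then obtain m :: int where "2 * pi * v = of_int m * 2 * pi"
      by (auto simp: cos_one_2pi_int)
    then have "0 < m \<and> m < 1" using v by simp
    then show False by linarith
  qed
  have nz: "complex_of_real t - \<i> * of_real (freq k i) \<noteq> 0" for i
    using t by (auto simp: complex_eq_iff)
  have norm_den: "norm (complex_of_real t - \<i> * of_real (freq k i)) = sqrt (t\<^sup>2 + (freq k i)\<^sup>2)" for i
    by (simp add: cmod_def)
  have term_eq: "pf_term k v (of_real t) i = of_real (2 * Re (q i * u i))" for i
  proof -
    have "t\<^sup>2 + (freq k i)\<^sup>2 \<noteq> 0" using t by (simp add: sum_power2_eq_zero_iff)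
    moreover have "u i = (of_real t + \<i> * of_real (freq k i)) / of_real (t\<^sup>2 + (freq k i)\<^sup>2)"
    proof -
      have "of_real (t\<^sup>2 + (freq k i)\<^sup>2) = (complex_of_real t - \<i> * of_real (freq k i)) * (of_real t + \<i> * of_real (freq k i))"
        by (simp add: algebra_simps power2_eq_square)
      moreover have "complex_of_real t + \<i> * of_real (freq k i) \<noteq> 0"
        using t by (auto simp: complex_eq_iff)
      ultimately show ?thesis using nz[of i] by (simp add: u_def)
    qed
    ultimately have "Re (q i * u i) = (t * cos (freq k i * v) + freq k i * sin (freq k i * v)) / (t\<^sup>2 + (freq k i)\<^sup>2)"
      by (simp add: q_def Re_divide_of_real Im_divide_of_real algebra_simps add_divide_distrib del: of_real_add of_real_power)
    then show ?thesis
      unfolding pf_term_def by (simp add: field_simps)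
  qed
  have abel: "(1 - \<omega>) * (\<Sum>i<N. q i * u i) = q 0 * u 0 - q N * u N + (\<Sum>i<N. q (Suc i) * (u (Suc i) - u i))"
  proof (induction N)
    case (Suc N)
    have "(1 - \<omega>) * (\<Sum>i<Suc N. q i * u i) = (1 - \<omega>) * (\<Sum>i<N. q i * u i) + (1 - \<omega>) * (q N * u N)"
      by (simp add: distrib_left)
    also have "\<dots> = q 0 * u 0 - \<omega> * q N * u N + (\<Sum>i<N. q (Suc i) * (u (Suc i) - u i))"
      unfolding Suc by (simp add: algebra_simps)
    also have "\<dots> = q 0 * u 0 - q (Suc N) * u (Suc N) + (\<Sum>i<Suc N. q (Suc i) * (u (Suc i) - u i))"
      unfolding sum.lessThan_Suc q_Suc[of N] by (simp add: algebra_simps)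
    finally show ?case .
  qed simp
  have u_le: "norm (u i) \<le> 2 / (1 + t)" for i
  proof -
    have "1 \<le> 2 * (real i + 1)" by simp
    also have "\<dots> \<le> freq k i" by (rule freq_ge[OF k])
    finally have "1\<^sup>2 \<le> (freq k i)\<^sup>2" by (intro power_mono) auto
    then have "t\<^sup>2 + (freq k i)\<^sup>2 \<ge> t\<^sup>2 + 1" by simp
    also have "t\<^sup>2 + 1 \<ge> ((1 + t) / 2)\<^sup>2"
    proof -
      have "4 * (t\<^sup>2 + 1) = (1 + t)\<^sup>2 + ((t - 1)\<^sup>2 + 2 * t\<^sup>2 + 2)"
        by (simp add: power2_eq_square algebra_simps)
      then have "(1 + t)\<^sup>2 \<le> 4 * (t\<^sup>2 + 1)"
        using zero_le_power2[of "t - 1"] zero_le_power2[of t] by linarith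
      then show ?thesis by (simp add: power_divide)
    qed
    finally have "sqrt (t\<^sup>2 + (freq k i)\<^sup>2) \<ge> (1 + t) / 2"
      by (rule real_le_rsqrt)
    then have "1 / sqrt (t\<^sup>2 + (freq k i)\<^sup>2) \<le> 1 / ((1 + t) / 2)"
      using t by (intro divide_left_mono) (auto simp: add_pos_nonneg)
    then show ?thesis unfolding u_def norm_divide norm_den by simp
  qed
  \<comment> \<open>Consecutive poles are 2 pi apart, so a difference of the fractions is 2 pi i
    times their product, which is square summable and not just of order 1/i.\<close>
  have diff_le: "norm (u (Suc i) - u i) \<le> 2 * pi * (1 / (t\<^sup>2 + (freq k i)\<^sup>2))" for i
  proof -
    have "u (Suc i) - u i = \<i> * of_real (freq k (Suc i) - freq k i) * (u i * u (Suc i))"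
      using nz[of i] nz[of "Suc i"] unfolding u_def by (simp add: field_simps)
    also have "freq k (Suc i) - freq k i = 2 * pi"
      by (simp add: freq_def algebra_simps)
    finally have "norm (u (Suc i) - u i) = 2 * pi * (norm (u i) * norm (u (Suc i)))"
      by (simp add: norm_mult)
    also have "norm (u (Suc i)) \<le> norm (u i)"
    proof -
      have "(freq k i)\<^sup>2 \<le> (freq k (Suc i))\<^sup>2"
        using freq_pos[OF k, of i] by (intro power_mono) (auto simp: freq_def)
      then show ?thesis
        unfolding u_def norm_divide norm_den using t by (intro divide_left_mono) (auto simp: add_pos_nonneg)
    qed
    then have "2 * pi * (norm (u i) * norm (u (Suc i))) \<le> 2 * pi * (norm (u i) * norm (u i))"
      by (intro mult_left_mono) auto
    also have "norm (u i) * norm (u i) = 1 / (t\<^sup>2 + (freq k i)\<^sup>2)"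
      unfolding u_def norm_divide norm_den by (simp add: sum_power2_ge_zero)
    finally show ?thesis .
  qed
  have "norm ((1 - \<omega>) * (\<Sum>i<N. q i * u i)) \<le> norm (u 0) + norm (u N) + (\<Sum>i<N. norm (u (Suc i) - u i))"
  proof -
    have "norm (\<Sum>i<N. q (Suc i) * (u (Suc i) - u i)) \<le> (\<Sum>i<N. norm (u (Suc i) - u i))"
      by (rule order_trans[OF norm_sum]) (simp add: norm_mult norm_q)
    moreover have "norm (q 0 * u 0 - q N * u N) \<le> norm (u 0) + norm (u N)"
      using norm_triangle_ineq4[of "q 0 * u 0" "q N * u N"] by (simp add: norm_mult norm_q)
    ultimately show ?thesis
      unfolding abel by (intro order_trans[OF norm_triangle_ineq]) linarith
  qed
  also have "(\<Sum>i<N. norm (u (Suc i) - u i)) \<le> 2 * pi * (1 / (1 + t))"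
  proof -
    have "(\<Sum>i<N. norm (u (Suc i) - u i)) \<le> 2 * pi * (\<Sum>i<N. 1 / (t\<^sup>2 + (freq k i)\<^sup>2))"
      unfolding sum_distrib_left by (intro sum_mono diff_le)
    also have "\<dots> \<le> 2 * pi * (1 / (1 + t))"
      by (intro mult_left_mono sum_inverse_square_freq_le[OF k t]) auto
    finally show ?thesis .
  qed
  \<comment> \<open>Each boundary term of the Abel summation gives 2/(1+t), the differences give 2
    pi/(1+t).\<close>
  also have "norm (u 0) + norm (u N) + 2 * pi * (1 / (1 + t)) \<le> (4 + 2 * pi) / (1 + t)"
    using u_le[of 0] u_le[of N] by (simp add: add_divide_distrib)
  finally have "norm (\<Sum>i<N. q i * u i) * norm (1 - \<omega>) \<le> (4 + 2 * pi) / (1 + t)"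
    by (simp only: norm_mult mult.commute)
  moreover have "norm (1 - \<omega>) > 0" using \<omega>1 by simp
  ultimately have "norm (\<Sum>i<N. q i * u i) \<le> (4 + 2 * pi) / (1 + t) / norm (1 - \<omega>)"
    by (simp only: pos_le_divide_eq)
  moreover have "norm (\<Sum>i<N. pf_term k v (of_real t) i) \<le> 2 * norm (\<Sum>i<N. q i * u i)"
  proof -
    have "(\<Sum>i<N. pf_term k v (of_real t) i) = of_real (2 * Re (\<Sum>i<N. q i * u i))"
      unfolding term_eq by (simp add: sum_distrib_left)
    then show ?thesis
      using abs_Re_le_cmod[of "\<Sum>i<N. q i * u i"] by (simp add: abs_mult del: of_real_mult)
  qed
  ultimately have "norm (\<Sum>i<N. pf_term k v (of_real t) i) \<le> 2 * ((4 + 2 * pi) / (1 + t) / norm (1 - \<omega>))"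
    by linarith
  then show ?thesis
    unfolding \<omega>_def by (simp add: mult.commute)
qed

text \<open>The decay 1/(1+t) for v < 1 is weakened to 1/t when k = 0, where the pole at 0 forces a
  term 1/t anyway, and to a constant when k = 1, where 1/t need not be integrable near 0 against
  t^(a-1). The last two facts record which part is absent.\<close>

lemma norm_pf_sum_le:
  assumes k: "k \<in> {0, 1}" and v: "v \<in> {0<..1}"
  obtains A B where "\<And>N t. t > 0 \<Longrightarrow> norm (pf_sum k v N (of_real t)) \<le> A / t + B"
    and "k = 1 \<Longrightarrow> A = 0" and "k = 0 \<Longrightarrow> v \<noteq> 1 \<Longrightarrow> B = 0"
proof -
  have k1: "k \<le> 1" using k by auto
  have head: "norm (if k = 0 then 1 / complex_of_real t else 0) = (if k = 0 then 1 / t else 0)" if "t > 0" for t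
    using that by (simp add: norm_divide)
  show ?thesis
  proof (cases "v = 1")
    case True
    show ?thesis
    proof (rule that[of "if k = 0 then 1 else 0" 2])
      fix N and t :: real assume "t > 0"
      then show "norm (pf_sum k v N (of_real t)) \<le> (if k = 0 then 1 else 0) / t + 2"
        unfolding pf_sum_def True
        using norm_sum_pf_term_le_1[OF k1, of t N] head[of t]
        by (intro order_trans[OF norm_triangle_ineq]) auto
    qed (use True in auto)
  next
    case False
    define C where "C = 2 * (4 + 2 * pi) / norm (1 - cis (- (2 * pi * v)))"
    have C0: "C \<ge> 0" by (simp add: C_def)
    have le: "norm (\<Sum>i<N. pf_term k v (of_real t) i) \<le> C / (1 + t)" if "t > 0" for N t
      unfolding C_def by (rule norm_sum_pf_term_le[OF k1 that]) (use v False in auto)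
    show ?thesis
    proof (rule that[of "if k = 0 then 1 + C else 0" "if k = 0 then 0 else C"])
      fix N and t :: real assume t: "t > 0"
      have "C / (1 + t) \<le> C / t"
        using t C0 by (intro divide_left_mono) auto
      moreover have "C / (1 + t) \<le> C"
        using t C0 by (auto intro!: divide_left_mono mult_pos_pos simp: divide_le_eq mult_le_cancel_left1)
      ultimately show "norm (pf_sum k v N (of_real t)) \<le> (if k = 0 then 1 + C else 0) / t + (if k = 0 then 0 else C)"
        unfolding pf_sum_def
        using le[OF t, of N] head[OF t]
        by (intro order_trans[OF norm_triangle_ineq]) (auto simp: add_divide_distrib)
    qed auto
  qed
qed

section \<open>Termwise integration\<close>

text \<open>The argument is complex because values on the positive axis enter the integrals and
  values at \<plusminus>2iy enter f.\<close>

definition Lerch_kernel :: "nat \<Rightarrow> real \<Rightarrow> complex \<Rightarrow> complex"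
  where "Lerch_kernel k v t = exp (of_real (1 - v) * t) / (exp t - (-1) ^ k)"

lemma measurable_Lerch_kernel [measurable]: "(\<lambda>t. Lerch_kernel k v (of_real t)) \<in> borel_measurable borel"
  unfolding Lerch_kernel_def by measurable

text \<open>In the application \<open>a = s - 2 m\<^sub>k\<close>.\<close>

locale reduced_params =
  fixes k :: nat and v :: real and a :: complex
  assumes k: "k \<in> {0, 1}" and v: "v \<in> {0<..1}"
    and a_pos: "0 < Re a" and a_gt: "k = 0 \<Longrightarrow> 1 < Re a"
    and a_less: "k = 1 \<or> v = 1 \<Longrightarrow> Re a < 2" and a_less_3: "Re a < 3"
    and a_ne: "a \<noteq> 1" "a \<noteq> 2"
begin

lemma k_le: "k \<le> 1"
  using k by auto

lemma sin_ne: "sin (of_real pi * a / 2) \<noteq> 0"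
proof
  assume "sin (of_real pi * a / 2) = 0"
  then obtain n :: int where "a = of_int (2 * n)"
    by (rule sin_pi_half_eq_0D)
  moreover from this have "Re a = 2 * real_of_int n" by simp
  then have "0 < n \<and> n < 2" using a_pos a_less_3 by linarith
  then have "n = 1" by linarith
  ultimately show False using a_ne by simp
qed

lemma cos_ne: "cos (of_real pi * a / 2) \<noteq> 0"
proof
  assume "cos (of_real pi * a / 2) = 0"
  then have "sin (of_real pi * (a + 1) / 2) = 0"
    by (simp add: distrib_left add_divide_distrib sin_add)
  then obtain n :: int where n: "a + 1 = of_int (2 * n)"
    by (rule sin_pi_half_eq_0D)
  from arg_cong[OF n, of Re] have "Re a + 1 = 2 * real_of_int n" by simp
  then have "0 < n \<and> n < 2" using a_pos a_less_3 by linarith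
  then have "n = 1" by linarith
  with n a_ne show False by (simp add: eq_diff_eq[symmetric])
qed

text \<open>The integral of the \<open>i\<close>-th partial fraction splits into a multiple of \<open>c\<^sup>a\<^sup>-\<^sup>1\<close>, where
  \<open>c\<close> is the frequency, and a part which is recognised as the \<open>i\<close>-th partial fraction at \<open>\<plusminus>ix\<close>.\<close>

lemma integral_pf_term:
  assumes x: "x > 0" "x \<noteq> freq k i"
  shows "has_bochner_integral lborel (\<lambda>t. pos_powr (a - 1) t * pf_term k v (of_real t) i / of_real (t\<^sup>2 + x\<^sup>2))
     (2 * of_real pi * of_real (freq k i) powr (a - 1) * sin (of_real (freq k i * v) + of_real pi * a / 2)
          / (sin (of_real pi * a) * of_real (x\<^sup>2 - (freq k i)\<^sup>2))
       + of_real pi * of_real x powr (a - 2) *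
          ((pf_term k v (\<i> * of_real x) i - pf_term k v (- \<i> * of_real x) i) / (4 * \<i> * cos (of_real pi * a / 2))
            + (pf_term k v (\<i> * of_real x) i + pf_term k v (- \<i> * of_real x) i) / (4 * sin (of_real pi * a / 2))))"
proof -
  define c where "c = freq k i"
  define C where "C = complex_of_real (cos (c * v))"
  define S where "S = complex_of_real (sin (c * v))"
  define cA where "cA = cos (of_real pi * a / 2)"
  define sA where "sA = sin (of_real pi * a / 2)"
  define c' where "c' = complex_of_real c"
  define x' where "x' = complex_of_real x"
  have c: "c > 0" unfolding c_def by (rule freq_pos[OF k_le])
  have xc: "x \<noteq> c" using x by (simp add: c_def)
  have xc': "x'\<^sup>2 - c'\<^sup>2 \<noteq> 0"
  proof -
    have "x\<^sup>2 - c\<^sup>2 \<noteq> 0" using x c xc by (simp add: power2_eq_iff_nonneg)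
    then have "complex_of_real (x\<^sup>2 - c\<^sup>2) \<noteq> 0" unfolding of_real_eq_0_iff .
    then show ?thesis by (simp add: x'_def c'_def)
  qed
  have nz: "cA \<noteq> 0" "sA \<noteq> 0" "c' \<noteq> 0" "x' \<noteq> 0"
    using cos_ne sin_ne c x by (simp_all add: cA_def sA_def c'_def x'_def)
  \<comment> \<open>The cosine part of the numerator carries a factor t and raises the Mellin
    parameter to a+1; the sine part keeps a. The exceptional parameter 2 is avoided by a \<noteq> 1
    and a \<noteq> 2 respectively.\<close>
  have "has_bochner_integral lborel
      (\<lambda>t. 2 * C * (pos_powr (a + 1 - 1) t / of_real ((t\<^sup>2 + x\<^sup>2) * (t\<^sup>2 + c\<^sup>2)))
         + 2 * (c' * S) * (pos_powr (a - 1) t / of_real ((t\<^sup>2 + x\<^sup>2) * (t\<^sup>2 + c\<^sup>2))))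
      (2 * C * (of_real pi / 2 / sin (of_real pi * (a + 1) / 2) * (c' powr (a + 1 - 2) - x' powr (a + 1 - 2)) / of_real (x\<^sup>2 - c\<^sup>2))
       + 2 * (c' * S) * (of_real pi / 2 / sA * (c' powr (a - 2) - x' powr (a - 2)) / of_real (x\<^sup>2 - c\<^sup>2)))"
    unfolding c'_def x'_def sA_def using a_pos a_less_3 a_ne x xc c
    by (intro has_bochner_integral_add has_bochner_integral_mult_right has_bochner_integral_Mellin_square_square)
       (auto simp: eq_diff_eq[symmetric])
  moreover have "2 * C * (pos_powr (a + 1 - 1) t / of_real ((t\<^sup>2 + x\<^sup>2) * (t\<^sup>2 + c\<^sup>2)))
         + 2 * (c' * S) * (pos_powr (a - 1) t / of_real ((t\<^sup>2 + x\<^sup>2) * (t\<^sup>2 + c\<^sup>2)))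
      = pos_powr (a - 1) t * pf_term k v (of_real t) i / of_real (t\<^sup>2 + x\<^sup>2)" for t
  proof (cases "t > 0")
    case True
    have "pos_powr (a + 1 - 1) t = pos_powr (a - 1) t * of_real t"
      using pos_powr_add_nat[OF True, of "a - 1" 1] by simp
    moreover have "2 * C * (p * t' / (X * D)) + 2 * (c' * S) * (p / (X * D)) = p * ((2 * t' * C + 2 * (c' * S)) / D) / X" for p t' X D
      by (cases "X = 0 \<or> D = 0") (auto simp: field_simps)
    ultimately show ?thesis
      unfolding pf_term_def C_def S_def c'_def c_def by simp
  qed (simp add: pos_powr_def)
  moreover have "2 * C * (of_real pi / 2 / sin (of_real pi * (a + 1) / 2) * (c' powr (a + 1 - 2) - x' powr (a + 1 - 2)) / of_real (x\<^sup>2 - c\<^sup>2))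
       + 2 * (c' * S) * (of_real pi / 2 / sA * (c' powr (a - 2) - x' powr (a - 2)) / of_real (x\<^sup>2 - c\<^sup>2))
     = 2 * of_real pi * c' powr (a - 1) * sin (of_real (c * v) + of_real pi * a / 2) / (sin (of_real pi * a) * of_real (x\<^sup>2 - c\<^sup>2))
       + of_real pi * x' powr (a - 2) *
          ((pf_term k v (\<i> * of_real x) i - pf_term k v (- \<i> * of_real x) i) / (4 * \<i> * cA)
            + (pf_term k v (\<i> * of_real x) i + pf_term k v (- \<i> * of_real x) i) / (4 * sA))"
  proof -
    have s1: "sin (of_real pi * (a + 1) / 2) = cA"
      by (simp add: distrib_left add_divide_distrib sin_add cA_def)
    have s2: "sin (of_real (c * v) + of_real pi * a / 2) = S * cA + C * sA"
      by (simp only: sin_add sin_of_real cos_of_real S_def C_def cA_def sA_def)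
    have s3: "sin (of_real pi * a) = 2 * sA * cA"
      using sin_double[of "of_real pi * a / 2"] by (simp add: sA_def cA_def)
    have p: "z powr (a + 1 - 2) = z * z powr (a - 2)" "z powr (a - 1) = z * z powr (a - 2)" if "z \<noteq> 0" for z
      using that powr_add[of z 1 "a - 2"] by (simp_all add: algebra_simps)
    \<comment> \<open>At \<plusminus>ix the denominator is c^2-x^2 in both cases. The difference of
      the two values isolates the cosine part, their sum the sine part, matching the factors 1/cos
      and 1/sin of the two Mellin integrals.\<close>
    have t1: "pf_term k v (\<i> * of_real x) i = (2 * \<i> * x' * C + 2 * (c' * S)) / (c'\<^sup>2 - x'\<^sup>2)"
      unfolding pf_term_def c_def[symmetric] by (simp add: C_def S_def c'_def x'_def power_mult_distrib algebra_simps)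
    have t2: "pf_term k v (- \<i> * of_real x) i = (- 2 * \<i> * x' * C + 2 * (c' * S)) / (c'\<^sup>2 - x'\<^sup>2)"
      unfolding pf_term_def c_def[symmetric] by (simp add: C_def S_def c'_def x'_def power_mult_distrib algebra_simps)
    have D: "c'\<^sup>2 - x'\<^sup>2 = - (x'\<^sup>2 - c'\<^sup>2)" by simp
    have d1: "pf_term k v (\<i> * of_real x) i - pf_term k v (- \<i> * of_real x) i = - (4 * \<i> * (x' * C)) / (x'\<^sup>2 - c'\<^sup>2)"
      unfolding t1 t2 diff_divide_distrib[symmetric] D divide_minus_right minus_divide_left
      by (rule arg_cong2[where f = divide, OF _ refl]) (simp add: algebra_simps)
    have d2: "pf_term k v (\<i> * of_real x) i + pf_term k v (- \<i> * of_real x) i = - (4 * (c' * S)) / (x'\<^sup>2 - c'\<^sup>2)"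
      unfolding t1 t2 add_divide_distrib[symmetric] D divide_minus_right minus_divide_left
      by (rule arg_cong2[where f = divide, OF _ refl]) (simp add: algebra_simps)
    have alg: "2 * C * (P / 2 / u * (c' * cp - x' * xp) / D) + 2 * (c' * S) * (P / 2 / w * (cp - xp) / D)
      = 2 * P * (c' * cp) * (S * u + C * w) / (2 * w * u * D)
        + P * xp * (- (4 * \<i> * (x' * C)) / D / (4 * \<i> * u) + - (4 * (c' * S)) / D / (4 * w))"
      if "u \<noteq> 0" "w \<noteq> 0" for P u w D cp xp
    proof -
      have "2 * P * (c' * cp) * (S * u + C * w) / (2 * w * u * D) = P / D * (c' * cp) * ((S * u + C * w) / (w * u))"
      proof -
        have "2 * P * (c' * cp) * E / (2 * w * u * D) = P / D * (c' * cp) * (E / (w * u))" for E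
          by (simp add: mult_ac)
        then show ?thesis .
      qed
      also have "(S * u + C * w) / (w * u) = S / w + C / u"
        using that by (simp add: add_divide_distrib)
      finally have e1: "2 * P * (c' * cp) * (S * u + C * w) / (2 * w * u * D) = P / D * (c' * cp) * (S / w + C / u)" .
      have e2: "- (4 * \<i> * (x' * C)) / D / (4 * \<i> * u) + - (4 * (c' * S)) / D / (4 * w) = - (1 / D) * (x' * (C / u) + c' * (S / w))"
        by (simp add: add_divide_distrib distrib_left)
      have e3: "2 * C * (P / 2 / u * (c' * cp - x' * xp) / D) = P / D * (C / u) * (c' * cp - x' * xp)"
        "2 * (c' * S) * (P / 2 / w * (cp - xp) / D) = P / D * c' * (S / w) * (cp - xp)"
      proof -
        have g: "2 * X * (P / 2 / y * E / D) = P / D * (X / y) * E" for X y E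
          by (simp add: mult_ac)
        show "2 * C * (P / 2 / u * (c' * cp - x' * xp) / D) = P / D * (C / u) * (c' * cp - x' * xp)"
          by (rule g)
        show "2 * (c' * S) * (P / 2 / w * (cp - xp) / D) = P / D * c' * (S / w) * (cp - xp)"
          unfolding g by simp
      qed
      show ?thesis
        unfolding e1 e2 e3 by (simp only: divide_inverse) (simp add: algebra_simps)
    qed
    have xcD: "complex_of_real (x\<^sup>2 - c\<^sup>2) = x'\<^sup>2 - c'\<^sup>2"
      by (simp add: x'_def c'_def)
    show ?thesis
      unfolding s1 s2 s3 p(1)[OF nz(3)] p(1)[OF nz(4)] p(2)[OF nz(3)] d1 d2 xcD
      by (rule alg[OF nz(1,2)])
  qed
  ultimately show ?thesis
    unfolding c_def c'_def x'_def cA_def sA_def by simp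
qed

lemma integrable_div_square:
  assumes "0 < Re z" "Re z < 2" "x > 0"
  shows "integrable lborel (\<lambda>t. pos_powr (z - 1) t / of_real (t\<^sup>2 + x\<^sup>2))"
  using has_bochner_integral_Mellin_square[OF assms] has_bochner_integral_iff by blast

lemma exp_of_real_ne: "t > 0 \<Longrightarrow> exp (complex_of_real t) \<noteq> 1" "exp (complex_of_real t) \<noteq> -1"
proof -
  show "exp (complex_of_real t) \<noteq> 1" if "t > 0"
    using that by (simp add: exp_of_real)
  show "exp (complex_of_real t) \<noteq> -1"
  proof
    assume "exp (complex_of_real t) = -1"
    then have "exp t = -1" by (metis Re_exp Re_complex_of_real Im_complex_of_real cos_zero mult.right_neutral one_complex.sel(1) uminus_complex.sel(1))
    then show False by (smt (verit) exp_gt_zero)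
  qed
qed

text \<open>The integral of the N-th partial sum is the N-th partial sum of the series plus a
  multiple of \<open>H N\<close>, a combination of the partial fractions at \<plusminus>ix. The
  integrals converge by domination and \<open>H N\<close> by the partial fraction expansion, so the
  series converges, without any absolute convergence.\<close>

lemma Lerch_series_sums:
  assumes x: "x > 0" "sin x \<noteq> 0"
  shows "(\<lambda>i. 2 * of_real pi * of_real (freq k i) powr (a - 1) * sin (of_real (freq k i * v) + of_real pi * a / 2)
          / (sin (of_real pi * a) * of_real (x\<^sup>2 - (freq k i)\<^sup>2)))
     sums ((LINT t|lborel. pos_powr (a - 1) t * Lerch_kernel k v (of_real t) / of_real (t\<^sup>2 + x\<^sup>2))
       - of_real pi * of_real x powr (a - 2) / 4 *
          ((Lerch_kernel k v (\<i> * of_real x) - Lerch_kernel k v (- \<i> * of_real x)) / (\<i> * cos (of_real pi * a / 2))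
            + (Lerch_kernel k v (\<i> * of_real x) + Lerch_kernel k v (- \<i> * of_real x)) / sin (of_real pi * a / 2)))"
proof -
  define cA where "cA = cos (of_real pi * a / 2)"
  define sA where "sA = sin (of_real pi * a / 2)"
  define x' where "x' = complex_of_real x"
  define J where "J = complex_of_real (pf_jump k v)"
  define S where "S i = 2 * of_real pi * of_real (freq k i) powr (a - 1) * sin (of_real (freq k i * v) + of_real pi * a / 2)
          / (sin (of_real pi * a) * of_real (x\<^sup>2 - (freq k i)\<^sup>2))" for i
  have nz: "cA \<noteq> 0" "sA \<noteq> 0" "x' \<noteq> 0"
    using cos_ne sin_ne x by (simp_all add: cA_def sA_def x'_def)
  \<comment> \<open>Since sin x \<noteq> 0, x is no frequency and e^(ix), e^(-ix) differ from
    \<plusminus>1, as the expansions at \<plusminus>ix require.\<close>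
  have xfreq: "x \<noteq> freq k i" for i
  proof
    assume "x = freq k i"
    then have "sin x = Im ((-1) ^ k)" using cis_freq[OF k_le, of i] by (metis cis.sel(2))
    also have "\<dots> = 0" using k by auto
    finally show False using x by simp
  qed
  have exp_ix: "exp (\<i> * x') \<noteq> 1" "exp (\<i> * x') \<noteq> -1" "exp (- \<i> * x') \<noteq> 1" "exp (- \<i> * x') \<noteq> -1"
  proof -
    have "exp (\<i> * x') = cis x" "exp (- \<i> * x') = cis (- x)"
      by (simp_all add: x'_def cis_conv_exp)
    then show "exp (\<i> * x') \<noteq> 1" "exp (\<i> * x') \<noteq> -1" "exp (- \<i> * x') \<noteq> 1" "exp (- \<i> * x') \<noteq> -1"
      using x(2) by (auto simp: complex_eq_iff)
  qed
  define H where "H N = (pf_sum k v N (\<i> * x') - pf_sum k v N (- \<i> * x')) / (\<i> * cA)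
      + (pf_sum k v N (\<i> * x') + pf_sum k v N (- \<i> * x')) / sA" for N
  define f where "f N t = pos_powr (a - 1) t * pf_sum k v N (of_real t) / of_real (t\<^sup>2 + x\<^sup>2)" for N t
  define F where "F t = pos_powr (a - 1) t * (Lerch_kernel k v (of_real t) + J) / of_real (t\<^sup>2 + x\<^sup>2)" for t
  have meas[measurable]: "f N \<in> borel_measurable borel" "F \<in> borel_measurable borel" for N
    unfolding f_def F_def pf_sum_def pf_term_def by measurable
  have int_f: "has_bochner_integral lborel (f N) ((\<Sum>i<N. S i) + of_real pi * x' powr (a - 2) / 4 * H N)" for N
  proof -
    \<comment> \<open>The pole at 0, present only for k = 0. Its integral has parameter a-1, whence
      Re a > 1. It adds no term to the series and is absorbed by \<open>H N\<close>.\<close>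
    define \<delta> where "\<delta> = (if k = 0 then 1 else 0 :: complex)"
    have d: "has_bochner_integral lborel (\<lambda>t. \<delta> * (pos_powr (a - 1 - 1) t / of_real (t\<^sup>2 + x\<^sup>2)))
       (\<delta> * (of_real pi / 2 * x' powr (a - 1 - 2) / sin (of_real pi * (a - 1) / 2)))"
    proof (cases "k = 0")
      case True
      then show ?thesis unfolding x'_def
        using a_gt a_less_3 x
        by (intro has_bochner_integral_mult_right has_bochner_integral_Mellin_square) auto
    qed (simp add: \<delta>_def has_bochner_integral_zero)
    define R where "R i = (pf_term k v (\<i> * of_real x) i - pf_term k v (- \<i> * of_real x) i) / (4 * \<i> * cA)
            + (pf_term k v (\<i> * of_real x) i + pf_term k v (- \<i> * of_real x) i) / (4 * sA)" for i
    have "has_bochner_integral lborel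
      (\<lambda>t. \<delta> * (pos_powr (a - 1 - 1) t / of_real (t\<^sup>2 + x\<^sup>2)) + (\<Sum>i<N. pos_powr (a - 1) t * pf_term k v (of_real t) i / of_real (t\<^sup>2 + x\<^sup>2)))
      (\<delta> * (of_real pi / 2 * x' powr (a - 1 - 2) / sin (of_real pi * (a - 1) / 2)) + (\<Sum>i<N. S i + of_real pi * x' powr (a - 2) * R i))"
      unfolding S_def R_def x'_def cA_def sA_def
      by (intro has_bochner_integral_add d[unfolded x'_def] has_bochner_integral_sum integral_pf_term x(1) xfreq)
    moreover have "\<delta> * (pos_powr (a - 1 - 1) t / of_real (t\<^sup>2 + x\<^sup>2)) + (\<Sum>i<N. pos_powr (a - 1) t * pf_term k v (of_real t) i / of_real (t\<^sup>2 + x\<^sup>2)) = f N t" for t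
    proof (cases "t > 0")
      case True
      have "pos_powr (a - 1) t = pos_powr (a - 1 - 1) t * of_real t"
        using pos_powr_add_nat[OF True, of "a - 1 - 1" 1] by simp
      then have "pos_powr (a - 1 - 1) t = pos_powr (a - 1) t * (1 / of_real t)"
        using True by simp
      then show ?thesis
        unfolding f_def pf_sum_def \<delta>_def
        by (auto simp: distrib_left add_divide_distrib sum_distrib_left sum_divide_distrib)
    qed (simp add: f_def pos_powr_def)
    moreover have "\<delta> * (of_real pi / 2 * x' powr (a - 1 - 2) / sin (of_real pi * (a - 1) / 2)) + (\<Sum>i<N. S i + of_real pi * x' powr (a - 2) * R i)
       = (\<Sum>i<N. S i) + of_real pi * x' powr (a - 2) / 4 * H N"
    proof -
      have s1: "sin (of_real pi * (a - 1) / 2) = - cA"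
        by (simp add: right_diff_distrib diff_divide_distrib sin_diff cA_def)
      have p: "x' powr (a - 2) = x' * x' powr (a - 1 - 2)"
        using nz(3) powr_add[of x' 1 "a - 1 - 2"] by simp
      define T1 where "T1 = (\<Sum>i<N. pf_term k v (\<i> * of_real x) i)"
      define T2 where "T2 = (\<Sum>i<N. pf_term k v (- \<i> * of_real x) i)"
      have pf: "pf_sum k v N (\<i> * x') = \<delta> / (\<i> * x') + T1" "pf_sum k v N (- \<i> * x') = - (\<delta> / (\<i> * x')) + T2"
        by (simp_all add: pf_sum_def \<delta>_def T1_def T2_def x'_def)
      have R: "(\<Sum>i<N. R i) = (T1 - T2) / (4 * \<i> * cA) + (T1 + T2) / (4 * sA)"
        unfolding R_def T1_def T2_def
        by (simp add: sum.distrib sum_subtractf sum_divide_distrib add_divide_distrib diff_divide_distrib)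
      have H: "H N = 4 * (\<Sum>i<N. R i) - 2 * \<delta> / (x' * cA)"
      proof -
        have "\<i> * x' * (\<i> * cA) = - (x' * cA)"
          by (simp add: mult_ac)
        then have "\<delta> / (\<i> * x') / (\<i> * cA) = - (\<delta> / (x' * cA))"
          by (simp only: divide_divide_eq_left divide_minus_right)
        then show ?thesis
          unfolding H_def pf R by (simp only: add_divide_distrib diff_divide_distrib minus_divide_left[symmetric]) simp
      qed
      have "\<delta> * (of_real pi / 2 * x' powr (a - 1 - 2) / sin (of_real pi * (a - 1) / 2)) = - (of_real pi * x' powr (a - 2) / 4 * (2 * \<delta> / (x' * cA)))"
        unfolding s1 p using nz by simp
      then show ?thesis
        unfolding H by (simp add: sum.distrib sum_distrib_left right_diff_distrib mult.assoc)
    qed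
    ultimately show ?thesis by simp
  qed
  obtain A B where AB: "\<And>N t. t > 0 \<Longrightarrow> norm (pf_sum k v N (of_real t)) \<le> A / t + B"
    and A0: "k = 1 \<Longrightarrow> A = 0" and B0: "k = 0 \<Longrightarrow> v \<noteq> 1 \<Longrightarrow> B = 0"
    by (rule norm_pf_sum_le[OF k v]) blast
  define W where "W t = A * norm (pos_powr (a - 1 - 1) t / of_real (t\<^sup>2 + x\<^sup>2)) + B * norm (pos_powr (a - 1) t / of_real (t\<^sup>2 + x\<^sup>2))" for t
  have W_int: "integrable lborel W"
  proof -
    have "integrable lborel (\<lambda>t. A * norm (pos_powr (a - 1 - 1) t / of_real (t\<^sup>2 + x\<^sup>2)))"
    proof (cases "k = 0")
      case True
      then show ?thesis using a_gt a_less_3 x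
        by (intro integrable_mult_right integrable_norm integrable_div_square) auto
    next
      case False
      then show ?thesis using A0 k by simp
    qed
    moreover have "integrable lborel (\<lambda>t. B * norm (pos_powr (a - 1) t / of_real (t\<^sup>2 + x\<^sup>2)))"
    proof (cases "k = 1 \<or> v = 1")
      case True
      then show ?thesis using a_pos a_less x
        by (intro integrable_mult_right integrable_norm integrable_div_square) auto
    next
      case False
      then show ?thesis using B0 k by simp
    qed
    ultimately show ?thesis unfolding W_def by (rule Bochner_Integration.integrable_add)
  qed
  have lim: "(\<lambda>N. f N t) \<longlonglongrightarrow> F t" for t
  proof (cases "t > 0")
    case True
    have "(\<lambda>N. pf_sum k v N (of_real t)) \<longlonglongrightarrow> Lerch_kernel k v (of_real t) + J"
      unfolding Lerch_kernel_def J_def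
      by (rule partial_fractions[OF k _ _ v]) (use exp_of_real_ne True in auto)
    then show ?thesis
      unfolding f_def F_def divide_inverse by (intro tendsto_mult tendsto_const)
  qed (simp add: f_def F_def pos_powr_def)
  have bound: "norm (f N t) \<le> W t" for N t
  proof (cases "t > 0")
    case True
    have e: "norm (pos_powr (a - 1 - 1) t) = norm (pos_powr (a - 1) t) / t"
      using pos_powr_add_nat[OF True, of "a - 1 - 1" 1] True by (simp add: norm_mult)
    have "norm (f N t) \<le> norm (pos_powr (a - 1) t) * (A / t + B) / norm (complex_of_real (t\<^sup>2 + x\<^sup>2))"
      unfolding f_def norm_divide norm_mult by (intro divide_right_mono mult_left_mono AB True) auto
    also have "\<dots> = W t"
      unfolding W_def norm_divide e by (simp add: distrib_left distrib_right add_divide_distrib mult_ac)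
    finally show ?thesis .
  qed (simp add: f_def W_def pos_powr_def)
  have dct: "integrable lborel F" "(\<lambda>N. integral\<^sup>L lborel (f N)) \<longlonglongrightarrow> integral\<^sup>L lborel F"
    using integrable_dominated_convergence[of F lborel f W] integral_dominated_convergence[of F lborel f W] W_int lim bound
    by auto
  have H_lim: "H \<longlonglongrightarrow> ((Lerch_kernel k v (\<i> * x') + J) - (Lerch_kernel k v (- \<i> * x') + J)) / (\<i> * cA)
      + ((Lerch_kernel k v (\<i> * x') + J) + (Lerch_kernel k v (- \<i> * x') + J)) / sA"
  proof -
    have *: "(\<lambda>N. pf_sum k v N (\<i> * x')) \<longlonglongrightarrow> Lerch_kernel k v (\<i> * x') + J"
      unfolding Lerch_kernel_def J_def by (rule partial_fractions[OF k exp_ix(1,2) v])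
    have **: "(\<lambda>N. pf_sum k v N (- \<i> * x')) \<longlonglongrightarrow> Lerch_kernel k v (- \<i> * x') + J"
      unfolding Lerch_kernel_def J_def by (rule partial_fractions[OF k exp_ix(3,4) v])
    show ?thesis
      unfolding H_def using nz
      by (intro tendsto_add tendsto_diff tendsto_divide tendsto_const * **) auto
  qed
  \<comment> \<open>If J is nonzero then v = 1, so Re a < 2 and the constant can be integrated
    separately. Its integral is exactly what J contributes to the limit of \<open>H\<close>, hence J
    drops out of the final formula.\<close>
  have F_int: "integral\<^sup>L lborel F = (LINT t|lborel. pos_powr (a - 1) t * Lerch_kernel k v (of_real t) / of_real (t\<^sup>2 + x\<^sup>2))
      + J * (of_real pi / 2 * x' powr (a - 2) / sA)"
  proof (cases "J = 0")
    case True
    then show ?thesis by (simp add: F_def[abs_def])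
  next
    case False
    then have "v = 1" by (auto simp: J_def pf_jump_def split: if_splits)
    then have j: "has_bochner_integral lborel (\<lambda>t. J * (pos_powr (a - 1) t / of_real (t\<^sup>2 + x\<^sup>2))) (J * (of_real pi / 2 * x' powr (a - 2) / sA))"
      unfolding sA_def x'_def using a_pos a_less x
      by (intro has_bochner_integral_mult_right has_bochner_integral_Mellin_square) auto
    have "(\<lambda>t. pos_powr (a - 1) t * Lerch_kernel k v (of_real t) / of_real (t\<^sup>2 + x\<^sup>2))
        = (\<lambda>t. F t - J * (pos_powr (a - 1) t / of_real (t\<^sup>2 + x\<^sup>2)))"
      by (auto simp: F_def fun_eq_iff distrib_left add_divide_distrib mult_ac)
    then show ?thesis
      using j dct(1) by (simp add: has_bochner_integral_iff)
  qed
  have "(\<lambda>N. integral\<^sup>L lborel (f N) - of_real pi * x' powr (a - 2) / 4 * H N) \<longlonglongrightarrow>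
     integral\<^sup>L lborel F - of_real pi * x' powr (a - 2) / 4 *
     (((Lerch_kernel k v (\<i> * x') + J) - (Lerch_kernel k v (- \<i> * x') + J)) / (\<i> * cA)
      + ((Lerch_kernel k v (\<i> * x') + J) + (Lerch_kernel k v (- \<i> * x') + J)) / sA)"
    by (intro tendsto_diff dct(2) tendsto_mult tendsto_const H_lim)
  moreover have "integral\<^sup>L lborel (f N) - of_real pi * x' powr (a - 2) / 4 * H N = (\<Sum>i<N. S i)" for N
    using has_bochner_integral_integral_eq[OF int_f[of N]] by simp
  moreover have "integral\<^sup>L lborel F - of_real pi * x' powr (a - 2) / 4 *
     (((Lerch_kernel k v (\<i> * x') + J) - (Lerch_kernel k v (- \<i> * x') + J)) / (\<i> * cA)
      + ((Lerch_kernel k v (\<i> * x') + J) + (Lerch_kernel k v (- \<i> * x') + J)) / sA)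
   = (LINT t|lborel. pos_powr (a - 1) t * Lerch_kernel k v (of_real t) / of_real (t\<^sup>2 + x\<^sup>2))
       - of_real pi * x' powr (a - 2) / 4 *
          ((Lerch_kernel k v (\<i> * x') - Lerch_kernel k v (- \<i> * x')) / (\<i> * cA)
            + (Lerch_kernel k v (\<i> * x') + Lerch_kernel k v (- \<i> * x')) / sA)"
    unfolding F_int by (simp add: algebra_simps add_divide_distrib)
  ultimately show ?thesis
    unfolding sums_def S_def x'_def cA_def sA_def by simp
qed

end

section \<open>The transform of the kernel and its moments\<close>

definition Lerch_moment :: "nat \<Rightarrow> real \<Rightarrow> complex \<Rightarrow> complex"
  where "Lerch_moment k v z = (LINT t|lborel. pos_powr (z - 1) t * Lerch_kernel k v (of_real t))"

text \<open>At x = 2y and z = s this is the function G of the overview. The factor x^2/(t^2+x^2)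
  lies between 0 and 1 and tends to 1 as x grows, so the moment is the limit at infinity.\<close>

definition Lerch_transform :: "nat \<Rightarrow> real \<Rightarrow> complex \<Rightarrow> real \<Rightarrow> complex"
  where "Lerch_transform k v z x =
    of_real (x\<^sup>2) * (LINT t|lborel. pos_powr (z - 1) t * Lerch_kernel k v (of_real t) / of_real (t\<^sup>2 + x\<^sup>2))"

lemma norm_Lerch_kernel_le:
  assumes k: "k \<in> {0, 1}" and t: "t > 0"
  shows "norm (Lerch_kernel k v (of_real t)) \<le> exp (- (v * t)) * (1 + (if k = 0 then 1 / t else 0))"
proof -
  have e: "exp t \<ge> 1 + t" by (rule exp_ge_add_one_self)
  have v: "exp ((1 - v) * t) = exp (- (v * t)) * exp t"
    by (simp add: algebra_simps flip: exp_add)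
  have "Lerch_kernel k v (of_real t) = of_real (exp ((1 - v) * t) / (exp t - (-1) ^ k))"
    unfolding Lerch_kernel_def by (simp add: exp_of_real[symmetric])
  then have "norm (Lerch_kernel k v (of_real t)) = exp (- (v * t)) * (exp t / \<bar>exp t - (-1) ^ k\<bar>)"
    by (simp only: norm_of_real abs_divide v) (simp add: abs_mult)
  also have "exp t / \<bar>exp t - (-1) ^ k\<bar> \<le> 1 + (if k = 0 then 1 / t else 0)"
  proof (cases "k = 0")
    case True
    have "exp t / (exp t - 1) = 1 + 1 / (exp t - 1)"
      using t by (simp add: field_simps)
    also have "1 / (exp t - 1) \<le> 1 / t"
    proof -
      have "t \<le> exp t - 1" using e by linarith
      then show ?thesis using t by (intro divide_left_mono) auto
    qed
    finally show ?thesis using True t by simp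
  next
    case False
    then have "k = 1" using k by simp
    then show ?thesis by (simp add: abs_of_pos add_pos_pos)
  qed
  finally show ?thesis by simp
qed

lemma integrable_Lerch_moment:
  assumes k: "k \<in> {0, 1}" and v: "v > 0" and z: "Re z > (if k = 0 then 1 else 0)"
  shows "integrable lborel (\<lambda>t. pos_powr (z - 1) t * Lerch_kernel k v (of_real t))"
proof (rule Bochner_Integration.integrable_bound)
  have gam: "integrable lborel (\<lambda>t. norm (pos_powr (w - 1) t * of_real (exp (- (v * t)))))" if "Re w > 0" for w
    using has_bochner_integral_Gamma[OF that v] by (intro integrable_norm) (simp add: has_bochner_integral_iff)
  define \<delta> :: real where "\<delta> = (if k = 0 then 1 else 0)"
  have "integrable lborel (\<lambda>t. \<delta> * norm (pos_powr (z - 1 - 1) t * of_real (exp (- (v * t)))))"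
    using gam[of "z - 1"] z by (cases "k = 0") (auto simp: \<delta>_def)
  moreover have "Re z > 0" using z by (auto split: if_splits)
  ultimately show "integrable lborel (\<lambda>t. norm (pos_powr (z - 1) t * of_real (exp (- (v * t))))
      + \<delta> * norm (pos_powr (z - 1 - 1) t * of_real (exp (- (v * t)))))"
    using gam by (intro Bochner_Integration.integrable_add) auto
  show "AE t in lborel. norm (pos_powr (z - 1) t * Lerch_kernel k v (of_real t))
     \<le> norm (norm (pos_powr (z - 1) t * of_real (exp (- (v * t))))
      + \<delta> * norm (pos_powr (z - 1 - 1) t * of_real (exp (- (v * t)))))"
  proof (rule always_eventually, rule allI)
    fix t :: real
    show "norm (pos_powr (z - 1) t * Lerch_kernel k v (of_real t))
     \<le> norm (norm (pos_powr (z - 1) t * of_real (exp (- (v * t))))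
      + \<delta> * norm (pos_powr (z - 1 - 1) t * of_real (exp (- (v * t)))))"
    proof (cases "t > 0")
      case True
      have e: "norm (pos_powr (z - 1) t) = norm (pos_powr (z - 1 - 1) t) * t"
        using pos_powr_add_nat[OF True, of "z - 1 - 1" 1] True by (simp add: norm_mult)
      have "norm (pos_powr (z - 1) t * Lerch_kernel k v (of_real t))
          \<le> norm (pos_powr (z - 1) t) * (exp (- (v * t)) * (1 + \<delta> / t))"
        unfolding norm_mult using norm_Lerch_kernel_le[OF k True, of v] by (intro mult_left_mono) (auto simp: \<delta>_def)
      also have "\<dots> = norm (pos_powr (z - 1) t) * exp (- (v * t)) + \<delta> * (norm (pos_powr (z - 1 - 1) t) * exp (- (v * t)))"
        unfolding e using True by (simp add: field_simps)
      also have "\<dots> = norm (norm (pos_powr (z - 1) t * of_real (exp (- (v * t))))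
        + \<delta> * norm (pos_powr (z - 1 - 1) t * complex_of_real (exp (- (v * t)))))"
        by (simp add: norm_mult \<delta>_def)
      finally show ?thesis .
    qed (simp add: pos_powr_def)
  qed
qed measurable

lemma square_div_le_1: "x\<^sup>2 / (t\<^sup>2 + x\<^sup>2) \<le> (1::real)"
  by (simp add: divide_le_eq_1 sum_power2_gt_zero_iff not_less)

lemma
  assumes k: "k \<in> {0, 1}" and v: "v > 0" and z: "Re z > (if k = 0 then 1 else 0)"
  shows integrable_Lerch_transform:
      "integrable lborel (\<lambda>t. of_real (x\<^sup>2) * (pos_powr (z - 1) t * Lerch_kernel k v (of_real t) / of_real (t\<^sup>2 + x\<^sup>2)))"
    and norm_Lerch_transform_le: "norm (Lerch_transform k v z x)
       \<le> (LINT t|lborel. norm (pos_powr (z - 1) t * Lerch_kernel k v (of_real t)))"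
proof -
  have le: "norm (of_real (x\<^sup>2) * (pos_powr (z - 1) t * Lerch_kernel k v (of_real t) / of_real (t\<^sup>2 + x\<^sup>2)))
      \<le> norm (pos_powr (z - 1) t * Lerch_kernel k v (of_real t))" for t
  proof -
    have "norm (of_real (x\<^sup>2) * (pos_powr (z - 1) t * Lerch_kernel k v (of_real t) / of_real (t\<^sup>2 + x\<^sup>2)))
       = x\<^sup>2 / (t\<^sup>2 + x\<^sup>2) * norm (pos_powr (z - 1) t * Lerch_kernel k v (of_real t))"
      unfolding norm_mult norm_divide norm_of_real by simp
    also have "\<dots> \<le> 1 * norm (pos_powr (z - 1) t * Lerch_kernel k v (of_real t))"
      by (intro mult_right_mono square_div_le_1) auto
    finally show ?thesis by simp
  qed
  show int: "integrable lborel (\<lambda>t. of_real (x\<^sup>2) * (pos_powr (z - 1) t * Lerch_kernel k v (of_real t) / of_real (t\<^sup>2 + x\<^sup>2)))"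
    by (rule Bochner_Integration.integrable_bound[OF integrable_Lerch_moment[OF k v z]])
       (use le in \<open>auto simp del: of_real_add of_real_power\<close>)
  have "Lerch_transform k v z x = (LINT t|lborel. of_real (x\<^sup>2) * (pos_powr (z - 1) t * Lerch_kernel k v (of_real t) / of_real (t\<^sup>2 + x\<^sup>2)))"
    unfolding Lerch_transform_def by (rule integral_mult_right_zero[symmetric])
  also have "norm \<dots> \<le> (LINT t|lborel. norm (of_real (x\<^sup>2) * (pos_powr (z - 1) t * Lerch_kernel k v (of_real t) / of_real (t\<^sup>2 + x\<^sup>2))))"
    by (rule integral_norm_bound)
  also have "\<dots> \<le> (LINT t|lborel. norm (pos_powr (z - 1) t * Lerch_kernel k v (of_real t)))"
    by (intro integral_mono integrable_norm int integrable_Lerch_moment[OF k v z] le)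
  finally show "norm (Lerch_transform k v z x) \<le> (LINT t|lborel. norm (pos_powr (z - 1) t * Lerch_kernel k v (of_real t)))" .
qed

text \<open>This is t^2/(t^2+x^2) = 1 - x^2/(t^2+x^2). Iterated it yields the finite sum of g;
  applied once, from s to s+2, it gives the error O(x^(-2)).\<close>

lemma Lerch_transform_add_2:
  assumes k: "k \<in> {0, 1}" and v: "v > 0" and z: "Re z > (if k = 0 then 1 else 0)" and x: "x \<noteq> 0"
  shows "Lerch_transform k v (z + 2) x = of_real (x\<^sup>2) * (Lerch_moment k v z - Lerch_transform k v z x)"
proof -
  have "(LINT t|lborel. pos_powr (z + 2 - 1) t * Lerch_kernel k v (of_real t) / of_real (t\<^sup>2 + x\<^sup>2))
    = (LINT t|lborel. pos_powr (z - 1) t * Lerch_kernel k v (of_real t)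
        - of_real (x\<^sup>2) * (pos_powr (z - 1) t * Lerch_kernel k v (of_real t) / of_real (t\<^sup>2 + x\<^sup>2)))"
  proof (intro Bochner_Integration.integral_cong refl)
    fix t :: real
    show "pos_powr (z + 2 - 1) t * Lerch_kernel k v (of_real t) / of_real (t\<^sup>2 + x\<^sup>2)
      = pos_powr (z - 1) t * Lerch_kernel k v (of_real t)
        - of_real (x\<^sup>2) * (pos_powr (z - 1) t * Lerch_kernel k v (of_real t) / of_real (t\<^sup>2 + x\<^sup>2))"
    proof (cases "t > 0")
      case True
      have p: "pos_powr (z + 2 - 1) t = pos_powr (z - 1) t * of_real (t\<^sup>2)"
        using pos_powr_add_nat[OF True, of "z - 1" 2] by (simp add: algebra_simps)
      have "t\<^sup>2 + x\<^sup>2 \<noteq> 0" using x by (simp add: sum_power2_eq_zero_iff)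
      then have nz: "complex_of_real (t\<^sup>2 + x\<^sup>2) \<noteq> 0" unfolding of_real_eq_0_iff .
      have "A * T * W / D = A * W - X * (A * W / D)" if "D = T + X" "D \<noteq> 0" for A T W X D :: complex
        using that(2) by (simp add: divide_simps) (simp add: that(1) algebra_simps)
      from this[OF _ nz] show ?thesis unfolding p by simp
    qed (simp add: pos_powr_def)
  qed
  also have "\<dots> = Lerch_moment k v z - Lerch_transform k v z x"
    unfolding Lerch_moment_def Lerch_transform_def
    by (simp only: Bochner_Integration.integral_diff[OF integrable_Lerch_moment[OF k v z] integrable_Lerch_transform[OF k v z]]
        integral_mult_right_zero)
  finally show ?thesis unfolding Lerch_transform_def[of k v "z + 2"] by simp
qed

lemma Lerch_transform_expand:
  assumes k: "k \<in> {0, 1}" and v: "v > 0" and z: "Re z - 2 * real m > (if k = 0 then 1 else 0)" and x: "x \<noteq> 0"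
  shows "Lerch_transform k v z x = (\<Sum>j = 1..m. (-1) ^ (j - 1) * Lerch_moment k v (z - 2 * of_nat j) * of_real (x ^ (2 * j)))
     + (-1) ^ m * of_real (x ^ (2 * m)) * Lerch_transform k v (z - 2 * of_nat m) x"
  using z
proof (induction m)
  case (Suc m)
  have "z - 2 * of_nat m = (z - 2 * of_nat (Suc m)) + 2"
    by simp
  then have rec: "Lerch_transform k v (z - 2 * of_nat m) x
      = of_real (x\<^sup>2) * (Lerch_moment k v (z - 2 * of_nat (Suc m)) - Lerch_transform k v (z - 2 * of_nat (Suc m)) x)"
    using Lerch_transform_add_2[OF k v _ x, of "z - 2 * of_nat (Suc m)"] Suc.prems by (simp split: if_splits)
  have "Re z - 2 * real m > (if k = 0 then 1 else 0)"
    using Suc.prems by (auto split: if_splits)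
  note IH = Suc.IH[OF this]
  show ?case
    unfolding IH rec by (simp add: right_diff_distrib power2_eq_square mult_ac)
qed simp

lemma Phi_eq_Lerch_moment: "Phi ((-1) ^ k) z v = Lerch_moment k v z / Gamma z"
proof -
  have "(LINT t:{0<..}|lborel. complex_of_real t powr (z - 1) * complex_of_real (exp ((1 - v) * t))
          / (complex_of_real (exp t) - complex_of_real ((-1) ^ k)))
      = (LINT t:{0<..}|lborel. complex_of_real t powr (z - 1) * Lerch_kernel k v (of_real t))"
    by (rule set_lebesgue_integral_cong) (auto simp: Lerch_kernel_def exp_of_real[symmetric])
  then show ?thesis
    unfolding Phi_def Lerch_moment_def LINT_pos_powr[symmetric] by simp
qed

lemma Gamma_ne_0: "Re z > 0 \<Longrightarrow> Gamma z \<noteq> (0 :: complex)"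
  by (auto simp: Gamma_eq_zero_iff elim!: nonpos_Ints_cases)

text \<open>Half-angle factorisation: e^(2iy) - (-1)^k equals e^(i(y - pi k/2)) 2i sin(y + pi k/2).
  The sine factor in front of G cancels this denominator, and \<alpha> is the phase that occurs in
  f.\<close>

lemma Lerch_kernel_imaginary:
  fixes v y :: real
  assumes k: "k \<in> {0, 1}" and y: "sin (y + pi * real k / 2) \<noteq> 0"
  defines "\<alpha> \<equiv> (2 * v - 1) * y - pi * real k / 2"
  shows "Lerch_kernel k v (\<i> * of_real (2 * y)) = cis (- \<alpha>) / (2 * \<i> * of_real (sin (y + pi * real k / 2)))"
    and "Lerch_kernel k v (- \<i> * of_real (2 * y)) = - cis \<alpha> / (2 * \<i> * of_real (sin (y + pi * real k / 2)))"
proof -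
  define \<beta> where "\<beta> = y + pi * real k / 2"
  have sgn: "(-1) ^ k = cis (- (pi * real k))" "(-1) ^ k = cis (pi * real k)"
    using k by (auto simp: complex_eq_iff)
  have cis_diff_cis: "cis \<beta> - cis (- \<beta>) = 2 * \<i> * of_real (sin \<beta>)"
    by (simp add: complex_eq_iff)
  have d1: "cis (2 * y) - cis (- (pi * real k)) = cis (y - pi * real k / 2) * (cis \<beta> - cis (- \<beta>))"
    by (simp add: right_diff_distrib cis_mult \<beta>_def field_simps)
  have d2: "cis (- (2 * y)) - cis (pi * real k) = cis (- (y - pi * real k / 2)) * (cis (- \<beta>) - cis \<beta>)"
    by (simp add: right_diff_distrib cis_mult \<beta>_def field_simps)
  have n1: "exp (of_real (1 - v) * (\<i> * of_real (2 * y))) = cis (y - pi * real k / 2) * cis (- \<alpha>)"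
    unfolding cis_mult by (simp add: cis_conv_exp \<alpha>_def algebra_simps)
  have n2: "exp (of_real (1 - v) * (- \<i> * of_real (2 * y))) = cis (- (y - pi * real k / 2)) * cis \<alpha>"
    unfolding cis_mult by (simp add: cis_conv_exp \<alpha>_def algebra_simps)
  have e: "exp (\<i> * of_real (2 * y)) = cis (2 * y)" "exp (- \<i> * of_real (2 * y)) = cis (- (2 * y))"
    by (simp_all add: cis_conv_exp)
  show "Lerch_kernel k v (\<i> * of_real (2 * y)) = cis (- \<alpha>) / (2 * \<i> * of_real (sin (y + pi * real k / 2)))"
    unfolding Lerch_kernel_def n1 e(1) sgn(1) d1 cis_diff_cis \<beta>_def[symmetric] by simp
  have c: "cis (- \<beta>) - cis \<beta> = - (2 * \<i> * of_real (sin \<beta>))"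
    using cis_diff_cis by (metis minus_diff_eq)
  show "Lerch_kernel k v (- \<i> * of_real (2 * y)) = - cis \<alpha> / (2 * \<i> * of_real (sin (y + pi * real k / 2)))"
    unfolding Lerch_kernel_def n2 e(2) sgn(2) d2 c \<beta>_def[symmetric] by simp
qed

section \<open>The difference of the two functions\<close>

text \<open>\<open>\<nat>\<close> contains 0, so \<open>\<nat> - {0}\<close> is the set of positive
  integers.\<close>

locale admissible_params =
  fixes k :: nat and s :: complex and v :: real
  assumes k: "k \<in> {0, 1}" and v: "v \<in> {0<..1}"
    and cases: "(k = 0 \<and> v \<in> {0<..<1} \<and> Re s > 1 \<and> (\<forall>d::nat. Re s \<noteq> 3 + 2 * real d) \<and> s \<notin> \<nat> - {0})
       \<or> (k = 0 \<and> v = 1 \<and> Re s \<in> (\<Union>d::nat. {1 + 2 * real d<..<2 + 2 * real d}))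
       \<or> (k = 1 \<and> v \<in> {0<..1} \<and> Re s > 0 \<and> (\<forall>d::nat. Re s \<noteq> 2 + 2 * real d) \<and> s \<notin> \<nat> - {0})"
begin

section \<open>Reduction of the exponent to a bounded strip\<close>

definition m :: nat where "m = m_idx k s"
definition a :: complex where "a = s - 2 * of_nat m"

lemma Re_a: "Re a = Re s - 2 * real m"
  by (simp add: a_def)

lemma nat_floor_half: "x \<ge> 0 \<Longrightarrow> 2 * real (nat \<lfloor>x / 2\<rfloor>) \<le> x \<and> x < 2 * real (nat \<lfloor>x / 2\<rfloor>) + 2"
  by linarith

text \<open>The floor alone puts Re a into [1,3) for k = 0 and [0,2) for k = 1. The left end with m
  > 0 is ruled out by the excluded values of Re s, and with m = 0 by the lower bound on Re s. For v
  = 1 the interval containing Re s has index m, which gives the sharper upper bound.\<close>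

lemma Re_a_bounds:
  "k = 0 \<Longrightarrow> 1 < Re a \<and> Re a < 3" "k = 0 \<Longrightarrow> v = 1 \<Longrightarrow> Re a < 2" "k = 1 \<Longrightarrow> 0 < Re a \<and> Re a < 2"
proof -
  show k0: "1 < Re a \<and> Re a < 3" if k0: "k = 0"
  proof -
    have gt: "Re s > 1" using cases k0 by auto
    have "m = nat \<lfloor>(Re s - 1) / 2\<rfloor>"
      unfolding m_def m_idx_def using k0 by (rule if_P)
    then have b: "2 * real m \<le> Re s - 1" "Re s - 1 < 2 * real m + 2"
      using nat_floor_half[of "Re s - 1"] gt by auto
    have "Re s - 1 \<noteq> 2 * real m"
    proof
      assume eq: "Re s - 1 = 2 * real m"
      then obtain d where "m = Suc d" using gt by (cases m) auto
      with eq have d: "Re s = 3 + 2 * real d" by simp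
      from cases k0 consider "\<forall>d::nat. Re s \<noteq> 3 + 2 * real d"
        | e :: nat where "1 + 2 * real e < Re s" "Re s < 2 + 2 * real e" by auto
      then show False
      proof cases
        case 2
        then have "real e < real (Suc d)" "real (Suc d) < real (Suc e)"
          using d by simp_all
        then show False unfolding of_nat_less_iff by simp
      qed (use d in auto)
    qed
    then show ?thesis using b by (simp add: Re_a)
  qed
  show "Re a < 2" if k0: "k = 0" "v = 1"
  proof -
    from cases k0 obtain e :: nat where e: "1 + 2 * real e < Re s" "Re s < 2 + 2 * real e" by auto
    have "1 < Re s - 2 * real m" "Re s - 2 * real m < 3"
      using \<open>k = 0 \<Longrightarrow> 1 < Re a \<and> Re a < 3\<close>[OF k0(1)] unfolding Re_a by simp_all
    then have "real m < real (Suc e)" "real e < real (Suc m)" using e by simp_all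
    then have "m = e" unfolding of_nat_less_iff by simp
    then show ?thesis using e by (simp add: Re_a)
  qed
  show "0 < Re a \<and> Re a < 2" if k1: "k = 1"
  proof -
    have gt: "Re s > 0" and ne: "\<forall>d::nat. Re s \<noteq> 2 + 2 * real d" using cases k1 by auto
    have "m = nat \<lfloor>Re s / 2\<rfloor>"
      unfolding m_def m_idx_def by (rule if_not_P) (simp add: k1)
    then have b: "2 * real m \<le> Re s" "Re s < 2 * real m + 2"
      using nat_floor_half[of "Re s"] gt by auto
    have "Re s \<noteq> 2 * real m"
    proof
      assume eq: "Re s = 2 * real m"
      then obtain d where "m = Suc d" using gt by (cases m) auto
      with eq ne show False by simp
    qed
    then show ?thesis using b by (simp add: Re_a)
  qed
qed

text \<open>If a were 1 or 2, then s = a + 2m would be a positive integer, leaving only k = 0, v =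
  1; there 1 < Re a < 2.\<close>

lemma a_ne: "a \<noteq> 1" "a \<noteq> 2"
proof -
  have *: False if a: "a = of_nat n" "n = 1 \<or> n = 2" for n
  proof -
    have "z \<in> \<nat> - {0}" if "z - 2 * of_nat M = (of_nat n :: complex)" for z M
    proof -
      have "z = of_nat (n + 2 * M)" using that by (simp add: diff_eq_eq)
      then show ?thesis using a(2) by (auto simp del: of_nat_add)
    qed
    from this[OF a(1)[unfolded a_def]] have sN: "s \<in> \<nat> - {0}" .
    have kv: "k = 0" "v = 1" using cases by (elim disjE conjE; use sN in simp)+
    have "Re a = real n" unfolding a(1) by simp
    then show False using Re_a_bounds(1)[OF kv(1)] Re_a_bounds(2)[OF kv] a(2) by auto
  qed
  show "a \<noteq> 1" using *[of 1] by auto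
  show "a \<noteq> 2" using *[of 2] by auto
qed

sublocale reduced_params k v a
  using k v Re_a_bounds a_ne by unfold_locales auto

lemma v_pos: "v > 0" using v by simp

lemma Re_s: "Re s - 2 * real m > (if k = 0 then 1 else 0)"
  using Re_a_bounds[unfolded Re_a] k by auto

lemma trig_s: "sin (of_real pi * s / 2) = (-1) ^ m * sin (of_real pi * a / 2)"
    "cos (of_real pi * s / 2) = (-1) ^ m * cos (of_real pi * a / 2)"
    "sin (of_real pi * s) = sin (of_real pi * a)"
    "sin (\<theta> + of_real pi * s / 2) = (-1) ^ m * sin (\<theta> + of_real pi * a / 2)"
proof -
  have sc: "sin (of_nat m * of_real pi) = (0 :: complex)" "cos (of_nat m * of_real pi) = ((-1) ^ m :: complex)"
  proof -
    have e: "of_nat m * complex_of_real pi = of_real (real m * pi)" by simp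
    show "sin (of_nat m * of_real pi) = (0 :: complex)" "cos (of_nat m * of_real pi) = ((-1) ^ m :: complex)"
      unfolding e sin_of_real cos_of_real sin_npi cos_npi by simp_all
  qed
  have "P * z / 2 = P * (z - 2 * M) / 2 + M * P" for P z M :: complex
    by (simp add: algebra_simps diff_divide_distrib)
  then have h: "of_real pi * s / 2 = of_real pi * a / 2 + of_nat m * of_real pi"
    unfolding a_def .
  have sh: "sin (w + of_nat m * of_real pi) = (-1) ^ m * sin w" "cos (w + of_nat m * of_real pi) = (-1) ^ m * cos w" for w :: complex
    by (simp_all add: sin_add cos_add sc)
  show "sin (of_real pi * s / 2) = (-1) ^ m * sin (of_real pi * a / 2)"
    "cos (of_real pi * s / 2) = (-1) ^ m * cos (of_real pi * a / 2)"
    unfolding h sh by simp_all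
  show "sin (\<theta> + of_real pi * s / 2) = (-1) ^ m * sin (\<theta> + of_real pi * a / 2)"
    unfolding h add.assoc[symmetric] sh by simp
  have "P * z = P * (z - 2 * M) + M * P + M * P" for P z M :: complex
    by (simp add: algebra_simps)
  then have "of_real pi * s = of_real pi * a + of_nat m * of_real pi + of_nat m * of_real pi"
    unfolding a_def .
  then show "sin (of_real pi * s) = sin (of_real pi * a)"
    by (simp only: sh) (simp add: mult.assoc[symmetric] power_mult_distrib[symmetric])
qed

section \<open>Identification of the series in g and of f\<close>

lemma node_eq: "node k (i + (1 - k)) = freq k i / 2"
  using k by (auto simp: node_def freq_def field_simps)

lemma square_ne_node_square:
  assumes "sin (2 * y) \<noteq> 0"
  shows "y\<^sup>2 \<noteq> (node k n)\<^sup>2"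
proof
  assume "y\<^sup>2 = (node k n)\<^sup>2"
  then have "2 * y = 2 * node k n \<or> 2 * y = - (2 * node k n)"
    by (auto simp: power2_eq_iff)
  then have "sin (2 * y) = sin (2 * node k n) \<or> sin (2 * y) = - sin (2 * node k n)"
    by (metis sin_minus)
  moreover have "2 * node k n = real (2 * n + k) * pi"
    by (simp add: node_def algebra_simps)
  then have "sin (2 * node k n) = 0"
    by (simp only: sin_npi)
  ultimately show False using assms by auto
qed

lemma sin_shift_ne_0:
  assumes "sin (2 * y) \<noteq> 0"
  shows "sin (y + pi * real k / 2) \<noteq> 0"
  using assms k by (auto simp: sin_double sin_add)

definition g_term :: "real \<Rightarrow> nat \<Rightarrow> complex"
  where "g_term y i =
    complex_of_real (node k (i + (1 - k))) powr (s - 2 * of_nat m - 1)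
      * sin (complex_of_real (pi * (2 * real (i + (1 - k)) + real k) * v) + complex_of_real pi * s / 2)
      * complex_of_real (sin_quot k (i + (1 - k)) y)"

lemma g_fun_unfold:
  "g_fun k s v y = - (complex_of_real (sin (y + pi * real k / 2)) *
          (\<Sum>j = 1..m. (-1) ^ (j - 1) * Gamma (s - 2 * of_nat j)
              * Phi ((-1) ^ k) (s - 2 * of_nat j) v * complex_of_real ((2 * y) ^ (2 * j)))
        + complex_of_real pi * 2 powr s * complex_of_real (y ^ (2 * (m + 1)))
            / sin (complex_of_real pi * s) * (\<Sum>i. g_term y i))"
  unfolding g_fun_def g_term_def Let_def m_def by (rule refl)

lemma
  assumes y: "y > 0" "sin (2 * y) \<noteq> 0"
  shows summable_g_term: "summable (g_term y)"
    and g_fun_eq: "- g_fun k s v y = of_real (sin (y + pi * real k / 2)) *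
     (Lerch_transform k v s (2 * y)
      - (-1) ^ m * of_real ((2 * y) ^ (2 * m + 2)) * (of_real pi * of_real (2 * y) powr (a - 2) / 4 *
          ((Lerch_kernel k v (\<i> * of_real (2 * y)) - Lerch_kernel k v (- \<i> * of_real (2 * y))) / (\<i> * cos (of_real pi * a / 2))
            + (Lerch_kernel k v (\<i> * of_real (2 * y)) + Lerch_kernel k v (- \<i> * of_real (2 * y))) / sin (of_real pi * a / 2))))"
proof -
  define sy where "sy = sin (y + pi * real k / 2)"
  define E where "E = of_real pi * of_real (2 * y) powr (a - 2) / 4 *
          ((Lerch_kernel k v (\<i> * of_real (2 * y)) - Lerch_kernel k v (- \<i> * of_real (2 * y))) / (\<i> * cos (of_real pi * a / 2))
            + (Lerch_kernel k v (\<i> * of_real (2 * y)) + Lerch_kernel k v (- \<i> * of_real (2 * y))) / sin (of_real pi * a / 2))"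
  define I where "I = (LINT t|lborel. pos_powr (a - 1) t * Lerch_kernel k v (of_real t) / of_real (t\<^sup>2 + (2 * y)\<^sup>2))"
  define S where "S i = 2 * of_real pi * of_real (freq k i) powr (a - 1) * sin (of_real (freq k i * v) + of_real pi * a / 2)
          / (sin (of_real pi * a) * of_real ((2 * y)\<^sup>2 - (freq k i)\<^sup>2))" for i
  have S: "S sums (I - E)"
    unfolding S_def I_def E_def using y by (intro Lerch_series_sums) auto
  have sinpa: "sin (of_real pi * a) \<noteq> 0"
    using sin_double[of "of_real pi * a / 2"] sin_ne cos_ne by simp
  \<comment> \<open>The conversion factor between the two series: a frequency is twice a node,
    giving 2^(a-1) in the power and 4 in the denominator, and passing from s to a in the sine gives
    (-1)^m.\<close>
  define \<kappa> where "\<kappa> = (-1) ^ m * of_real sy * (2 * sin (of_real pi * a)) / (of_real pi * 2 powr (a - 1))"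
  have two: "(2::complex) powr (a - 1) \<noteq> 0" by simp
  have term_eq: "g_term y i = \<kappa> * S i" for i
  proof -
    define n where "n = i + (1 - k)"
    have n: "node k n = freq k i / 2" unfolding n_def by (rule node_eq)
    have f2: "pi * (2 * real n + real k) * v = freq k i * v"
    proof -
      have "pi * (2 * real n + real k) = 2 * node k n" by (simp add: node_def algebra_simps)
      then show ?thesis unfolding n by simp
    qed
    have D: "y\<^sup>2 - (node k n)\<^sup>2 \<noteq> 0" using square_ne_node_square[OF y(2)] by simp
    have q: "sin_quot k n y = sy / (y\<^sup>2 - (node k n)\<^sup>2)"
      using square_ne_node_square[OF y(2)] by (simp add: sin_quot_def sy_def)
    have fr: "freq k i = 2 * node k n" unfolding n by simp
    have "node k n \<ge> 0" using freq_pos[OF k_le, of i] unfolding n by simp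
    then have fp: "complex_of_real (freq k i) powr (a - 1) = 2 powr (a - 1) * of_real (node k n) powr (a - 1)"
      unfolding fr using powr_times_real[of 2 "of_real (node k n)" "a - 1"] by simp
    have fd: "complex_of_real ((2 * y)\<^sup>2 - (freq k i)\<^sup>2) = 4 * of_real (y\<^sup>2 - (node k n)\<^sup>2)"
      unfolding n by (simp add: power2_eq_square)
    have Dc: "complex_of_real (y\<^sup>2 - (node k n)\<^sup>2) \<noteq> 0" using D unfolding of_real_eq_0_iff .
    have alg: "N * (M * T) * (Y / D) = M * Y * (2 * P) / (Q * w) * (2 * Q * (w * N) * T / (P * (4 * D)))"
      if "P \<noteq> 0" "Q \<noteq> 0" "w \<noteq> 0" "D \<noteq> 0" for N M T Y D P Q w :: complex
      using that by (simp add: field_simps)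
    have "of_real (node k n) powr (a - 1) * ((-1) ^ m * sin (of_real (freq k i * v) + of_real pi * a / 2)) * (of_real sy / of_real (y\<^sup>2 - (node k n)\<^sup>2))
        = \<kappa> * S i"
      unfolding \<kappa>_def S_def fp fd
      by (rule alg[OF sinpa _ two Dc]) simp
    then show ?thesis
      unfolding g_term_def n_def[symmetric] f2 q trig_s(4) a_def[symmetric] of_real_divide by simp
  qed
  show "summable (g_term y)"
    unfolding term_eq[abs_def] by (rule sums_summable[OF sums_mult[OF S]])
  have suminf_eq: "(\<Sum>i. g_term y i) = \<kappa> * (I - E)"
    unfolding term_eq by (rule sums_unique[symmetric, OF sums_mult[OF S]])
  have coeff: "complex_of_real pi * 2 powr s * complex_of_real (y ^ (2 * (m + 1))) / sin (complex_of_real pi * s) * \<kappa>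
      = (-1) ^ m * of_real sy * of_real ((2 * y) ^ (2 * m + 2))"
  proof -
    have "2 powr s = 2 powr (a - 1) * 2 * 2 ^ (2 * m)"
    proof -
      have "2 powr s = 2 powr (a - 1 + of_nat (2 * m + 1))" by (simp add: a_def)
      also have "\<dots> = 2 powr (a - 1) * 2 ^ (2 * m + 1)"
        unfolding powr_add by (subst powr_nat') simp_all
      finally show ?thesis by simp
    qed
    moreover have "Q * (w * 2 * R) * Y / P * (M * sY * (2 * P) / (Q * w)) = M * sY * (4 * R * Y)"
      if "P \<noteq> 0" "Q \<noteq> 0" "w \<noteq> 0" for Q w R Y P M sY :: complex
      using that by (simp add: field_simps)
    moreover have "complex_of_real ((2 * y) ^ (2 * m + 2)) = 4 * 2 ^ (2 * m) * of_real (y ^ (2 * (m + 1)))"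
      by (simp add: power_mult_distrib power_add)
    ultimately show ?thesis
      unfolding trig_s(3) \<kappa>_def using sinpa two by simp
  qed
  have moments: "(\<Sum>j = 1..m. (-1) ^ (j - 1) * Gamma (s - 2 * of_nat j) * Phi ((-1) ^ k) (s - 2 * of_nat j) v * complex_of_real ((2 * y) ^ (2 * j)))
      = (\<Sum>j = 1..m. (-1) ^ (j - 1) * Lerch_moment k v (s - 2 * of_nat j) * complex_of_real ((2 * y) ^ (2 * j)))"
  proof (rule sum.cong[OF refl])
    fix j assume "j \<in> {1..m}"
    then have "Re (s - 2 * of_nat j) > 0" using Re_s by (auto split: if_splits)
    then have "Gamma (s - 2 * of_nat j) \<noteq> 0" by (rule Gamma_ne_0)
    then show "(-1) ^ (j - 1) * Gamma (s - 2 * of_nat j) * Phi ((-1) ^ k) (s - 2 * of_nat j) v * complex_of_real ((2 * y) ^ (2 * j))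
      = (-1) ^ (j - 1) * Lerch_moment k v (s - 2 * of_nat j) * complex_of_real ((2 * y) ^ (2 * j))"
      unfolding Phi_eq_Lerch_moment by simp
  qed
  have trans: "Lerch_transform k v s (2 * y) = (\<Sum>j = 1..m. (-1) ^ (j - 1) * Lerch_moment k v (s - 2 * of_nat j) * complex_of_real ((2 * y) ^ (2 * j)))
      + (-1) ^ m * of_real ((2 * y) ^ (2 * m + 2)) * I"
    using Lerch_transform_expand[OF k v_pos Re_s, of "2 * y"] y(1)
    unfolding a_def[symmetric] Lerch_transform_def[of k v a] I_def
    by (simp add: power_add power2_eq_square mult_ac)
  have "- g_fun k s v y = of_real sy * (\<Sum>j = 1..m. (-1) ^ (j - 1) * Lerch_moment k v (s - 2 * of_nat j) * complex_of_real ((2 * y) ^ (2 * j)))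
      + complex_of_real pi * 2 powr s * complex_of_real (y ^ (2 * (m + 1))) / sin (complex_of_real pi * s) * \<kappa> * (I - E)"
    unfolding g_fun_unfold moments suminf_eq sy_def[symmetric]
    by (simp only: minus_minus mult.assoc)
  then show "- g_fun k s v y = of_real (sin (y + pi * real k / 2)) *
     (Lerch_transform k v s (2 * y)
      - (-1) ^ m * of_real ((2 * y) ^ (2 * m + 2)) * (of_real pi * of_real (2 * y) powr (a - 2) / 4 *
          ((Lerch_kernel k v (\<i> * of_real (2 * y)) - Lerch_kernel k v (- \<i> * of_real (2 * y))) / (\<i> * cos (of_real pi * a / 2))
            + (Lerch_kernel k v (\<i> * of_real (2 * y)) + Lerch_kernel k v (- \<i> * of_real (2 * y))) / sin (of_real pi * a / 2))))"
    unfolding coeff sy_def[symmetric] E_def[symmetric] trans by (simp add: algebra_simps)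
qed

text \<open>f is exactly the contribution of the partial fractions at \<plusminus>2iy that is
  subtracted in \<open>g_fun_eq\<close>, so only the transform survives in f - g. The powers combine
  as (2y)^(2m+2) (2y)^(a-2) = (2y)^s.\<close>

lemma f_fun_eq:
  assumes y: "y > 0" "sin (2 * y) \<noteq> 0"
  shows "f_fun k s v y = of_real (sin (y + pi * real k / 2)) *
     ((-1) ^ m * of_real ((2 * y) ^ (2 * m + 2)) * (of_real pi * of_real (2 * y) powr (a - 2) / 4 *
          ((Lerch_kernel k v (\<i> * of_real (2 * y)) - Lerch_kernel k v (- \<i> * of_real (2 * y))) / (\<i> * cos (of_real pi * a / 2))
            + (Lerch_kernel k v (\<i> * of_real (2 * y)) + Lerch_kernel k v (- \<i> * of_real (2 * y))) / sin (of_real pi * a / 2))))"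
proof -
  define sy where "sy = complex_of_real (sin (y + pi * real k / 2))"
  define \<alpha> where "\<alpha> = (2 * v - 1) * y - pi * real k / 2"
  define cA where "cA = cos (of_real pi * a / 2)"
  define sA where "sA = sin (of_real pi * a / 2)"
  have nz: "cA \<noteq> 0" "sA \<noteq> 0" using cos_ne sin_ne by (simp_all add: cA_def sA_def)
  have sy0: "sy \<noteq> 0" using sin_shift_ne_0[OF y(2)] by (simp add: sy_def)
  have c: "cis (- \<alpha>) = of_real (cos \<alpha>) - \<i> * of_real (sin \<alpha>)" "cis \<alpha> = of_real (cos \<alpha>) + \<i> * of_real (sin \<alpha>)"
    by (simp_all add: complex_eq_iff)
  note ker = Lerch_kernel_imaginary[OF k sin_shift_ne_0[OF y(2)], of v, folded \<alpha>_def sy_def]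
  have diff: "(Lerch_kernel k v (\<i> * of_real (2 * y)) - Lerch_kernel k v (- \<i> * of_real (2 * y))) / (\<i> * cA) = - (of_real (cos \<alpha>) / (sy * cA))"
    unfolding ker c using sy0 nz by (simp add: field_simps)
  have sum: "(Lerch_kernel k v (\<i> * of_real (2 * y)) + Lerch_kernel k v (- \<i> * of_real (2 * y))) / sA = - (of_real (sin \<alpha>) / (sy * sA))"
    unfolding ker c using sy0 nz by (simp add: field_simps)
  have pw: "complex_of_real ((2 * y) ^ (2 * m + 2)) * (of_real pi * of_real (2 * y) powr (a - 2) / 4) = of_real pi * 2 powr (s - 2) * of_real y powr s"
  proof -
    have "complex_of_real ((2 * y) ^ (2 * m + 2)) * of_real (2 * y) powr (a - 2) = of_real (2 * y) powr (a - 2 + of_nat (2 * m + 2))"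
      using y by (subst powr_add, subst powr_nat') (auto simp: mult.commute)
    also have "a - 2 + of_nat (2 * m + 2) = s" by (simp add: a_def)
    also have "complex_of_real (2 * y) powr s = 2 powr s * of_real y powr s"
      using y powr_times_real[of 2 "of_real y" s] by simp
    also have "2 powr s = 4 * (2::complex) powr (s - 2)"
      using powr_add[of "2::complex" 2 "s - 2"] by simp
    finally show ?thesis by simp
  qed
  have "of_real (sin (y + pi * real k / 2)) *
     ((-1) ^ m * of_real ((2 * y) ^ (2 * m + 2)) * (of_real pi * of_real (2 * y) powr (a - 2) / 4 *
          ((Lerch_kernel k v (\<i> * of_real (2 * y)) - Lerch_kernel k v (- \<i> * of_real (2 * y))) / (\<i> * cA)
            + (Lerch_kernel k v (\<i> * of_real (2 * y)) + Lerch_kernel k v (- \<i> * of_real (2 * y))) / sA)))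
    = sy * ((-1) ^ m * ((complex_of_real ((2 * y) ^ (2 * m + 2)) * (of_real pi * of_real (2 * y) powr (a - 2) / 4))
        * (- (of_real (cos \<alpha>) / (sy * cA)) + - (of_real (sin \<alpha>) / (sy * sA)))))"
    unfolding diff sum sy_def by (simp only: mult.assoc)
  also have "\<dots> = f_fun k s v y"
  proof -
    have alg: "sy * (M * (X * (- (c / (sy * cA)) + - (d / (sy * sA))))) = - (X * (d / (M * sA) + c / (M * cA)))"
      if "M * M = 1" for M X c d
    proof -
      have "M \<noteq> 0" "inverse M = M" using that by (auto intro: inverse_unique)
      then have "d / (M * sA) = M * (d / sA)" "c / (M * cA) = M * (c / cA)"
        by (simp_all add: divide_inverse mult_ac)
      moreover have "sy * (c / (sy * cA)) = c / cA" "sy * (d / (sy * sA)) = d / sA"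
        using sy0 by simp_all
      moreover have "sy * (M * (X * Z)) = M * (X * (sy * Z))" for Z
        by (simp only: mult.left_commute)
      ultimately show ?thesis
        by (simp only: distrib_left mult_minus_right) (simp add: mult_ac)
    qed
    have sgn: "(-1) ^ m * (-1) ^ m = (1 :: complex)"
      by (simp flip: power_mult_distrib)
    show ?thesis
      unfolding pw alg[OF sgn] f_fun_def trig_s(1,2) \<alpha>_def[symmetric] cA_def[symmetric] sA_def[symmetric]
      using y by (simp add: distrib_left mult_ac)
  qed
  finally show ?thesis unfolding cA_def sA_def by simp
qed

text \<open>Like g, f is odd for k = 0 and even for k = 1; as the transform is even in x, the
  identity for f - g extends from y > 0 to y < 0.\<close>

lemma f_fun_minus: "f_fun k s v (- y) = (-1) ^ (k + 1) * f_fun k s v y"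
proof (cases "k = 0")
  case True
  then show ?thesis by (simp add: f_fun_def sgn_minus) (simp add: algebra_simps)
next
  case False
  then have k1: "k = 1" using k by simp
  have t: "sin (w - pi / 2) = - cos w" "cos (w - pi / 2) = sin w" for w :: real
    by (simp_all add: sin_diff cos_diff)
  show ?thesis unfolding f_fun_def k1 by (simp add: t sgn_minus)
qed

lemma g_fun_minus:
  assumes y: "y > 0" "sin (2 * y) \<noteq> 0"
  shows "g_fun k s v (- y) = (-1) ^ (k + 1) * g_fun k s v y"
proof -
  have sn: "sin (- y + pi * real k / 2) = (-1) ^ (k + 1) * sin (y + pi * real k / 2)"
    using k by (auto simp: sin_add sin_diff)
  have "sin_quot k n (- y) = (-1) ^ (k + 1) * sin_quot k n y" for n
    using square_ne_node_square[OF y(2), of n] unfolding sin_quot_def Let_def sn by simp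
  then have "g_term (- y) = (\<lambda>i. (-1) ^ (k + 1) * g_term y i)"
    unfolding g_term_def by (intro ext) simp
  moreover have "summable (g_term y)"
    by (rule summable_g_term[OF y])
  ultimately have T: "suminf (g_term (- y)) = (-1) ^ (k + 1) * suminf (g_term y)"
    by (simp only: suminf_mult)
  have sn': "complex_of_real (sin (- y + pi * real k / 2)) = (-1) ^ (k + 1) * of_real (sin (y + pi * real k / 2))"
    unfolding sn by simp
  have p: "(2 * - y) ^ (2 * j) = (2 * y) ^ (2 * j)" "(- y) ^ (2 * j) = y ^ (2 * j)" for j
    by simp_all
  have "- (c * A * B + D * (c * E)) = c * - (A * B + D * E)" for c A B D E :: complex
    by (simp add: algebra_simps)
  then show ?thesis
    unfolding g_fun_unfold T sn' p .
qed

lemma f_minus_g_eq: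
  assumes y: "sin (2 * y) \<noteq> 0"
  shows "f_fun k s v y - g_fun k s v y = of_real (sin (y + pi * real k / 2)) * Lerch_transform k v s (2 * y)"
proof -
  have pos: "f_fun k s v z - g_fun k s v z = of_real (sin (z + pi * real k / 2)) * Lerch_transform k v s (2 * z)"
    if z: "z > 0" "sin (2 * z) \<noteq> 0" for z
  proof -
    have "f_fun k s v z - g_fun k s v z = f_fun k s v z + (- g_fun k s v z)" by simp
    also have "\<dots> = of_real (sin (z + pi * real k / 2)) * Lerch_transform k v s (2 * z)"
      unfolding f_fun_eq[OF z] g_fun_eq[OF z] by (simp add: algebra_simps)
    finally show ?thesis .
  qed
  show ?thesis
  proof (cases "y > 0")
    case False
    with y have z: "- y > 0" "sin (2 * (- y)) \<noteq> 0" by (auto simp: not_less le_less)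
    have sn: "sin (y + pi * real k / 2) = (-1) ^ (k + 1) * sin (- y + pi * real k / 2)"
      using k by (auto simp: sin_add sin_diff)
    have L: "Lerch_transform k v s (2 * - y) = Lerch_transform k v s (2 * y)"
      by (simp add: Lerch_transform_def)
    have "f_fun k s v y - g_fun k s v y = (-1) ^ (k + 1) * (f_fun k s v (- y) - g_fun k s v (- y))"
      using f_fun_minus[of "- y"] g_fun_minus[OF z] by (simp add: right_diff_distrib)
    then show ?thesis
      unfolding pos[OF z] sn L by simp
  qed (use pos y in auto)
qed

end

section \<open>Integrability\<close>

lemma measurable_Lerch_transform [measurable]: "Lerch_transform k v z \<in> borel_measurable borel"
proof -
  have "(\<lambda>x. LINT t|lborel. pos_powr (z - 1) t * Lerch_kernel k v (of_real t) / of_real (t\<^sup>2 + x\<^sup>2)) \<in> borel_measurable borel"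
    by (rule lborel.borel_measurable_lebesgue_integral) measurable
  then show ?thesis
    unfolding Lerch_transform_def[abs_def] by measurable
qed

text \<open>By the recursion, x^2 times the deviation from the moment is, up to sign, the transform
  at z+2, which is bounded by an absolute moment independent of x.\<close>

lemma Lerch_transform_tail:
  assumes k: "k \<in> {0, 1}" and v: "v > 0" and z: "Re z > (if k = 0 then 1 else 0)"
  obtains C where "\<And>x. norm (Lerch_transform k v z x) \<le> C"
    and "\<And>x. x\<^sup>2 * norm (Lerch_transform k v z x - Lerch_moment k v z) \<le> C"
proof -
  define A where "A w = (LINT t|lborel. norm (pos_powr (w - 1) t * Lerch_kernel k v (of_real t)))" for w
  have A0: "A w \<ge> 0" for w unfolding A_def by simp
  have z2: "Re (z + 2) > (if k = 0 then 1 else 0)" using z by (auto split: if_splits)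
  show ?thesis
  proof (rule that[of "A z + A (z + 2)"])
    fix x :: real
    show "norm (Lerch_transform k v z x) \<le> A z + A (z + 2)"
      using norm_Lerch_transform_le[OF k v z, of x] A0[of "z + 2"] unfolding A_def by linarith
    show "x\<^sup>2 * norm (Lerch_transform k v z x - Lerch_moment k v z) \<le> A z + A (z + 2)"
    proof (cases "x = 0")
      case False
      have "x\<^sup>2 * norm (Lerch_transform k v z x - Lerch_moment k v z) = norm (Lerch_transform k v (z + 2) x)"
        unfolding Lerch_transform_add_2[OF k v z False] norm_mult by (simp add: norm_minus_commute norm_power)
      then show ?thesis
        using norm_Lerch_transform_le[OF k v z2, of x] A0[of z] unfolding A_def by linarith
    qed (use A0[of z] A0[of "z + 2"] in simp)
  qed
qed

text \<open>Reduced to the Mellin integrals already known, on the positive half-line and by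
  reflection on the negative one.\<close>

lemma integrable_inverse_square_powr:
  assumes p: "p > 1/2"
  shows "integrable lborel (\<lambda>y::real. (1 / (1 + y\<^sup>2)) powr p)"
proof -
  \<comment> \<open>Lowering p to q \<le> 1 only increases the integrand. Then (1+y^2)^(1-q) is at
    most 2(1 + y^(2-2q)), and division by 1+y^2 leaves the Mellin parameters 1 and 3-2q, the latter
    below 2 because q > 1/2.\<close>
  define q where "q = min p 1"
  have q: "1/2 < q" "q \<le> 1" "q \<le> p" using p by (auto simp: q_def)
  define P where "P y = norm (pos_powr (of_real (3 - 2 * q) - 1) y / of_real (y\<^sup>2 + 1\<^sup>2)) + norm (pos_powr (1 - 1) y / of_real (y\<^sup>2 + 1\<^sup>2))" for y
  have int: "integrable lborel P"
    unfolding P_def using q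
    by (intro Bochner_Integration.integrable_add integrable_norm)
       (use has_bochner_integral_Mellin_square[of "of_real (3 - 2 * q)" 1] has_bochner_integral_Mellin_square[of 1 1] in
         \<open>auto simp: has_bochner_integral_iff\<close>)
  have "integrable lborel (\<lambda>y. P (0 + (- 1) * y))"
    by (rule lborel_integrable_real_affine[OF int]) simp
  then have int2: "integrable lborel (\<lambda>y. 2 * (P y + P (- y)))"
    using int by simp
  have bound: "(1 / (1 + y\<^sup>2)) powr p \<le> 2 * P y" if y: "y > 0" for y
  proof -
    have pos: "1 + y\<^sup>2 > 0" by (simp add: add_pos_nonneg)
    have "(1 / (1 + y\<^sup>2)) powr p \<le> (1 / (1 + y\<^sup>2)) powr q"
      using q pos by (intro powr_mono') auto
    also have "\<dots> = (1 + y\<^sup>2) powr (1 - q) / (1 + y\<^sup>2)"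
      using pos by (simp add: powr_divide powr_diff)
    also have "(1 + y\<^sup>2) powr (1 - q) \<le> 2 * (1 + y powr (2 - 2 * q))"
    proof (cases "y \<le> 1")
      case True
      then have "1 + y\<^sup>2 \<le> 2" using y by (simp add: power_le_one)
      then have "(1 + y\<^sup>2) powr (1 - q) \<le> 2 powr (1 - q)"
        using q pos by (intro powr_mono2) auto
      also have "\<dots> \<le> 2 powr 1" using q by (intro powr_mono) auto
      finally show ?thesis by (simp add: add_increasing2)
    next
      case False
      then have "1 \<le> y\<^sup>2" by (simp add: one_le_power)
      then have "(1 + y\<^sup>2) powr (1 - q) \<le> (2 * y\<^sup>2) powr (1 - q)"
        using q pos by (intro powr_mono2) auto
      also have "\<dots> = 2 powr (1 - q) * y powr (2 - 2 * q)"
        using y powr_powr[of y 2 "1 - q"] by (simp add: powr_mult)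
      also have "\<dots> \<le> 2 powr 1 * y powr (2 - 2 * q)"
        using q by (intro mult_right_mono powr_mono) auto
      finally show ?thesis by simp
    qed
    then have "(1 + y\<^sup>2) powr (1 - q) / (1 + y\<^sup>2) \<le> 2 * (1 + y powr (2 - 2 * q)) / (1 + y\<^sup>2)"
      using pos by (intro divide_right_mono) auto
    also have "\<dots> = 2 * P y"
    proof -
      have "norm (complex_of_real (y\<^sup>2 + 1\<^sup>2)) = 1 + y\<^sup>2"
        unfolding norm_of_real using pos by simp
      then show ?thesis
        unfolding P_def norm_divide norm_pos_powr using y by (simp add: add_divide_distrib)
    qed
    finally show ?thesis .
  qed
  have P0: "P y \<ge> 0" for y by (simp add: P_def)
  show ?thesis
  proof (rule Bochner_Integration.integrable_bound[OF int2])
    have "AE y in lborel. (y::real) \<noteq> 0"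
      by (rule AE_lborel_singleton)
    then show "AE y in lborel. norm ((1 / (1 + y\<^sup>2)) powr p) \<le> norm (2 * (P y + P (- y)))"
    proof eventually_elim
      case (elim y)
      have "(1 / (1 + y\<^sup>2)) powr p \<le> 2 * (P y + P (- y))"
      proof (cases "y > 0")
        case True
        show ?thesis
          by (rule order_trans[OF bound[OF True]]) (use P0[of "- y"] in simp)
      next
        case False
        then have "- y > 0" using elim by simp
        from bound[OF this] P0[of y] show ?thesis by simp
      qed
      then show ?case using P0[of y] P0[of "- y"] by simp
    qed
  qed measurable
qed

lemma nn_integral_shift:
  fixes f :: "real \<Rightarrow> ennreal"
  assumes [measurable]: "f \<in> borel_measurable borel"
  shows "(\<integral>\<^sup>+ y. f (c + y) \<partial>lborel) = (\<integral>\<^sup>+ y. f y \<partial>lborel)"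
  using nn_integral_real_affine[of f 1 c] by simp

lemma emeasure_lborel_Ici: "emeasure lborel {a..} = (\<infinity> :: ennreal)" for a :: real
proof (cases "emeasure lborel {a..}" rule: ennreal_cases)
  case (real r)
  have "ennreal (r + 1) = emeasure lborel {a..a + (r + 1)}"
    using real by simp
  also have "\<dots> \<le> emeasure lborel {a..}"
    by (rule emeasure_mono) auto
  finally show ?thesis using real by simp
qed simp

text \<open>Translating by \<open>\<pi> / 2\<close> turns the sine into a cosine, and the two do not vanish
  simultaneously.\<close>

lemma nn_integral_sin_powr_infinite:
  fixes \<phi> Y p c :: real
  assumes p: "p > 0" and c: "c > 0"
  shows "(\<integral>\<^sup>+ y. indicator {Y..} y * ennreal ((c * \<bar>sin (y + \<phi>)\<bar>) powr p) \<partial>lborel) = \<infinity>"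
proof (rule ccontr)
  define h where "h \<theta> Z y = indicator {Z..} y * ennreal ((c * \<bar>sin (y + \<theta>)\<bar>) powr p)" for \<theta> Z y :: real
  have [measurable]: "h \<theta> Z \<in> borel_measurable borel" for \<theta> Z
    unfolding h_def by measurable
  assume "(\<integral>\<^sup>+ y. indicator {Y..} y * ennreal ((c * \<bar>sin (y + \<phi>)\<bar>) powr p) \<partial>lborel) \<noteq> \<infinity>"
  then have fin: "(\<integral>\<^sup>+ y. h \<phi> Y y \<partial>lborel) < \<infinity>"
    by (simp add: h_def top.not_eq_extremum)
  have "(\<integral>\<^sup>+ y. h (\<phi> + pi / 2) Y y \<partial>lborel) = (\<integral>\<^sup>+ y. h \<phi> (Y + pi / 2) (pi / 2 + y) \<partial>lborel)"
    by (intro nn_integral_cong) (auto simp: h_def indicator_def add_ac)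
  also have "\<dots> = (\<integral>\<^sup>+ y. h \<phi> (Y + pi / 2) y \<partial>lborel)"
    by (rule nn_integral_shift) measurable
  also have "\<dots> \<le> (\<integral>\<^sup>+ y. h \<phi> Y y \<partial>lborel)"
  proof (intro nn_integral_mono)
    fix y :: real
    show "h \<phi> (Y + pi / 2) y \<le> h \<phi> Y y"
    proof (cases "Y + pi / 2 \<le> y")
      case True
      then have "Y \<le> y" using pi_gt_zero by linarith
      then show ?thesis by (simp add: h_def indicator_def)
    qed (simp add: h_def)
  qed
  finally have fin2: "(\<integral>\<^sup>+ y. h (\<phi> + pi / 2) Y y \<partial>lborel) < \<infinity>"
    using fin by (rule le_less_trans)
  \<comment> \<open>At every y one of |sin| and |cos| is at least 1/2, since otherwise their squares
    would add up to less than 1/2. So the two integrands together dominate the constant d on a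
    half-line of infinite measure.\<close>
  define d where "d = (c * (1/2)) powr p"
  have "(\<integral>\<^sup>+ y. ennreal d * indicator {Y..} y \<partial>lborel) \<le> (\<integral>\<^sup>+ y. h \<phi> Y y + h (\<phi> + pi / 2) Y y \<partial>lborel)"
  proof (intro nn_integral_mono)
    fix y :: real
    define S where "S = \<bar>sin (y + \<phi>)\<bar>"
    define C where "C = \<bar>cos (y + \<phi>)\<bar>"
    have cs: "\<bar>sin (y + (\<phi> + pi / 2))\<bar> = C"
      by (simp add: C_def sin_add add.assoc[symmetric])
    have "1/2 \<le> S \<or> 1/2 \<le> C"
    proof (rule ccontr)
      assume "\<not> (1/2 \<le> S \<or> 1/2 \<le> C)"
      moreover have "S \<ge> 0" "C \<ge> 0" by (simp_all add: S_def C_def)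
      ultimately have "S\<^sup>2 < (1/2)\<^sup>2" "C\<^sup>2 < (1/2)\<^sup>2"
        by (auto intro!: power_strict_mono simp del: power_divide)
      moreover have "S\<^sup>2 + C\<^sup>2 = 1" by (simp add: S_def C_def)
      ultimately show False by (simp add: power2_eq_square)
    qed
    then have "d \<le> (c * S) powr p \<or> d \<le> (c * C) powr p"
      unfolding d_def using p c by (auto intro!: powr_mono2 mult_left_mono)
    then have "d \<le> (c * S) powr p + (c * C) powr p"
      by (elim disjE) (simp_all add: add_increasing add_increasing2)
    then have "ennreal d \<le> ennreal ((c * S) powr p + (c * C) powr p)"
      by (rule ennreal_leI)
    then have "ennreal d \<le> ennreal ((c * S) powr p) + ennreal ((c * C) powr p)"
      by (simp add: ennreal_plus)
    then show "ennreal d * indicator {Y..} y \<le> h \<phi> Y y + h (\<phi> + pi / 2) Y y"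
      unfolding h_def cs S_def[symmetric] by (auto simp: indicator_def)
  qed
  also have "\<dots> = (\<integral>\<^sup>+ y. h \<phi> Y y \<partial>lborel) + (\<integral>\<^sup>+ y. h (\<phi> + pi / 2) Y y \<partial>lborel)"
    by (rule nn_integral_add) measurable
  also have "\<dots> < \<infinity>" using fin fin2 by simp
  finally have "(\<integral>\<^sup>+ y. ennreal d * indicator {Y..} y \<partial>lborel) < \<infinity>" .
  moreover have "(\<integral>\<^sup>+ y. ennreal d * indicator {Y..} y \<partial>lborel) = ennreal d * emeasure lborel {Y..}"
    by (rule nn_integral_cmult_indicator) simp
  moreover have "d > 0" using c by (simp add: d_def)
  ultimately show False
    by (simp add: emeasure_lborel_Ici ennreal_mult_top)
qed

context admissible_params
begin

lemma countable_exceptional: "countable {y::real. sin (2 * y) = 0}"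
proof -
  have "{y::real. sin (2 * y) = 0} \<subseteq> range (\<lambda>n::int. of_int n * pi / 2)"
  proof
    fix y :: real
    assume "y \<in> {y. sin (2 * y) = 0}"
    then obtain i :: int where "2 * y = of_int i * pi"
      by (auto simp: sin_zero_iff_int2)
    then show "y \<in> range (\<lambda>n::int. of_int n * pi / 2)"
      by (intro range_eqI[of _ _ i]) simp
  qed
  then show ?thesis by (rule countable_subset) simp
qed

text \<open>Measurability is transferred from the product with the transform across a countable set,
  which avoids arguing about the series and limits in g.\<close>

lemma measurable_f_minus_g: "(\<lambda>y. f_fun k s v y - g_fun k s v y) \<in> borel_measurable borel"
proof (rule measurable_discrete_difference[OF _ countable_exceptional])
  show "(\<lambda>y. of_real (sin (y + pi * real k / 2)) * Lerch_transform k v s (2 * y)) \<in> borel_measurable borel"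
    by measurable
qed (auto simp: f_minus_g_eq)

lemma f_minus_g_in_Lp_iff:
  "(\<lambda>y. f_fun k s v y - g_fun k s v y) \<in> Lp p \<longleftrightarrow>
   (\<integral>\<^sup>+ y. ennreal (norm (of_real (sin (y + pi * real k / 2)) * Lerch_transform k v s (2 * y)) powr p) \<partial>lborel) < \<infinity>"
proof -
  have "(\<lambda>y. f_fun k s v y - g_fun k s v y) \<in> borel_measurable lebesgue"
    using measurable_f_minus_g by (intro measurable_completion) simp
  moreover have "(\<integral>\<^sup>+ y. ennreal (norm (f_fun k s v y - g_fun k s v y) powr p) \<partial>lborel)
    = (\<integral>\<^sup>+ y. ennreal (norm (of_real (sin (y + pi * real k / 2)) * Lerch_transform k v s (2 * y)) powr p) \<partial>lborel)"
  proof (rule nn_integral_cong_AE)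
    have "AE y in lborel. y \<notin> {y::real. sin (2 * y) = 0}"
      by (intro AE_not_in countable_imp_null_set_lborel countable_exceptional)
    then show "AE y in lborel. ennreal (norm (f_fun k s v y - g_fun k s v y) powr p)
      = ennreal (norm (of_real (sin (y + pi * real k / 2)) * Lerch_transform k v s (2 * y)) powr p)"
      by eventually_elim (simp add: f_minus_g_eq)
  qed
  ultimately show ?thesis
    by (simp add: Lp_def nn_integral_completion)
qed

lemma Re_s_gt: "Re s > (if k = 0 then 1 else 0)"
  using Re_s by (auto split: if_splits)

lemma Phi_eq_0_iff: "Phi ((-1) ^ k) s v = 0 \<longleftrightarrow> Lerch_moment k v s = 0"
  using Gamma_ne_0[of s] Re_s_gt by (auto simp: Phi_eq_Lerch_moment split: if_splits)

lemma in_Lp_if_moment_0: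
  assumes mom: "Lerch_moment k v s = 0" and p: "p > 1/2"
  shows "(\<lambda>y. f_fun k s v y - g_fun k s v y) \<in> Lp p"
proof -
  obtain C where C1: "\<And>x. norm (Lerch_transform k v s x) \<le> C"
    and C2: "\<And>x. x\<^sup>2 * norm (Lerch_transform k v s x - Lerch_moment k v s) \<le> C"
    by (rule Lerch_transform_tail[OF k v_pos Re_s_gt]) blast
  have C0: "C \<ge> 0" using C1[of 0] norm_ge_zero order_trans by blast
  have le: "norm (of_real (sin (y + pi * real k / 2)) * Lerch_transform k v s (2 * y)) powr p
      \<le> (2 * C) powr p * (1 / (1 + y\<^sup>2)) powr p" for y
  proof -
    define T where "T = norm (Lerch_transform k v s (2 * y))"
    \<comment> \<open>With a vanishing moment C bounds both T and 4 y^2 T, hence (1+y^2) T \<le>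
      2C.\<close>
    have T: "T \<le> C" "(2 * y)\<^sup>2 * T \<le> C" "0 \<le> T"
      using C1[of "2 * y"] C2[of "2 * y"] by (simp_all add: T_def mom)
    have "y\<^sup>2 * T \<le> (2 * y)\<^sup>2 * T"
      using T(3) by (intro mult_right_mono) (simp_all add: power2_eq_square)
    then have "(1 + y\<^sup>2) * T \<le> 2 * C"
      using T by (simp add: distrib_right)
    moreover have "1 + y\<^sup>2 > 0" by (simp add: add_pos_nonneg)
    ultimately have "T \<le> 2 * C * (1 / (1 + y\<^sup>2))"
      by (simp add: field_simps)
    moreover have "norm (of_real (sin (y + pi * real k / 2)) * Lerch_transform k v s (2 * y)) \<le> 1 * T"
      unfolding norm_mult T_def norm_of_real by (intro mult_right_mono abs_sin_le_one) auto
    ultimately have "norm (of_real (sin (y + pi * real k / 2)) * Lerch_transform k v s (2 * y)) powr p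
        \<le> (2 * C * (1 / (1 + y\<^sup>2))) powr p"
      using p by (intro powr_mono2) auto
    also have "\<dots> = (2 * C) powr p * (1 / (1 + y\<^sup>2)) powr p"
      by (rule powr_mult)
    finally show ?thesis .
  qed
  have "integrable lborel (\<lambda>y. (2 * C) powr p * (1 / (1 + y\<^sup>2)) powr p)"
    using integrable_inverse_square_powr[OF p] by simp
  then have "(\<integral>\<^sup>+ y. ennreal (norm ((2 * C) powr p * (1 / (1 + y\<^sup>2)) powr p)) \<partial>lborel) < \<infinity>"
    unfolding integrable_iff_bounded by blast
  moreover have "(\<integral>\<^sup>+ y. ennreal (norm (of_real (sin (y + pi * real k / 2)) * Lerch_transform k v s (2 * y)) powr p) \<partial>lborel)
      \<le> (\<integral>\<^sup>+ y. ennreal (norm ((2 * C) powr p * (1 / (1 + y\<^sup>2)) powr p)) \<partial>lborel)"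
    using le by (intro nn_integral_mono ennreal_leI) (simp add: abs_mult)
  ultimately show ?thesis
    unfolding f_minus_g_in_Lp_iff by (rule le_less_trans[rotated])
qed

lemma moment_0_if_in_Lp:
  assumes F: "(\<lambda>y. f_fun k s v y - g_fun k s v y) \<in> Lp p" and p: "p > 0"
  shows "Lerch_moment k v s = 0"
proof (rule ccontr)
  assume mom: "Lerch_moment k v s \<noteq> 0"
  define c where "c = norm (Lerch_moment k v s) / 2"
  have c: "c > 0" using mom by (simp add: c_def)
  obtain C where C2: "\<And>x. x\<^sup>2 * norm (Lerch_transform k v s x - Lerch_moment k v s) \<le> C"
    by (rule Lerch_transform_tail[OF k v_pos Re_s_gt]) blast
  \<comment> \<open>For y \<ge> Y one has C \<le> y c \<le> (2y)^2 c, so the transform differs from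
    the moment by at most c, half the modulus of the moment, and its own modulus is at least
    c.\<close>
  define Y where "Y = max 1 (C / c)"
  have le: "c \<le> norm (Lerch_transform k v s (2 * y))" if y: "y \<ge> Y" for y
  proof -
    have y1: "y \<ge> 1" "y \<ge> C / c" using y by (auto simp: Y_def)
    have "C / c * c \<le> y * c" using c y1 by (intro mult_right_mono) auto
    then have "C \<le> y * c" using c by simp
    also have "\<dots> \<le> (2 * y)\<^sup>2 * c"
      using c y1 by (intro mult_right_mono) (auto simp: power2_eq_square)
    finally have "(2 * y)\<^sup>2 * norm (Lerch_transform k v s (2 * y) - Lerch_moment k v s) \<le> (2 * y)\<^sup>2 * c"
      using C2[of "2 * y"] by linarith
    moreover have "(2 * y)\<^sup>2 > 0" using y1 by simp
    ultimately have "norm (Lerch_transform k v s (2 * y) - Lerch_moment k v s) \<le> c"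
      by (rule mult_left_le_imp_le)
    moreover have "norm (Lerch_moment k v s) = 2 * c" by (simp add: c_def)
    ultimately show ?thesis
      using norm_triangle_ineq2[of "Lerch_moment k v s" "Lerch_transform k v s (2 * y)"]
      by (simp add: norm_minus_commute)
  qed
  have "\<infinity> = (\<integral>\<^sup>+ y. indicator {Y..} y * ennreal ((c * \<bar>sin (y + pi * real k / 2)\<bar>) powr p) \<partial>lborel)"
    by (rule nn_integral_sin_powr_infinite[OF p c, symmetric])
  also have "\<dots> \<le> (\<integral>\<^sup>+ y. ennreal (norm (of_real (sin (y + pi * real k / 2)) * Lerch_transform k v s (2 * y)) powr p) \<partial>lborel)"
  proof (intro nn_integral_mono)
    fix y :: real
    show "indicator {Y..} y * ennreal ((c * \<bar>sin (y + pi * real k / 2)\<bar>) powr p)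
      \<le> ennreal (norm (of_real (sin (y + pi * real k / 2)) * Lerch_transform k v s (2 * y)) powr p)"
    proof (cases "y \<ge> Y")
      case True
      have "c * \<bar>sin (y + pi * real k / 2)\<bar> \<le> norm (of_real (sin (y + pi * real k / 2)) * Lerch_transform k v s (2 * y))"
        unfolding norm_mult norm_of_real using mult_right_mono[OF le[OF True], of "\<bar>sin (y + pi * real k / 2)\<bar>"]
        by (simp add: mult.commute)
      then show ?thesis
        using True p c by (auto intro!: ennreal_leI powr_mono2)
    qed simp
  qed
  also have "\<dots> < \<infinity>" using F unfolding f_minus_g_in_Lp_iff .
  finally show False by simp
qed

end

theorem corollary2p2:
  fixes k :: nat and s :: complex and v :: real
  assumes "k \<in> {0, 1}" and "v \<in> {0<..1}"
    and "(k = 0 \<and> v \<in> {0<..<1} \<and> Re s > 1 \<and> (\<forall>d::nat. Re s \<noteq> 3 + 2 * real d) \<and> s \<notin> \<nat> - {0})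
       \<or> (k = 0 \<and> v = 1 \<and> Re s \<in> (\<Union>d::nat. {1 + 2 * real d<..<2 + 2 * real d}))
       \<or> (k = 1 \<and> v \<in> {0<..1} \<and> Re s > 0 \<and> (\<forall>d::nat. Re s \<noteq> 2 + 2 * real d) \<and> s \<notin> \<nat> - {0})"
  shows "(Phi ((-1) ^ k) s v = 0 \<longrightarrow>
            (\<forall>p::real. p > 1/2 \<longrightarrow> (\<lambda>y. f_fun k s v y - g_fun k s v y) \<in> Lp p))
       \<and> ((\<exists>p::real. p > 1/2 \<and> (\<lambda>y. f_fun k s v y - g_fun k s v y) \<in> Lp p) \<longrightarrow>
            Phi ((-1) ^ k) s v = 0)"
proof -
  interpret admissible_params k s v
    by (rule admissible_params.intro) (fact assms)+
  have "Phi ((-1) ^ k) s v = 0" if "(\<lambda>y. f_fun k s v y - g_fun k s v y) \<in> Lp p" "p > 1/2" for p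
    using moment_0_if_in_Lp[OF that(1)] that(2) Phi_eq_0_iff by simp
  then show ?thesis
    using in_Lp_if_moment_0 Phi_eq_0_iff by blast
qed

end
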